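(* Let $G$ be a graph and assume that for every vertex $v\in V(G)$ the open neighborhood $N(v)$ induces a path on at least two vertices. Then $\mathcal{T}(G)\cong C_n$ for some $n\ge 3$ if and only if (i) $G\cong C_k^2$ for some $k\ge 7$; or (ii) $G\cong S_A$ or $S_B$ or $S_C$ or $S_D$; or (iii) $G$ can be obtained by a sequence of edge splittings from a graph which satisfies (i) or (ii).
   Context: All graphs are finite, simple and undirected. A triangle is a $K_3$ subgraph. The triangle graph $\mathcal{T}(G)$ of $G$ has one vertex for each triangle of $G$, two vertices being adjacent if and only if the corresponding triangles share an edge. $C_k^2$ is the square of the $k$-cycle: two vertices are adjacent iff their distance in $C_k$ is $1$ or $2$. $S_A$: vertices $v_i,u_i$ ($1\le i\le 4$); edges $v_iv_{i+1}$ and $u_iv_{i-1},u_iv_i,u_iv_{i+1}$ for $1\le i\le 4$ (subscripts of $v$ modulo 4). $S_B$: vertices $v_1,\dots,v_5,u_1,u_2,u_3$; edges $v_iv_{i+1}$ for $1\le i\le 5$, $v_3v_5$, $v_4v_1$, and $u_iv_{i-1},u_iv_i,u_iv_{i+1}$ for $1\le i\le 3$ (subscripts modulo 5). $S_C$: vertices $v_1,\dots,v_6,u_1,u_2$; edges $v_iv_{i+1}$ for $1\le i\le 6$, $v_2v_4,v_3v_5,v_4v_6,v_5v_1$, and $u_iv_{i-1},u_iv_i,u_iv_{i+1}$ for $i=1,2$ (subscripts modulo 6). $S_D$: vertices $v_1,\dots,v_6,u_1,u_4$; edges $v_iv_{i+1}$ for $1\le i\le 6$, $v_1v_3,v_2v_4,v_4v_6,v_5v_1$,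 and $u_iv_{i-1},u_iv_i,u_iv_{i+1}$ for $i=1,4$ (subscripts modulo 6). Edge splitting: suppose $e=xy$ is an edge contained in exactly one triangle $xyz$, whilst each of $xz$ and $zy$ belongs to more than one triangle. Splitting $e$ means replacing $e$ with the 3-vertex path $xwy$, where $w$ is a new vertex, and inserting the further edge $wz$. *)

theory Defs
  imports Graph_Theory.Graph_Theory
begin

definition open_neighborhood :: "'a pair_pre_digraph \<Rightarrow> 'a \<Rightarrow> 'a set" where
  "open_neighborhood G v = {u. (v, u) \<in> parcs G}"

definition path_graph :: "nat \<Rightarrow> nat pair_pre_digraph" where
  "path_graph n = mk_symmetric (with_proj
     \<lparr>pverts = {..<n}, parcs = {(i, i + 1) | i. i + 1 < n}\<rparr>)"

text \<open>This is the \<open>n\<close>-cycle only for \<open>n \<ge> 3\<close>.\<close>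

definition cycle_graph :: "nat \<Rightarrow> nat pair_pre_digraph" where
  "cycle_graph n = mk_symmetric (with_proj
     \<lparr>pverts = {..<n}, parcs = {(i, (i + 1) mod n) | i. i < n}\<rparr>)"

text \<open>With unit weights, \<^const>\<open>wf_digraph.\<mu>\<close> is the usual distance in a graph.\<close>

definition graph_square :: "'a pair_pre_digraph \<Rightarrow> 'a pair_pre_digraph" where
  "graph_square G =
     \<lparr>pverts = pverts G,
      parcs = {(u, v). u \<in> pverts G \<and> v \<in> pverts G \<and>
                 wf_digraph.\<mu> (with_proj G) (\<lambda>_. 1) u v \<in> {1, 2}}\<rparr>"

text \<open>
  In a simple graph, a \<open>K\<^sub>3\<close> subgraph is determined by its vertex set, and it is the subgraph
  induced on that set; so triangles are represented by their vertex sets.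
\<close>

definition triangles :: "'a pair_pre_digraph \<Rightarrow> 'a set set" where
  "triangles G = {T. T \<subseteq> pverts G \<and> K\<^bsub>3\<^esub> (with_proj G \<restriction> T)}"

definition triangles_on :: "'a pair_pre_digraph \<Rightarrow> 'a \<Rightarrow> 'a \<Rightarrow> 'a set set" where
  "triangles_on G x y = {T \<in> triangles G. x \<in> T \<and> y \<in> T}"

definition share_edge :: "'a pair_pre_digraph \<Rightarrow> 'a set \<Rightarrow> 'a set \<Rightarrow> bool" where
  "share_edge G S T \<longleftrightarrow> (\<exists>(x, y) \<in> parcs G. {x, y} \<subseteq> S \<inter> T)"

definition triangle_graph :: "'a pair_pre_digraph \<Rightarrow> 'a set pair_pre_digraph" where
  "triangle_graph G =
     \<lparr>pverts = triangles G,
      parcs = {(S, T). S \<in> triangles G \<and> T \<in> triangles G \<and> S \<noteq> T \<and> share_edge G S T}\<rparr>"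

datatype label = V nat | U nat

text \<open>
  The graphs \<open>S_A\<close> to \<open>S_D\<close> share one pattern: a cycle \<open>v\<^sub>1, \<dots>, v\<^sub>n\<close> with further edges
  \<open>v\<^sub>i v\<^sub>j\<close> for \<open>(i, j) \<in> E\<close>, and for each \<open>i \<in> I\<close> a vertex \<open>u\<^sub>i\<close> joined to
  \<open>v\<^sub>i\<^sub>-\<^sub>1, v\<^sub>i, v\<^sub>i\<^sub>+\<^sub>1\<close>. The subscripts of \<open>v\<close> are residues modulo \<open>n\<close>, so \<open>v\<^sub>n\<close> is \<open>V 0\<close>;
  truncated subtraction is harmless as long as \<open>0 \<notin> I\<close>.
\<close>

definition S_graph :: "nat \<Rightarrow> (nat \<times> nat) set \<Rightarrow> nat set \<Rightarrow> label pair_pre_digraph" where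
  "S_graph n E I = mk_symmetric (with_proj
     \<lparr>pverts = {V (i mod n) | i. i \<in> {1..n}} \<union> {U i | i. i \<in> I},
      parcs = {(V (i mod n), V ((i + 1) mod n)) | i. i \<in> {1..n}}
        \<union> {(V (i mod n), V (j mod n)) | i j. (i, j) \<in> E}
        \<union> {(U i, V (j mod n)) | i j. i \<in> I \<and> j \<in> {i - 1, i, i + 1}}\<rparr>)"

definition "S_A = S_graph 4 {} {1, 2, 3, 4}"
definition "S_B = S_graph 5 {(3, 5), (4, 1)} {1, 2, 3}"
definition "S_C = S_graph 6 {(2, 4), (3, 5), (4, 6), (5, 1)} {1, 2}"
definition "S_D = S_graph 6 {(1, 3), (2, 4), (4, 6), (5, 1)} {1, 4}"

definition is_cycle_square :: "'a pair_pre_digraph \<Rightarrow> bool" where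
  "is_cycle_square G \<longleftrightarrow>
     (\<exists>k \<ge> 7. digraph_iso (with_proj G) (with_proj (graph_square (cycle_graph k))))"

definition is_S_graph :: "'a pair_pre_digraph \<Rightarrow> bool" where
  "is_S_graph G \<longleftrightarrow> (\<exists>S \<in> {S_A, S_B, S_C, S_D}. digraph_iso (with_proj G) (with_proj S))"

definition edge_splitting :: "'a pair_pre_digraph \<Rightarrow> 'a pair_pre_digraph \<Rightarrow> bool" where
  "edge_splitting G H \<longleftrightarrow>
     (\<exists>x y z w. (x, y) \<in> parcs G \<and> triangles_on G x y = {{x, y, z}} \<and>
        1 < card (triangles_on G x z) \<and> 1 < card (triangles_on G z y) \<and>
        w \<notin> pverts G \<and>
        H = \<lparr>pverts = pverts (subdivide G (x, y) w),
             parcs = parcs (subdivide G (x, y) w) \<union> {(w, z), (z, w)}\<rparr>)"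

end

theory Submission
  imports Defs
begin

text \<open>If every neighbourhood induces a path, then \<open>G\<close> is a triangulated surface with boundary in which every
vertex lies on the boundary: the path induced on \<open>N(v)\<close> is the link of \<open>v\<close>, and an edge \<open>vr\<close> lies in one
triangle if \<open>r\<close> is an end of the link of \<open>v\<close> (a boundary edge), and in two triangles otherwise (an inner edge).
If moreover the triangle graph is a cycle, then each triangle has exactly one boundary edge, so that the
triangles form a closed strip, an annulus or a Moebius band. Both halves of the theorem start from this picture.

From right to left, the triangle graphs of \<open>C\<^sub>k\<^sup>2\<close> and of the four exceptional graphs are computed, and
\<open>edge_splitting_is_cycle\<close> shows that splitting an edge replaces one vertex of the cycle of triangles by two
consecutive ones.

From left to right, \<open>strip_of_cycle\<close> extracts the local description of a strip from the cycle, and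
\<open>strip_reduction\<close> is an induction on the number of vertices. Let \<open>w\<close> have degree three, with link \<open>x, z, y\<close>.
If \<open>z\<close> and \<open>w\<close> are the only common neighbours of \<open>x\<close> and \<open>y\<close>, then replacing the path \<open>x w y\<close> by an edge
\<open>xy\<close> yields a smaller strip, from which \<open>G\<close> arises by splitting \<open>xy\<close> (\<open>strip_H\<close>, \<open>edge_splitting_H\<close>).
What remains are two kinds of strips that cannot be reduced.

All degrees are at least three, since a vertex with only two neighbours would lie in a single triangle, with two
boundary edges. If no vertex has degree three, then every vertex has degree four, because among five or more
neighbours of a vertex the third one, in the order of the link, has degree three. The strip zigzags: the
link of a vertex determines how the strip continues, and following it yields a sequence \<open>g\<close> in which the link
of \<open>g(i)\<close> is \<open>g(i-2), g(i-1), g(i+1), g(i+2)\<close>. By finiteness the sequence is periodic, and its period \<open>k\<close>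
is at least \<open>7\<close> since shorter periods would add an edge to some link; so \<open>G\<close> is \<open>C\<^sub>k\<^sup>2\<close>.

If there is a vertex of degree three but none of them can be removed, then for each of them \<open>x\<close> and \<open>y\<close> have a
further common neighbour \<open>q\<close>. This forces all degrees to be at most five, so \<open>q\<close> has only three possible
positions in the link of \<open>x\<close>, and three in the link of \<open>y\<close>. Up to symmetry there are six cases,
and in each of them the strip closes up after eight vertices to one of \<open>S\<^sub>A\<close>, \<open>S\<^sub>B\<close>, \<open>S\<^sub>C\<close>, \<open>S\<^sub>D\<close>.\<close>

section \<open>Graphs and their isomorphisms\<close>

definition graph_iso_map :: "'a pair_pre_digraph \<Rightarrow> 'b pair_pre_digraph \<Rightarrow> ('a \<Rightarrow> 'b) \<Rightarrow> bool" where
  "graph_iso_map G H f \<longleftrightarrow> bij_betw f (pverts G) (pverts H) \<and>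
     (\<forall>u\<in>pverts G. \<forall>v\<in>pverts G. (u, v) \<in> parcs G \<longleftrightarrow> (f u, f v) \<in> parcs H)"

text \<open>Without parallel arcs, the arc component of an isomorphism is determined by its vertex component.\<close>

lemma digraph_iso_with_proj_iff:
  assumes G: "pair_wf_digraph G" and H: "pair_wf_digraph H"
  shows "digraph_iso (with_proj G) (with_proj H) \<longleftrightarrow> (\<exists>f. graph_iso_map G H f)"
proof
  assume "digraph_iso (with_proj G) (with_proj H)"
  then obtain h where h: "pre_digraph.digraph_isomorphism (with_proj G) h"
    and eq: "with_proj H = app_iso h (with_proj G)"
    by (auto simp: digraph_iso_def)
  define f where "f = iso_verts h"
  have "verts (with_proj H) = f ` pverts G" unfolding eq by (simp add: f_def)
  then have 1: "pverts H = f ` pverts G" by simp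
  have inj: "inj_on f (pverts G)"
    using h by (simp add: pre_digraph.digraph_isomorphism_def f_def)
  have "arcs (with_proj H) = iso_arcs h ` parcs G" unfolding eq by simp
  then have arcs: "parcs H = iso_arcs h ` parcs G" by simp
  have th: "iso_tail h = fst" "iso_head h = snd"
    using arg_cong[OF eq, of tail] arg_cong[OF eq, of head] by simp_all
  have im: "iso_arcs h (u, v) = (f u, f v)" if "(u, v) \<in> parcs G" for u v
  proof (rule prod_eqI)
    show "fst (iso_arcs h (u, v)) = fst (f u, f v)" "snd (iso_arcs h (u, v)) = snd (f u, f v)"
      using h that th unfolding pre_digraph.digraph_isomorphism_def f_def by fastforce+
  qed
  have "(u, v) \<in> parcs G \<longleftrightarrow> (f u, f v) \<in> parcs H" if uv: "u \<in> pverts G" "v \<in> pverts G" for u v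
  proof
    assume "(u, v) \<in> parcs G"
    then show "(f u, f v) \<in> parcs H" using im arcs by (metis image_eqI)
  next
    assume "(f u, f v) \<in> parcs H"
    then obtain a b where ab: "(a, b) \<in> parcs G" "(f u, f v) = iso_arcs h (a, b)"
      using arcs by auto
    then have "f u = f a" "f v = f b" using im by auto
    moreover have "a \<in> pverts G" "b \<in> pverts G"
      using pair_wf_digraph.wellformed'[OF G ab(1)] by auto
    ultimately have "u = a" "v = b" using inj uv by (auto dest: inj_onD)
    then show "(u, v) \<in> parcs G" using ab by simp
  qed
  then show "\<exists>f. graph_iso_map G H f"
    using 1 inj unfolding graph_iso_map_def bij_betw_def by blast
next
  assume "\<exists>f. graph_iso_map G H f"
  then obtain f where b: "bij_betw f (pverts G) (pverts H)"
    and e: "\<And>u v. u \<in> pverts G \<Longrightarrow> v \<in> pverts G \<Longrightarrow> (u, v) \<in> parcs G \<longleftrightarrow> (f u, f v) \<in> parcs H"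
    unfolding graph_iso_map_def by blast
  define h where "h = \<lparr>iso_verts = f, iso_arcs = map_prod f f, iso_head = snd, iso_tail = fst\<rparr>"
  have wf: "wf_digraph (with_proj G)"
    using G by unfold_locales (auto dest: pair_wf_digraph.wellformed')
  have sub: "parcs G \<subseteq> pverts G \<times> pverts G" "parcs H \<subseteq> pverts H \<times> pverts H"
    using G H by (auto dest: pair_wf_digraph.wellformed')
  have inj: "inj_on f (pverts G)" and im: "f ` pverts G = pverts H"
    using b by (auto simp: bij_betw_def)
  have "inj_on (map_prod f f) (parcs G)"
    by (rule inj_on_subset[OF map_prod_inj_on[OF inj inj] sub(1)])
  then have 1: "pre_digraph.digraph_isomorphism (with_proj G) h"
    unfolding pre_digraph.digraph_isomorphism_def using wf inj by (simp add: h_def)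
  have "map_prod f f ` parcs G = parcs H"
  proof (intro equalityI subrelI)
    fix u v assume "(u, v) \<in> map_prod f f ` parcs G"
    then obtain a b where "(a, b) \<in> parcs G" "u = f a" "v = f b" by auto
    then show "(u, v) \<in> parcs H" using e sub by blast
  next
    fix u v assume uv: "(u, v) \<in> parcs H"
    then obtain a b where "a \<in> pverts G" "b \<in> pverts G" "u = f a" "v = f b"
      using sub im by blast
    then have "(a, b) \<in> parcs G" "(u, v) = map_prod f f (a, b)" using uv e by auto
    then show "(u, v) \<in> map_prod f f ` parcs G" by (metis image_eqI)
  qed
  then have "with_proj H = app_iso h (with_proj G)"
    using im by (simp add: app_iso_def with_proj_def h_def)
  then show "digraph_iso (with_proj G) (with_proj H)" using 1 unfolding digraph_iso_def by blast
qed

lemma induce_subgraph_with_proj: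
  "with_proj G \<restriction> S = with_proj \<lparr>pverts = S, parcs = {(u, v) \<in> parcs G. u \<in> S \<and> v \<in> S}\<rparr>"
  by (auto simp: induce_subgraph_def with_proj_def)

lemma pair_graphI:
  assumes "finite (pverts G)" "parcs G \<subseteq> pverts G \<times> pverts G"
    and "\<And>u v. (u, v) \<in> parcs G \<Longrightarrow> (v, u) \<in> parcs G" "\<And>v. (v, v) \<notin> parcs G"
  shows "pair_graph G"
proof -
  have "finite (parcs G)" using assms by (meson finite_SigmaI finite_subset)
  moreover have "fst e \<noteq> snd e" if "e \<in> parcs G" for e
    using assms(4) that by (metis prod.collapse)
  ultimately show ?thesis using assms
    by unfold_locales (auto simp: symmetric_def sym_def)
qed

context
  fixes G :: "'a pair_pre_digraph"
  assumes G: "pair_graph G"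
begin

lemma pair_graph_sym: "(u, v) \<in> parcs G \<longleftrightarrow> (v, u) \<in> parcs G"
proof -
  interpret pair_graph G by (rule G)
  show ?thesis using pair_sym_arcs by (auto simp: symmetric_def sym_def)
qed

lemma pair_graph_irrefl: "(v, v) \<notin> parcs G"
proof -
  interpret pair_graph G by (rule G)
  show ?thesis using pair_no_loops[of "(v, v)"] by auto
qed

lemma pair_graph_in_verts: "(u, v) \<in> parcs G \<Longrightarrow> u \<in> pverts G \<and> v \<in> pverts G"
proof -
  interpret pair_graph G by (rule G)
  show "(u, v) \<in> parcs G \<Longrightarrow> u \<in> pverts G \<and> v \<in> pverts G" using wellformed' by blast
qed

lemma pair_graph_finite: "finite (pverts G)"
proof -
  interpret pair_graph G by (rule G)
  show ?thesis using pair_finite_verts .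
qed

lemma pair_graph_wf: "pair_wf_digraph G"
proof -
  interpret pair_graph G by (rule G)
  show ?thesis ..
qed

end

section \<open>Induced paths\<close>

text \<open>Adjacency of \<open>a\<close> to the rest is compared with \<open>b = hd ps\<close>, so the predicate also forbids chords; the
recursion allows adjacency and distinctness to be read off from explicit lists.\<close>

fun induced_path :: "'a pair_pre_digraph \<Rightarrow> 'a list \<Rightarrow> bool" where
  "induced_path G [] \<longleftrightarrow> True"
| "induced_path G (a # ps) \<longleftrightarrow>
     a \<notin> set ps \<and> (\<forall>b\<in>set ps. (a, b) \<in> parcs G \<longleftrightarrow> b = hd ps) \<and> induced_path G ps"

lemma induced_path_distinct: "induced_path G ps \<Longrightarrow> distinct ps"
  by (induction ps) auto

lemma induced_path_cong:
  assumes "\<And>u v. u \<in> set ps \<Longrightarrow> v \<in> set ps \<Longrightarrow> (u, v) \<in> parcs G \<longleftrightarrow> (u, v) \<in> parcs H"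
  shows "induced_path G ps \<longleftrightarrow> induced_path H ps"
  using assms by (induction ps) auto

text \<open>This is what permits cutting a vertex out of the middle of a path.\<close>

lemma induced_path_append:
  assumes "pair_graph G"
  shows "induced_path G (ps @ qs) \<longleftrightarrow> induced_path G ps \<and> induced_path G qs \<and>
    set ps \<inter> set qs = {} \<and>
    (\<forall>a\<in>set ps. \<forall>b\<in>set qs. (a, b) \<in> parcs G \<longleftrightarrow> a = last ps \<and> b = hd qs)"
proof (induction ps)
  case Nil
  then show ?case by simp
next
  case (Cons a ps)
  show ?case
  proof (cases "ps = []")
    case True
    then show ?thesis by auto
  next
    case False
    then have hl: "hd ps \<in> set ps" "last ps \<in> set ps" by auto
    show ?thesis
    proof (cases "set ps \<inter> set qs = {} \<and> a \<notin> set ps")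
      case disj: True
      then have "hd ps \<notin> set qs" "a \<noteq> last ps" using hl by auto
      then have "(\<forall>b\<in>set qs. (a, b) \<in> parcs G \<longleftrightarrow> b = hd ps) \<longleftrightarrow>
          (\<forall>b\<in>set qs. (a, b) \<in> parcs G \<longleftrightarrow> a = last ps \<and> b = hd qs)" by auto
      then have h1: "(\<forall>b\<in>set (ps @ qs). (a, b) \<in> parcs G \<longleftrightarrow> b = hd ps) \<longleftrightarrow>
          (\<forall>b\<in>set ps. (a, b) \<in> parcs G \<longleftrightarrow> b = hd ps) \<and>
          (\<forall>b\<in>set qs. (a, b) \<in> parcs G \<longleftrightarrow> a = last ps \<and> b = hd qs)" by (simp add: ball_Un)
      have h2: "last (a # ps) = last ps" using False by simp
      have h3: "a \<notin> set (ps @ qs) \<longleftrightarrow> a \<notin> set qs" "insert a (set ps) \<inter> set qs = {} \<longleftrightarrow> a \<notin> set qs"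
        using disj by auto
      have h4: "hd (ps @ qs) = hd ps" using False by simp
      show ?thesis
        unfolding append_Cons induced_path.simps h4 Cons.IH list.set(2) ball_simps h1 h2 h3
        using disj by argo
    next
      case False
      then show ?thesis by (auto simp: Cons.IH)
    qed
  qed
qed

lemma induced_path_rev:
  assumes "pair_graph G"
  shows "induced_path G (rev ps) \<longleftrightarrow> induced_path G ps"
proof (induction ps)
  case (Cons a ps)
  show ?case
    by (auto simp: induced_path_append[OF assms] Cons last_rev pair_graph_sym[OF assms, of a])
qed simp

lemma induced_path_nth:
  assumes "pair_graph G"
  shows "induced_path G ps \<longleftrightarrow> distinct ps \<and>
    (\<forall>i<length ps. \<forall>j<i. (ps ! j, ps ! i) \<in> parcs G \<longleftrightarrow> i = Suc j)"
proof (induction ps)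
  case (Cons a ps)
  have "(\<forall>i<length (a # ps). \<forall>j<i. ((a # ps) ! j, (a # ps) ! i) \<in> parcs G \<longleftrightarrow> i = Suc j)
    \<longleftrightarrow> (\<forall>i<length ps. (a, ps ! i) \<in> parcs G \<longleftrightarrow> i = 0) \<and>
        (\<forall>i<length ps. \<forall>j<i. (ps ! j, ps ! i) \<in> parcs G \<longleftrightarrow> i = Suc j)" (is "?L = ?R")
    by (auto simp: All_less_Suc2)
  moreover have "(\<forall>i<length ps. (a, ps ! i) \<in> parcs G \<longleftrightarrow> i = 0) \<longleftrightarrow>
      (\<forall>b\<in>set ps. (a, b) \<in> parcs G \<longleftrightarrow> b = hd ps)" if "distinct ps"
  proof (cases ps)
    case (Cons b bs)
    then show ?thesis using that
      by (auto simp: all_set_conv_all_nth hd_conv_nth nth_eq_iff_index_eq All_less_Suc2)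
  qed simp
  ultimately show ?case using Cons by (auto dest: induced_path_distinct)
qed simp

definition link :: "'a pair_pre_digraph \<Rightarrow> 'a \<Rightarrow> 'a list \<Rightarrow> bool" where
  "link G v ps \<longleftrightarrow> v \<in> pverts G \<and> set ps = open_neighborhood G v \<and> induced_path G ps"

lemma link_rev: "pair_graph G \<Longrightarrow> link G v (rev ps) \<longleftrightarrow> link G v ps"
  by (simp add: link_def induced_path_rev)

lemma path_graph_arcs: "(i, j) \<in> parcs (path_graph m) \<longleftrightarrow> i < m \<and> j < m \<and> (j = Suc i \<or> i = Suc j)"
  by (auto simp: path_graph_def parcs_mk_symmetric)

lemma path_graph_verts: "pverts (path_graph m) = {..<m}"
  by (simp add: path_graph_def)

lemma cycle_graph_arcs: "(i, j) \<in> parcs (cycle_graph n) \<longleftrightarrow>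
    i < n \<and> j < n \<and> (j = Suc i mod n \<or> i = Suc j mod n)"
  by (cases "n = 0") (auto simp: cycle_graph_def parcs_mk_symmetric)

lemma cycle_graph_verts: "pverts (cycle_graph n) = {..<n}"
  by (simp add: cycle_graph_def)

lemma pair_graph_path_graph: "pair_graph (path_graph m)"
  by (rule pair_graphI) (auto simp: path_graph_arcs path_graph_verts)

lemma pair_graph_cycle_graph: "2 \<le> n \<Longrightarrow> pair_graph (cycle_graph n)"
  by (rule pair_graphI) (auto simp: cycle_graph_arcs cycle_graph_verts mod_Suc split: if_splits)

lemma link_of_path_neighborhood:
  assumes G: "pair_graph G" and v: "v \<in> pverts G"
    and iso: "digraph_iso (with_proj G \<restriction> open_neighborhood G v) (with_proj (path_graph m))"
  shows "\<exists>ps. link G v ps \<and> length ps = m"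
proof -
  let ?N = "open_neighborhood G v"
  let ?I = "\<lparr>pverts = ?N, parcs = {(u, v) \<in> parcs G. u \<in> ?N \<and> v \<in> ?N}\<rparr>"
  have "pair_wf_digraph ?I" by unfold_locales auto
  then obtain f where f: "graph_iso_map ?I (path_graph m) f"
    using iso digraph_iso_with_proj_iff pair_graph_wf[OF pair_graph_path_graph]
    unfolding induce_subgraph_with_proj by blast
  then have b: "bij_betw f ?N {..<m}"
    and e: "\<And>a b. a \<in> ?N \<Longrightarrow> b \<in> ?N \<Longrightarrow> (a, b) \<in> parcs G \<longleftrightarrow> (f a, f b) \<in> parcs (path_graph m)"
    by (auto simp: graph_iso_map_def path_graph_verts)
  define g where "g = inv_into ?N f"
  have g: "bij_betw g {..<m} ?N" unfolding g_def by (rule bij_betw_inv_into[OF b])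
  have fg: "f (g i) = i" if "i < m" for i
    using b that unfolding g_def by (simp add: bij_betw_inv_into_right)
  have gN: "g i \<in> ?N" if "i < m" for i using g that by (auto simp: bij_betw_def)
  define ps where "ps = map g [0..<m]"
  have "set ps = ?N" using g by (simp add: ps_def bij_betw_def atLeast0LessThan)
  moreover have "induced_path G ps"
  proof -
    have "distinct ps" using g by (simp add: ps_def distinct_map bij_betw_def atLeast0LessThan)
    moreover have "(ps ! j, ps ! i) \<in> parcs G \<longleftrightarrow> i = Suc j" if "i < m" "j < i" for i j
      using that e[of "g j" "g i"] by (auto simp: ps_def gN fg path_graph_arcs)
    ultimately show ?thesis using induced_path_nth[OF G] by (simp add: ps_def)
  qed
  ultimately show ?thesis using v by (auto simp: link_def ps_def intro!: exI[of _ ps])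
qed

section \<open>Triangles\<close>

lemma triangles_iff:
  assumes G: "pair_graph G"
  shows "T \<in> triangles G \<longleftrightarrow>
    (\<exists>a b c. T = {a, b, c} \<and> (a, b) \<in> parcs G \<and> (b, c) \<in> parcs G \<and> (a, c) \<in> parcs G)"
    (is "?L \<longleftrightarrow> ?R")
proof
  assume ?L
  then have "card T = 3" and e: "{(u, v) \<in> parcs G. u \<in> T \<and> v \<in> T} = {(u, v). u \<in> T \<and> v \<in> T \<and> u \<noteq> v}"
    by (auto simp: triangles_def induce_subgraph_with_proj complete_digraph_pair_def)
  then obtain a b c where T: "T = {a, b, c}" and "a \<noteq> b" "b \<noteq> c" "a \<noteq> c"
    by (auto simp: card_3_iff)
  moreover have "(u, v) \<in> parcs G" if "u \<in> T" "v \<in> T" "u \<noteq> v" for u v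
    using that e by blast
  ultimately show ?R by blast
next
  assume ?R
  then obtain a b c where T: "T = {a, b, c}"
    and e: "(a, b) \<in> parcs G" "(b, c) \<in> parcs G" "(a, c) \<in> parcs G" by blast
  note [simp] = pair_graph_irrefl[OF G]
  have "a \<noteq> b" "b \<noteq> c" "a \<noteq> c" using e by auto
  moreover have "(b, a) \<in> parcs G" "(c, b) \<in> parcs G" "(c, a) \<in> parcs G"
    using e pair_graph_sym[OF G] by blast+
  moreover have "T \<subseteq> pverts G" using e pair_graph_in_verts[OF G] T by blast
  ultimately show ?L using e T
    by (auto simp: triangles_def induce_subgraph_with_proj complete_digraph_pair_def)
qed

lemma triangle_card: "T \<in> triangles G \<Longrightarrow> card T = 3 \<and> finite T"
  by (auto simp: triangles_def induce_subgraph_with_proj complete_digraph_pair_def)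

lemma triangle_arc:
  assumes "T \<in> triangles G" "a \<in> T" "b \<in> T" "a \<noteq> b"
  shows "(a, b) \<in> parcs G"
proof -
  have "{(u, v) \<in> parcs G. u \<in> T \<and> v \<in> T} = {(u, v). u \<in> T \<and> v \<in> T \<and> u \<noteq> v}"
    using assms by (auto simp: triangles_def induce_subgraph_with_proj complete_digraph_pair_def)
  then show ?thesis using assms by blast
qed

lemma triangle_third:
  assumes "T \<in> triangles G" "a \<in> T" "b \<in> T" "a \<noteq> b"
  obtains c where "T = {a, b, c}" "c \<noteq> a" "c \<noteq> b" "(a, c) \<in> parcs G" "(b, c) \<in> parcs G"
proof -
  have "card (T - {a, b}) = 1" using triangle_card[OF assms(1)] assms by (simp add: card_Diff_subset)
  then obtain c where "T - {a, b} = {c}" by (auto simp: card_1_singleton_iff)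
  then have "T = {a, b, c}" "c \<noteq> a" "c \<noteq> b" using assms by blast+
  then show ?thesis using that triangle_arc[OF assms(1)] by blast
qed

text \<open>Adjacency in the triangle graph, freed from the graph: two vertices of a triangle are always adjacent.
So it survives changes of the graph elsewhere.\<close>

definition overlap :: "'a set \<Rightarrow> 'a set \<Rightarrow> bool" where
  "overlap S T \<longleftrightarrow> S \<noteq> T \<and> (\<exists>a b. a \<noteq> b \<and> a \<in> S \<inter> T \<and> b \<in> S \<inter> T)"

lemma overlapI: "S \<noteq> T \<Longrightarrow> a \<noteq> b \<Longrightarrow> a \<in> S \<Longrightarrow> a \<in> T \<Longrightarrow> b \<in> S \<Longrightarrow> b \<in> T \<Longrightarrow> overlap S T"
  by (auto simp: overlap_def)

lemma overlap_sym: "overlap S T \<longleftrightarrow> overlap T S"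
  by (auto simp: overlap_def)

lemma triangle_graph_verts: "pverts (triangle_graph G) = triangles G"
  by (simp add: triangle_graph_def)

lemma triangle_graph_arcs:
  assumes "pair_graph G"
  shows "(S, T) \<in> parcs (triangle_graph G) \<longleftrightarrow> S \<in> triangles G \<and> T \<in> triangles G \<and> overlap S T"
proof -
  have "share_edge G S T \<longleftrightarrow> (\<exists>a b. a \<noteq> b \<and> a \<in> S \<inter> T \<and> b \<in> S \<inter> T)" if "S \<in> triangles G"
  proof
    assume "share_edge G S T"
    then obtain a b where "(a, b) \<in> parcs G" "{a, b} \<subseteq> S \<inter> T" by (auto simp: share_edge_def)
    then show "\<exists>a b. a \<noteq> b \<and> a \<in> S \<inter> T \<and> b \<in> S \<inter> T"
      using pair_graph_irrefl[OF assms, of a] by (intro exI[of _ a] exI[of _ b]) auto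
  next
    assume "\<exists>a b. a \<noteq> b \<and> a \<in> S \<inter> T \<and> b \<in> S \<inter> T"
    then obtain a b where "a \<noteq> b" "a \<in> S \<inter> T" "b \<in> S \<inter> T" by blast
    then show "share_edge G S T"
      unfolding share_edge_def using triangle_arc[OF that, of a b] by (intro bexI[of _ "(a, b)"]) auto
  qed
  then show ?thesis unfolding triangle_graph_def overlap_def by fastforce
qed

lemma pair_graph_triangle_graph:
  assumes "pair_graph G"
  shows "pair_graph (triangle_graph G)"
proof (rule pair_graphI)
  have "triangles G \<subseteq> Pow (pverts G)" by (auto simp: triangles_def)
  then show "finite (pverts (triangle_graph G))"
    using pair_graph_finite[OF assms] by (simp add: triangle_graph_verts finite_subset)
  show "parcs (triangle_graph G) \<subseteq> pverts (triangle_graph G) \<times> pverts (triangle_graph G)"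
    by (auto simp: triangle_graph_def)
  show "(S, T) \<in> parcs (triangle_graph G) \<Longrightarrow> (T, S) \<in> parcs (triangle_graph G)" for S T
    unfolding triangle_graph_arcs[OF assms] by (simp add: overlap_sym[of S])
  show "(S, S) \<notin> parcs (triangle_graph G)" for S
    unfolding triangle_graph_arcs[OF assms] by (simp add: overlap_def)
qed

lemma graph_iso_map_triangles:
  assumes G: "pair_graph G" and H: "pair_graph H" and f: "graph_iso_map G H f"
  shows "graph_iso_map (triangle_graph G) (triangle_graph H) ((`) f)"
proof -
  have inj: "inj_on f (pverts G)" and im: "f ` pverts G = pverts H"
    and e: "\<And>u v. u \<in> pverts G \<Longrightarrow> v \<in> pverts G \<Longrightarrow> (u, v) \<in> parcs G \<longleftrightarrow> (f u, f v) \<in> parcs H"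
    using f by (auto simp: graph_iso_map_def bij_betw_def)
  have sub: "T \<subseteq> pverts G" if "T \<in> triangles G" for T using that by (simp add: triangles_def)
  have inj2: "inj_on ((`) f) (triangles G)"
    using inj sub by (auto simp: inj_on_def inj_on_image_eq_iff)
  have "(`) f ` triangles G = triangles H"
  proof (intro equalityI subsetI)
    fix T assume "T \<in> (`) f ` triangles G"
    then obtain a b c where T: "T = f ` {a, b, c}" and
      abc: "(a, b) \<in> parcs G" "(b, c) \<in> parcs G" "(a, c) \<in> parcs G"
      using triangles_iff[OF G] by auto
    then have "a \<in> pverts G" "b \<in> pverts G" "c \<in> pverts G" using pair_graph_in_verts[OF G] by auto
    then have "(f a, f b) \<in> parcs H" "(f b, f c) \<in> parcs H" "(f a, f c) \<in> parcs H"
      using abc e by auto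
    moreover have "T = {f a, f b, f c}" using T by simp
    ultimately show "T \<in> triangles H" unfolding triangles_iff[OF H] by blast
  next
    fix T assume "T \<in> triangles H"
    then obtain a b c where T: "T = {a, b, c}" "(a, b) \<in> parcs H" "(b, c) \<in> parcs H" "(a, c) \<in> parcs H"
      using triangles_iff[OF H] by auto
    then have "a \<in> f ` pverts G" "b \<in> f ` pverts G" "c \<in> f ` pverts G"
      using pair_graph_in_verts[OF H] im by auto
    then obtain a' b' c' where "a = f a'" "b = f b'" "c = f c'" "a' \<in> pverts G" "b' \<in> pverts G" "c' \<in> pverts G"
      by blast
    then have "T = f ` {a', b', c'}" "(a', b') \<in> parcs G" "(b', c') \<in> parcs G" "(a', c') \<in> parcs G"
      using T e by auto
    moreover from this have "{a', b', c'} \<in> triangles G" using triangles_iff[OF G] by blast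
    ultimately have "T = f ` {a', b', c'}" "{a', b', c'} \<in> triangles G" by blast+
    then show "T \<in> (`) f ` triangles G" by blast
  qed
  moreover have "overlap S T \<longleftrightarrow> overlap (f ` S) (f ` T)" if "S \<in> triangles G" "T \<in> triangles G" for S T
  proof -
    have "f ` S = f ` T \<longleftrightarrow> S = T" using inj_on_image_eq_iff[OF inj sub[OF that(1)] sub[OF that(2)]] .
    moreover have "f ` S \<inter> f ` T = f ` (S \<inter> T)"
      using inj_on_image_Int[OF inj sub[OF that(1)] sub[OF that(2)]] by simp
    moreover have "(\<exists>a b. a \<noteq> b \<and> a \<in> f ` (S \<inter> T) \<and> b \<in> f ` (S \<inter> T)) \<longleftrightarrow>
        (\<exists>a b. a \<noteq> b \<and> a \<in> S \<inter> T \<and> b \<in> S \<inter> T)" (is "?A \<longleftrightarrow> ?B")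
    proof
      assume ?A
      then obtain a b where "f a \<noteq> f b" "a \<in> S \<inter> T" "b \<in> S \<inter> T" by blast
      then show ?B by (intro exI[of _ a] exI[of _ b]) auto
    next
      assume ?B
      then obtain a b where ab: "a \<noteq> b" "a \<in> S \<inter> T" "b \<in> S \<inter> T" by blast
      then have "f a \<noteq> f b" using inj_onD[OF inj, of a b] sub[OF that(1)] by blast
      then show ?A using ab by blast
    qed
    ultimately show ?thesis by (simp add: overlap_def)
  qed
  ultimately show ?thesis using inj2
    by (auto simp: graph_iso_map_def bij_betw_def triangle_graph_verts triangle_graph_arcs G H)
qed

section \<open>Graphs isomorphic to a cycle\<close>

lemma graph_iso_map_inv:
  assumes "graph_iso_map G H f"
  shows "graph_iso_map H G (inv_into (pverts G) f)"
proof -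
  let ?g = "inv_into (pverts G) f"
  have b: "bij_betw f (pverts G) (pverts H)"
    and e: "\<And>u v. u \<in> pverts G \<Longrightarrow> v \<in> pverts G \<Longrightarrow> (u, v) \<in> parcs G \<longleftrightarrow> (f u, f v) \<in> parcs H"
    using assms by (auto simp: graph_iso_map_def)
  have g: "bij_betw ?g (pverts H) (pverts G)" by (rule bij_betw_inv_into[OF b])
  have "f (?g u) = u" "?g u \<in> pverts G" if "u \<in> pverts H" for u
    using that b g bij_betw_inv_into_right[OF b] by (auto simp: bij_betw_def)
  then show ?thesis using g e by (auto simp: graph_iso_map_def)
qed

lemma graph_iso_map_comp:
  assumes "graph_iso_map G H f" "graph_iso_map H K g"
  shows "graph_iso_map G K (g \<circ> f)"
proof -
  have "f v \<in> pverts H" if "v \<in> pverts G" for v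
    using assms(1) that by (auto simp: graph_iso_map_def bij_betw_def)
  then show ?thesis using assms by (auto simp: graph_iso_map_def intro: bij_betw_trans)
qed

text \<open>A cycle cut open at the vertex \<open>t\<close>. In this form a cycle is lengthened by a list operation, without
arithmetic modulo its length.\<close>

definition cyclic_order :: "'a pair_pre_digraph \<Rightarrow> 'a \<Rightarrow> 'a list \<Rightarrow> bool" where
  "cyclic_order K t ps \<longleftrightarrow> induced_path K ps \<and> t \<notin> set ps \<and> 2 \<le> length ps \<and>
     pverts K = insert t (set ps) \<and> (\<forall>s\<in>set ps. (t, s) \<in> parcs K \<longleftrightarrow> s = hd ps \<or> s = last ps)"

definition is_cycle :: "'a pair_pre_digraph \<Rightarrow> bool" where
  "is_cycle K \<longleftrightarrow> (\<exists>n\<ge>3. digraph_iso (with_proj K) (with_proj (cycle_graph n)))"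

lemma is_cycle_iff:
  assumes K: "pair_graph K"
  shows "is_cycle K \<longleftrightarrow> (\<exists>n\<ge>3. \<exists>f. graph_iso_map K (cycle_graph n) f)"
proof -
  have "digraph_iso (with_proj K) (with_proj (cycle_graph n)) \<longleftrightarrow> (\<exists>f. graph_iso_map K (cycle_graph n) f)"
    if "3 \<le> n" for n
    using that by (intro digraph_iso_with_proj_iff pair_graph_wf K pair_graph_cycle_graph) simp
  then show ?thesis unfolding is_cycle_def by blast
qed

text \<open>Any vertex can serve as the cutting point, by rotating the given numbering of the cycle.\<close>

lemma is_cycle_cyclic_order:
  assumes K: "pair_graph K" and cyc: "is_cycle K" and t: "t \<in> pverts K"
  shows "\<exists>ps. cyclic_order K t ps"
proof -
  obtain n f where n: "3 \<le> n" and f: "graph_iso_map K (cycle_graph n) f"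
    using is_cycle_iff[OF K] cyc by blast
  let ?g = "inv_into (pverts K) f"
  have g: "graph_iso_map (cycle_graph n) K ?g" by (rule graph_iso_map_inv[OF f])
  then have gb: "bij_betw ?g {..<n} (pverts K)"
    and ge: "\<And>i j. i < n \<Longrightarrow> j < n \<Longrightarrow> (?g i, ?g j) \<in> parcs K \<longleftrightarrow> j = Suc i mod n \<or> i = Suc j mod n"
    by (auto simp: graph_iso_map_def cycle_graph_verts cycle_graph_arcs)
  define c where "c = f t"
  have c: "c < n" "?g c = t"
    using f t by (auto simp: graph_iso_map_def bij_betw_def c_def cycle_graph_verts)
  define h where "h i = ?g ((c + i) mod n)" for i
  have h0: "h 0 = t" using c by (simp add: h_def)
  have eq: "(c + i) mod n = (c + j) mod n \<longleftrightarrow> i = j" if "i < n" "j < n" for i j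
  proof -
    have "i = j" if "(c + i) mod n = (c + j) mod n" "i \<le> j" "j < n" for i j
    proof -
      have "n dvd (c + j) - (c + i)" using that by (metis add_le_mono1 add.commute mod_eq_dvd_iff_nat)
      then show ?thesis using that by (auto dest: dvd_imp_le)
    qed
    then show ?thesis using that by (metis nat_le_linear)
  qed
  have sm: "Suc ((c + i) mod n) mod n = (c + (if Suc i = n then 0 else Suc i)) mod n" if "i < n" for i
    using that by (auto simp: mod_Suc_eq) (metis add_Suc_right mod_add_self2)
  have he: "(h i, h j) \<in> parcs K \<longleftrightarrow> j = (if Suc i = n then 0 else Suc i) \<or> i = (if Suc j = n then 0 else Suc j)"
    if "i < n" "j < n" for i j
  proof -
    have "(if Suc i = n then 0 else Suc i) < n" "(if Suc j = n then 0 else Suc j) < n" using that by auto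
    moreover have "(c + i) mod n < n" "(c + j) mod n < n" using n by auto
    ultimately show ?thesis using that unfolding h_def by (simp only: ge sm eq)
  qed
  have hinj: "h i = h j \<longleftrightarrow> i = j" if "i < n" "j < n" for i j
    using gb eq[OF that] n unfolding h_def bij_betw_def by (auto dest!: inj_onD)
  have him: "h ` {..<n} = pverts K"
  proof -
    have "(\<lambda>i. (c + i) mod n) ` {..<n} \<subseteq> {..<n}" using n by auto
    moreover have "inj_on (\<lambda>i. (c + i) mod n) {..<n}" using eq by (auto simp: inj_on_def)
    ultimately have "(\<lambda>i. (c + i) mod n) ` {..<n} = {..<n}" by (metis endo_inj_surj finite_lessThan)
    then show ?thesis using gb unfolding h_def bij_betw_def using image_image[of ?g "\<lambda>i. (c + i) mod n" "{..<n}"] by simp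
  qed
  define ps where "ps = map h [1..<n]"
  have len: "length ps = n - 1" and nth: "\<And>i. i < n - 1 \<Longrightarrow> ps ! i = h (Suc i)"
    by (auto simp: ps_def)
  have set: "set ps = h ` {1..<n}" by (simp add: ps_def)
  have hd: "hd ps = h 1" and last: "last ps = h (n - 1)"
    using n by (simp_all add: ps_def hd_map last_map)
  have "distinct ps" using hinj by (auto simp: ps_def distinct_map inj_on_def)
  moreover have "(ps ! j, ps ! i) \<in> parcs K \<longleftrightarrow> i = Suc j" if "i < n - 1" "j < i" for i j
    using that by (auto simp: nth he)
  ultimately have "induced_path K ps"
    unfolding induced_path_nth[OF K] by (simp add: len)
  moreover have "t \<notin> set ps"
  proof
    assume "t \<in> set ps"
    then obtain j where "h 0 = h j" "1 \<le> j" "j < n" by (auto simp: set h0)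
    then show False using hinj[of 0 j] n by simp
  qed
  moreover have "pverts K = insert t (set ps)"
  proof -
    have "{..<n} = insert 0 {1..<n}" using n by auto
    then show ?thesis unfolding him[symmetric] set by (simp add: h0)
  qed
  moreover have "(t, s) \<in> parcs K \<longleftrightarrow> s = hd ps \<or> s = last ps" if s: "s \<in> set ps" for s
  proof -
    obtain j where j: "s = h j" "1 \<le> j" "j < n" using s unfolding set by auto
    then show ?thesis unfolding hd last h0[symmetric] using n by (auto simp: he hinj)
  qed
  ultimately show ?thesis using n by (auto simp: cyclic_order_def len)
qed

lemma cyclic_order_is_cycle:
  assumes K: "pair_graph K" and c: "cyclic_order K t ps"
  shows "is_cycle K"
proof -
  define n where "n = Suc (length ps)"
  have n: "3 \<le> n" using c by (simp add: n_def cyclic_order_def)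
  define l where "l = t # ps"
  have ps: "induced_path K ps" "t \<notin> set ps" "2 \<le> length ps" "pverts K = insert t (set ps)"
    and t: "\<And>s. s \<in> set ps \<Longrightarrow> (t, s) \<in> parcs K \<longleftrightarrow> s = hd ps \<or> s = last ps"
    using c by (auto simp: cyclic_order_def)
  have l: "distinct l" "set l = pverts K" "length l = n"
    using ps induced_path_distinct[OF ps(1)] by (auto simp: l_def n_def)
  have ne: "ps \<noteq> []" using ps by auto
  have e: "(l ! i, l ! j) \<in> parcs K \<longleftrightarrow> j = Suc i \<or> i = 0 \<and> j = n - 1" if "i < j" "j < n" for i j
  proof (cases i)
    case 0
    define j' where "j' = j - 1"
    have j': "j = Suc j'" "j' < length ps" using that by (auto simp: n_def j'_def)
    have "ps ! j' = hd ps \<longleftrightarrow> j' = 0" "ps ! j' = last ps \<longleftrightarrow> j' = length ps - 1"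
      using j' induced_path_distinct[OF ps(1)] ne
      by (simp_all add: hd_conv_nth last_conv_nth nth_eq_iff_index_eq)
    then show ?thesis using t[of "ps ! j'"] j' 0 by (auto simp: l_def n_def)
  next
    case (Suc i')
    define j' where "j' = j - 1"
    have j': "j = Suc j'" "j' < length ps" using that by (auto simp: n_def j'_def)
    then show ?thesis using ps(1) that Suc unfolding induced_path_nth[OF K] by (auto simp: l_def)
  qed
  have "graph_iso_map (cycle_graph n) K ((!) l)"
    unfolding graph_iso_map_def
  proof (intro conjI ballI)
    show "bij_betw ((!) l) (pverts (cycle_graph n)) (pverts K)"
      using bij_betw_nth[OF l(1), of "{..<n}" "pverts K"] l by (simp add: cycle_graph_verts)
    fix i j assume "i \<in> pverts (cycle_graph n)" "j \<in> pverts (cycle_graph n)"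
    then have ij: "i < n" "j < n" by (auto simp: cycle_graph_verts)
    show "(i, j) \<in> parcs (cycle_graph n) \<longleftrightarrow> (l ! i, l ! j) \<in> parcs K"
    proof (cases i j rule: linorder_cases)
      case less
      then show ?thesis using e[of i j] ij by (auto simp: cycle_graph_arcs mod_Suc)
    next
      case equal
      then show ?thesis using n pair_graph_irrefl[OF K] pair_graph_irrefl[OF pair_graph_cycle_graph, of n] by simp
    next
      case greater
      then show ?thesis using e[of j i] ij pair_graph_sym[OF K, of "l ! i" "l ! j"]
        by (auto simp: cycle_graph_arcs mod_Suc)
    qed
  qed
  from graph_iso_map_inv[OF this] show ?thesis
    using n is_cycle_iff[OF K] by blast
qed

lemma cyclic_order_rev:
  assumes "pair_graph K" "cyclic_order K t ps"
  shows "cyclic_order K t (rev ps)"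
proof -
  have "ps \<noteq> []" using assms by (auto simp: cyclic_order_def)
  then show ?thesis using assms by (auto simp: cyclic_order_def induced_path_rev hd_rev last_rev)
qed

lemma is_cycle_triangle_graph_iso:
  assumes G: "pair_graph G" and H: "pair_graph H" and iso: "digraph_iso (with_proj G) (with_proj H)"
    and cyc: "is_cycle (triangle_graph H)"
  shows "is_cycle (triangle_graph G)"
proof -
  note wf = pair_graph_wf[OF pair_graph_triangle_graph[OF G]] pair_graph_wf[OF pair_graph_triangle_graph[OF H]]
  obtain f where "graph_iso_map G H f"
    using iso digraph_iso_with_proj_iff[OF pair_graph_wf[OF G] pair_graph_wf[OF H]] by blast
  then have f: "graph_iso_map (triangle_graph G) (triangle_graph H) ((`) f)"
    by (rule graph_iso_map_triangles[OF G H])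
  obtain n where n: "3 \<le> n" "digraph_iso (with_proj (triangle_graph H)) (with_proj (cycle_graph n))"
    using cyc by (auto simp: is_cycle_def)
  have wfn: "pair_wf_digraph (cycle_graph n)" using n(1) by (intro pair_graph_wf pair_graph_cycle_graph) simp
  obtain g where "graph_iso_map (triangle_graph H) (cycle_graph n) g"
    using n(2) digraph_iso_with_proj_iff[OF wf(2) wfn] by blast
  then have "graph_iso_map (triangle_graph G) (cycle_graph n) (g \<circ> (`) f)"
    using graph_iso_map_comp[OF f] by blast
  then have "digraph_iso (with_proj (triangle_graph G)) (with_proj (cycle_graph n))"
    using digraph_iso_with_proj_iff[OF wf(1) wfn] by blast
  then show ?thesis using n(1) by (auto simp: is_cycle_def)
qed

section \<open>Edge splitting lengthens the cycle\<close>

lemma other_triangle_on: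
  assumes "1 < card (triangles_on G u v)"
  obtains T where "T \<in> triangles_on G u v" "T \<noteq> S"
proof -
  have "\<not> triangles_on G u v \<subseteq> {S}"
    using assms card_mono[of "{S}" "triangles_on G u v"] by auto
  then show ?thesis using that by blast
qed

text \<open>The split triangle \<open>t = xyz\<close> is replaced by \<open>p = xwz\<close> and \<open>q = wyz\<close>, which share the edge \<open>wz\<close>. The
triangle \<open>t\<close> has only two neighbours in the cycle; since \<open>xz\<close> and \<open>zy\<close> each lie in a second
triangle, one neighbour meets \<open>t\<close> in \<open>xz\<close> and the other in \<open>zy\<close>. So \<open>p\<close> and \<open>q\<close> each inherit exactly one of
them, and the cycle is one vertex longer.\<close>

lemma edge_splitting_is_cycle:
  assumes G: "pair_graph G" and split: "edge_splitting G H" and cyc: "is_cycle (triangle_graph G)"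
  shows "pair_graph H \<and> is_cycle (triangle_graph H)"
proof -
  obtain x y z w where xy: "(x, y) \<in> parcs G" and on: "triangles_on G x y = {{x, y, z}}"
    and xz2: "1 < card (triangles_on G x z)" and zy2: "1 < card (triangles_on G z y)"
    and w: "w \<notin> pverts G"
    and H_def: "H = \<lparr>pverts = pverts (subdivide G (x, y) w),
             parcs = parcs (subdivide G (x, y) w) \<union> {(w, z), (z, w)}\<rparr>"
    using split unfolding edge_splitting_def by blast
  note sym = pair_graph_sym[OF G] and irr = pair_graph_irrefl[OF G]
  define t where "t = {x, y, z}"
  have t: "t \<in> triangles G" using on by (auto simp: triangles_on_def t_def)
  have "card t = 3" using triangle_card[OF t] by simp
  then have d: "x \<noteq> y" "x \<noteq> z" "y \<noteq> z" by (auto simp: t_def card_insert_if split: if_splits)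
  have e: "(x, z) \<in> parcs G" "(y, z) \<in> parcs G"
    using triangle_arc[OF t] d by (auto simp: t_def)
  have xyzV: "x \<in> pverts G" "y \<in> pverts G" "z \<in> pverts G"
    using xy e pair_graph_in_verts[OF G] by blast+
  have dw: "w \<noteq> x" "w \<noteq> y" "w \<noteq> z" using w xyzV by auto
  have HV: "pverts H = insert w (pverts G)" by (simp add: H_def subdivide.simps)
  have HE: "parcs H = (parcs G - {(x, y), (y, x)}) \<union>
      {(x, w), (w, x), (w, y), (y, w), (w, z), (z, w)}"
    by (auto simp: H_def subdivide.simps)
  have H: "pair_graph H"
  proof (rule pair_graphI)
    show "finite (pverts H)" using pair_graph_finite[OF G] by (simp add: HV)
    show "parcs H \<subseteq> pverts H \<times> pverts H"
      using pair_graph_in_verts[OF G] xyzV by (auto simp: HV HE)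
    show "(u, v) \<in> parcs H \<Longrightarrow> (v, u) \<in> parcs H" for u v using sym by (auto simp: HE)
    show "(u, u) \<notin> parcs H" for u using irr dw by (auto simp: HE)
  qed
  have wE: "(w, u) \<in> parcs H \<longleftrightarrow> u \<in> {x, y, z}" for u
    using pair_graph_in_verts[OF G] w by (auto simp: HE)
  have uvE: "(u, v) \<in> parcs H \<longleftrightarrow> (u, v) \<in> parcs G \<and> {u, v} \<noteq> {x, y}" if "u \<noteq> w" "v \<noteq> w" for u v
    using that by (auto simp: HE doubleton_eq_iff)
  define p q where "p = {x, w, z}" and "q = {w, y, z}"
  have wT: "w \<notin> T" if "T \<in> triangles G" for T using w that by (auto simp: triangles_def)
  have xyT: "T = t" if "T \<in> triangles G" "x \<in> T" "y \<in> T" for T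
    using that on by (auto simp: triangles_on_def t_def)
  have TH: "triangles H = {p, q} \<union> (triangles G - {t})"
  proof (intro equalityI subsetI)
    fix T assume T: "T \<in> triangles H"
    show "T \<in> {p, q} \<union> (triangles G - {t})"
    proof (cases "w \<in> T")
      case True
      have "card (T - {w}) = 2" using True triangle_card[OF T] by simp
      then obtain a b where ab: "T - {w} = {a, b}" "a \<noteq> b" by (meson card_2_iff)
      then have Tw: "T = {w, a, b}" "a \<noteq> w" "b \<noteq> w" using True by auto
      have "(w, a) \<in> parcs H" "(w, b) \<in> parcs H" "(a, b) \<in> parcs H"
        using triangle_arc[OF T] Tw ab by auto
      then have "a \<in> {x, y, z}" "b \<in> {x, y, z}" "{a, b} \<noteq> {x, y}" using wE uvE Tw by auto
      then show ?thesis using ab Tw by (auto simp: p_def q_def)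
    next
      case False
      obtain a b c where abc: "T = {a, b, c}" "(a, b) \<in> parcs H" "(b, c) \<in> parcs H" "(a, c) \<in> parcs H"
        using T triangles_iff[OF H] by auto
      then have "(a, b) \<in> parcs G" "(b, c) \<in> parcs G" "(a, c) \<in> parcs G"
        using False uvE by auto
      then have TG: "T \<in> triangles G" using triangles_iff[OF G] abc by blast
      have "T \<noteq> t"
      proof
        assume "T = t"
        then have "(x, y) \<in> parcs H" using triangle_arc[OF T, of x y] d by (auto simp: t_def)
        then show False using uvE dw by auto
      qed
      then show ?thesis using TG by simp
    qed
  next
    fix T assume "T \<in> {p, q} \<union> (triangles G - {t})"
    then consider "T = p" | "T = q" | "T \<in> triangles G" "T \<noteq> t" by fast
    then show "T \<in> triangles H"
    proof cases
      case 1
      moreover have "(x, w) \<in> parcs H" "(w, z) \<in> parcs H" "(x, z) \<in> parcs H"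
        using e dw d by (simp_all add: HE)
      ultimately show ?thesis unfolding triangles_iff[OF H] p_def by fast
    next
      case 2
      moreover have "(w, y) \<in> parcs H" "(y, z) \<in> parcs H" "(w, z) \<in> parcs H"
        using e dw d by (simp_all add: HE)
      ultimately show ?thesis unfolding triangles_iff[OF H] q_def by fast
    next
      case 3
      then obtain a b c where abc: "T = {a, b, c}" "(a, b) \<in> parcs G" "(b, c) \<in> parcs G" "(a, c) \<in> parcs G"
        using triangles_iff[OF G] by auto
      have ns: "\<not> (x \<in> T \<and> y \<in> T)" using xyT 3 by blast
      have "(u, v) \<in> parcs H" if "(u, v) \<in> parcs G" "u \<in> T" "v \<in> T" for u v
      proof -
        have "{u, v} \<noteq> {x, y}" using ns that(2,3) by (auto simp: doubleton_eq_iff)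
        moreover have "u \<noteq> w" "v \<noteq> w" using wT[OF 3(1)] that(2,3) by auto
        ultimately show ?thesis using uvE that(1) by simp
      qed
      then show ?thesis unfolding triangles_iff[OF H] using abc by blast
    qed
  qed
  let ?K = "triangle_graph G" and ?L = "triangle_graph H"
  have K: "pair_graph ?K" and L: "pair_graph ?L"
    using pair_graph_triangle_graph G H by blast+
  obtain A where A: "A \<in> triangles G" "x \<in> A" "z \<in> A" "A \<noteq> t"
    using other_triangle_on[OF xz2, of t] unfolding triangles_on_def by blast
  obtain B where B: "B \<in> triangles G" "z \<in> B" "y \<in> B" "B \<noteq> t"
    using other_triangle_on[OF zy2, of t] unfolding triangles_on_def by blast
  \<comment> \<open>A triangle containing both edges would contain \<open>x\<close> and \<open>y\<close>, hence be \<open>t\<close>.\<close>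
  have AB: "A \<noteq> B" using xyT A B by blast
  have adj: "(S, T) \<in> parcs ?K \<longleftrightarrow> S \<in> triangles G \<and> T \<in> triangles G \<and> overlap S T" for S T
    by (rule triangle_graph_arcs[OF G])
  have tAdj: "(t, T) \<in> parcs ?K" if "T \<in> triangles G" "T \<noteq> t" "z \<in> T" "x \<in> T \<or> y \<in> T" for T
  proof -
    have "overlap t T"
      using that(4)
    proof
      assume "x \<in> T"
      then show ?thesis using that d by (intro overlapI[of t T x z]) (auto simp: t_def)
    next
      assume "y \<in> T"
      then show ?thesis using that d by (intro overlapI[of t T y z]) (auto simp: t_def)
    qed
    then show ?thesis using that(1) t by (simp add: adj)
  qed
  \<comment> \<open>Traverse the cycle in the direction in which \<open>B\<close> follows \<open>t\<close>.\<close>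
  obtain ps where ps: "cyclic_order ?K t ps" and hdB: "hd ps = B"
  proof -
    obtain ps where ps: "cyclic_order ?K t ps"
      using is_cycle_cyclic_order[OF K cyc] t by (auto simp: triangle_graph_verts)
    have "B = hd ps \<or> B = last ps"
      using ps tAdj[of B] B by (auto simp: cyclic_order_def triangle_graph_verts)
    moreover have "ps \<noteq> []" using ps by (auto simp: cyclic_order_def)
    ultimately show ?thesis
      using that[OF ps] that[OF cyclic_order_rev[OF K ps]] by (auto simp: hd_rev)
  qed
  have ip: "induced_path ?K ps" and tps: "t \<notin> set ps" and len: "2 \<le> length ps"
    and V: "triangles G = insert t (set ps)"
    and tE: "\<And>s. s \<in> set ps \<Longrightarrow> (t, s) \<in> parcs ?K \<longleftrightarrow> s = hd ps \<or> s = last ps"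
    using ps by (auto simp: cyclic_order_def triangle_graph_verts)
  have ne: "ps \<noteq> []" using len by auto
  have lastA: "last ps = A"
    using tE[of A] tAdj[of A] A AB hdB V by auto
  have sps: "s \<in> triangles G" "s \<noteq> t" if "s \<in> set ps" for s using that V tps by auto
  have zAB: "s = A \<or> s = B" if "s \<in> set ps" "z \<in> s" "x \<in> s \<or> y \<in> s" for s
    using tE[OF that(1)] tAdj[OF sps[OF that(1)] that(2,3)] hdB lastA by metis
  have "y \<notin> A" "x \<notin> B" using xyT[of A] xyT[of B] A B by auto
  then have onA: "x \<in> s \<and> z \<in> s \<longleftrightarrow> s = A" and onB: "y \<in> s \<and> z \<in> s \<longleftrightarrow> s = B"
    if "s \<in> set ps" for s
    using zAB[OF that] A(2,3) B(2,3) by metis+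
  have pq: "p \<noteq> q" using d dw by (auto simp: p_def q_def)
  have pqps: "p \<notin> set ps" "q \<notin> set ps" using sps wT by (auto simp: p_def q_def)
  have Lverts: "triangles H = insert p (insert q (set ps))" using TH V tps by auto
  have Ladj: "(S, T) \<in> parcs ?L \<longleftrightarrow> S \<in> triangles H \<and> T \<in> triangles H \<and> overlap S T" for S T
    by (rule triangle_graph_arcs[OF H])
  have pE: "(p, s) \<in> parcs ?L \<longleftrightarrow> s = A" if s: "s \<in> set ps" for s
  proof -
    have "overlap p s \<longleftrightarrow> x \<in> s \<and> z \<in> s"
      using wT[OF sps(1)[OF s]] d by (auto simp: overlap_def p_def)
    then show ?thesis using onA[OF s] s by (auto simp: Ladj Lverts)
  qed
  have qE: "(q, s) \<in> parcs ?L \<longleftrightarrow> s = B" if s: "s \<in> set ps" for s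
  proof -
    have "overlap q s \<longleftrightarrow> y \<in> s \<and> z \<in> s"
      using wT[OF sps(1)[OF s]] d by (auto simp: overlap_def q_def)
    then show ?thesis using onB[OF s] s by (auto simp: Ladj Lverts)
  qed
  have "overlap p q" using pq dw by (intro overlapI[of p q w z]) (auto simp: p_def q_def)
  then have pqE: "(p, q) \<in> parcs ?L" by (simp add: Ladj Lverts)
  have "induced_path ?L ps \<longleftrightarrow> induced_path ?K ps"
    by (rule induced_path_cong) (auto simp: Ladj adj Lverts V)
  then have "induced_path ?L (q # ps)" using ip pqps qE hdB by simp
  then have "cyclic_order ?L p (q # ps)"
    unfolding cyclic_order_def using pq pqps len ne pE pqE lastA Lverts A(1,4) V
    by (auto simp: triangle_graph_verts)
  then show ?thesis using cyclic_order_is_cycle[OF L] H by blast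
qed

section \<open>The four exceptional graphs\<close>

lemma S_graph_verts: "pverts (S_graph n E I) = (\<lambda>i. V (i mod n)) ` {1..n} \<union> U ` I"
  by (auto simp: S_graph_def)

definition sym_closure :: "('a \<times> 'a) set \<Rightarrow> ('a \<times> 'a) set" where
  "sym_closure A = A \<union> (\<lambda>(u, v). (v, u)) ` A"

lemma sym_closure_insert: "sym_closure (insert (a, b) A) = insert (a, b) (insert (b, a) (sym_closure A))"
  and sym_closure_empty: "sym_closure {} = {}"
  by (auto simp: sym_closure_def)

lemma insert_Image: "insert (a, b) A `` {v} = (if a = v then insert b (A `` {v}) else A `` {v})"
  by auto

lemma open_neighborhood_image: "open_neighborhood G v = parcs G `` {v}"
  by (auto simp: open_neighborhood_def)

lemma parcs_mk_symmetric_with_proj: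
  "parcs (mk_symmetric (with_proj \<lparr>pverts = P, parcs = A\<rparr>)) = sym_closure A"
  by (auto simp: parcs_mk_symmetric sym_closure_def)

text \<open>Images instead of set comprehensions, so that the arc sets of the concrete graphs can be computed.\<close>

lemma S_graph_arcs: "parcs (S_graph n E I) = sym_closure
    ((\<lambda>i. (V (i mod n), V ((i + 1) mod n))) ` {1..n} \<union>
     (\<lambda>(i, j). (V (i mod n), V (j mod n))) ` E \<union>
     (\<Union>i\<in>I. {(U i, V ((i - 1) mod n)), (U i, V (i mod n)), (U i, V ((i + 1) mod n))}))"
proof -
  let ?A = "{(V (i mod n), V ((i + 1) mod n)) | i. i \<in> {1..n}}
        \<union> {(V (i mod n), V (j mod n)) | i j. (i, j) \<in> E}
        \<union> {(U i, V (j mod n)) | i j. i \<in> I \<and> j \<in> {i - 1, i, i + 1}}"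
  have "parcs (S_graph n E I) = sym_closure ?A"
    by (simp only: S_graph_def parcs_mk_symmetric_with_proj)
  moreover have "{(V (i mod n), V ((i + 1) mod n)) | i. i \<in> {1..n}} =
      (\<lambda>i. (V (i mod n), V ((i + 1) mod n))) ` {1..n}" by (rule Setcompr_eq_image)
  moreover have "{(V (i mod n), V (j mod n)) | i j. (i, j) \<in> E} = (\<lambda>(i, j). (V (i mod n), V (j mod n))) ` E"
    by (auto simp: image_iff)
  moreover have "{(U i, V (j mod n)) | i j. i \<in> I \<and> j \<in> {i - 1, i, i + 1}} =
      (\<Union>i\<in>I. {(U i, V ((i - 1) mod n)), (U i, V (i mod n)), (U i, V ((i + 1) mod n))})"
    by auto
  ultimately show ?thesis by (simp only:)
qed

lemma upto_4: "{1..4::nat} = {1, 2, 3, 4}" and upto_5: "{1..5::nat} = {1, 2, 3, 4, 5}"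
  and upto_6: "{1..6::nat} = {1, 2, 3, 4, 5, 6}"
  by auto

lemma S_A_arcs: "parcs S_A = sym_closure {(V 1, V 2), (V 2, V 3), (V 3, V 0), (V 0, V 1),
    (U 1, V 0), (U 1, V 1), (U 1, V 2), (U 2, V 1), (U 2, V 2), (U 2, V 3),
    (U 3, V 2), (U 3, V 3), (U 3, V 0), (U 4, V 3), (U 4, V 0), (U 4, V 1)}"
  unfolding S_A_def S_graph_arcs upto_4 by (rule arg_cong[of _ _ sym_closure], rule subset_antisym) simp_all

lemma S_B_arcs: "parcs S_B = sym_closure {(V 1, V 2), (V 2, V 3), (V 3, V 4), (V 4, V 0), (V 0, V 1),
    (V 3, V 0), (V 4, V 1),
    (U 1, V 0), (U 1, V 1), (U 1, V 2), (U 2, V 1), (U 2, V 2), (U 2, V 3),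
    (U 3, V 2), (U 3, V 3), (U 3, V 4)}"
  unfolding S_B_def S_graph_arcs upto_5 by (rule arg_cong[of _ _ sym_closure], rule subset_antisym) simp_all

lemma S_C_arcs: "parcs S_C = sym_closure {(V 1, V 2), (V 2, V 3), (V 3, V 4), (V 4, V 5), (V 5, V 0), (V 0, V 1),
    (V 2, V 4), (V 3, V 5), (V 4, V 0), (V 5, V 1),
    (U 1, V 0), (U 1, V 1), (U 1, V 2), (U 2, V 1), (U 2, V 2), (U 2, V 3)}"
  unfolding S_C_def S_graph_arcs upto_6 by (rule arg_cong[of _ _ sym_closure], rule subset_antisym) simp_all

lemma S_D_arcs: "parcs S_D = sym_closure {(V 1, V 2), (V 2, V 3), (V 3, V 4), (V 4, V 5), (V 5, V 0), (V 0, V 1),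
    (V 1, V 3), (V 2, V 4), (V 4, V 0), (V 5, V 1),
    (U 1, V 0), (U 1, V 1), (U 1, V 2), (U 4, V 3), (U 4, V 4), (U 4, V 5)}"
  unfolding S_D_def S_graph_arcs upto_6 by (rule arg_cong[of _ _ sym_closure], rule subset_antisym) simp_all

lemma S_A_verts: "pverts S_A = {V 1, V 2, V 3, V 0, U 1, U 2, U 3, U 4}"
  and S_B_verts: "pverts S_B = {V 1, V 2, V 3, V 4, V 0, U 1, U 2, U 3}"
  and S_C_verts: "pverts S_C = {V 1, V 2, V 3, V 4, V 5, V 0, U 1, U 2}"
  and S_D_verts: "pverts S_D = {V 1, V 2, V 3, V 4, V 5, V 0, U 1, U 4}"
  unfolding S_A_def S_B_def S_C_def S_D_def S_graph_verts upto_4 upto_5 upto_6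
  by (rule subset_antisym; simp)+

lemma S_nbrs:
  "open_neighborhood S_A (V 0) = {V 1, V 3, U 1, U 3, U 4}"
  "open_neighborhood S_A (V 1) = {V 0, V 2, U 1, U 2, U 4}"
  "open_neighborhood S_A (V 2) = {V 1, V 3, U 1, U 2, U 3}"
  "open_neighborhood S_A (V 3) = {V 0, V 2, U 2, U 3, U 4}"
  "open_neighborhood S_A (U 1) = {V 0, V 1, V 2}"
  "open_neighborhood S_A (U 2) = {V 1, V 2, V 3}"
  "open_neighborhood S_A (U 3) = {V 2, V 3, V 0}"
  "open_neighborhood S_A (U 4) = {V 3, V 0, V 1}"
  "open_neighborhood S_B (V 0) = {V 1, V 3, V 4, U 1}"
  "open_neighborhood S_B (V 1) = {V 0, V 2, V 4, U 1, U 2}"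
  "open_neighborhood S_B (V 2) = {V 1, V 3, U 1, U 2, U 3}"
  "open_neighborhood S_B (V 3) = {V 0, V 2, V 4, U 2, U 3}"
  "open_neighborhood S_B (V 4) = {V 0, V 1, V 3, U 3}"
  "open_neighborhood S_B (U 1) = {V 0, V 1, V 2}"
  "open_neighborhood S_B (U 2) = {V 1, V 2, V 3}"
  "open_neighborhood S_B (U 3) = {V 2, V 3, V 4}"
  "open_neighborhood S_C (V 0) = {V 1, V 4, V 5, U 1}"
  "open_neighborhood S_C (V 1) = {V 0, V 2, V 5, U 1, U 2}"
  "open_neighborhood S_C (V 2) = {V 1, V 3, V 4, U 1, U 2}"
  "open_neighborhood S_C (V 3) = {V 2, V 4, V 5, U 2}"
  "open_neighborhood S_C (V 4) = {V 0, V 2, V 3, V 5}"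
  "open_neighborhood S_C (V 5) = {V 0, V 1, V 3, V 4}"
  "open_neighborhood S_C (U 1) = {V 0, V 1, V 2}"
  "open_neighborhood S_C (U 2) = {V 1, V 2, V 3}"
  "open_neighborhood S_D (V 0) = {V 1, V 4, V 5, U 1}"
  "open_neighborhood S_D (V 1) = {V 0, V 2, V 3, V 5, U 1}"
  "open_neighborhood S_D (V 2) = {V 1, V 3, V 4, U 1}"
  "open_neighborhood S_D (V 3) = {V 1, V 2, V 4, U 4}"
  "open_neighborhood S_D (V 4) = {V 0, V 2, V 3, V 5, U 4}"
  "open_neighborhood S_D (V 5) = {V 0, V 1, V 4, U 4}"
  "open_neighborhood S_D (U 1) = {V 0, V 1, V 2}"
  "open_neighborhood S_D (U 4) = {V 3, V 4, V 5}"
  by (simp_all only: open_neighborhood_image S_A_arcs S_B_arcs S_C_arcs S_D_arcs sym_closure_insert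
      sym_closure_empty)
    (rule subset_antisym; simp add: insert_Image)+

lemma sym_closure_sym: "(u, v) \<in> sym_closure A \<Longrightarrow> (v, u) \<in> sym_closure A"
  by (auto simp: sym_closure_def)

lemma pair_graph_S:
  assumes "S \<in> {S_A, S_B, S_C, S_D}"
  shows "pair_graph S"
proof (rule pair_graphI)
  show "finite (pverts S)" "parcs S \<subseteq> pverts S \<times> pverts S" "(v, v) \<notin> parcs S" for v
    using assms by (elim insertE; simp add: S_A_arcs S_B_arcs S_C_arcs S_D_arcs sym_closure_insert
      sym_closure_empty S_A_verts S_B_verts S_C_verts S_D_verts; fail)+
  show "(u, v) \<in> parcs S \<Longrightarrow> (v, u) \<in> parcs S" for u v
    using assms sym_closure_sym by (auto simp: S_A_arcs S_B_arcs S_C_arcs S_D_arcs)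
qed

lemma overlap_card:
  assumes "card S = 3" "card T = 3"
  shows "overlap S T \<longleftrightarrow> card (S \<inter> T) = 2"
proof -
  have fin: "finite S" "finite T" using assms by (auto intro: card_ge_0_finite)
  have "S = T \<longleftrightarrow> card (S \<inter> T) = 3"
    using assms fin by (metis card_subset_eq inf.cobounded1 inf.cobounded2 inf.idem)
  moreover have "card (S \<inter> T) \<le> 3" using assms card_mono[OF fin(1), of "S \<inter> T"] by simp
  moreover have "(\<exists>a b. a \<noteq> b \<and> a \<in> S \<inter> T \<and> b \<in> S \<inter> T) \<longleftrightarrow> \<not> card (S \<inter> T) \<le> Suc 0"
    using fin by (subst card_le_Suc0_iff_eq) auto
  ultimately have "overlap S T \<longleftrightarrow> card (S \<inter> T) \<noteq> 3 \<and> \<not> card (S \<inter> T) \<le> Suc 0"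
    unfolding overlap_def by (simp only:)
  then show ?thesis using \<open>card (S \<inter> T) \<le> 3\<close> by linarith
qed

text \<open>Triangles as triples of labels: whether two triangles are equal or share an edge is decided by counting
common corners, without equations between explicit sets.\<close>

fun corners_in :: "'a \<times> 'a \<times> 'a \<Rightarrow> 'a \<times> 'a \<times> 'a \<Rightarrow> nat" where
  "corners_in (a, b, c) (x, y, z) = (if a = x \<or> a = y \<or> a = z then 1 else 0) +
     (if b = x \<or> b = y \<or> b = z then 1 else 0) + (if c = x \<or> c = y \<or> c = z then 1 else 0)"

fun corners :: "'a \<times> 'a \<times> 'a \<Rightarrow> 'a set" where
  "corners (a, b, c) = {a, b, c}"

fun strip_path :: "('a \<times> 'a \<times> 'a) list \<Rightarrow> bool" where
  "strip_path [] \<longleftrightarrow> True"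
| "strip_path [t] \<longleftrightarrow> True"
| "strip_path (s # t # ts) \<longleftrightarrow> corners_in s t = 2 \<and> (\<forall>r\<in>set ts. corners_in s r < 2) \<and> strip_path (t # ts)"

lemma corners_in_card:
  assumes "card (corners s) = 3"
  shows "corners_in s t = card (corners s \<inter> corners t)"
proof -
  obtain a b c where s: "s = (a, b, c)" by (cases s)
  obtain x y z where t: "t = (x, y, z)" by (cases t)
  have "a \<noteq> b" "a \<noteq> c" "b \<noteq> c" using assms by (auto simp: s card_insert_if split: if_splits)
  then show ?thesis unfolding s t by (simp add: Int_insert_left)
qed

lemma set_hd_last_inner: "2 \<le> length xs \<Longrightarrow> set xs = {hd xs, last xs} \<union> set (butlast (tl xs))"
  by (cases xs; cases "tl xs" rule: rev_cases) auto

text \<open>A criterion for concrete graphs that can be checked by simplification: \<open>t # ts\<close> lists all triangles, and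
exactly those that are consecutive, in the cyclic sense, have two common corners.\<close>

lemma is_cycle_triangle_graphI:
  assumes S: "pair_graph S"
    and tri: "\<forall>(a, b, c)\<in>set (t # ts). b \<in> open_neighborhood S a \<and>
      c \<in> open_neighborhood S b \<and> c \<in> open_neighborhood S a"
    and sub: "\<forall>a\<in>pverts S. \<forall>b\<in>open_neighborhood S a. \<forall>c\<in>open_neighborhood S b.
      c \<in> open_neighborhood S a \<longrightarrow> (\<exists>r\<in>set (t # ts). corners_in (a, b, c) r = 3)"
    and path: "strip_path ts" "2 \<le> length ts"
    and closed: "corners_in t (hd ts) = 2" "corners_in t (last ts) = 2"
      "\<forall>r\<in>set (butlast (tl ts)). corners_in t r < 2"
  shows "is_cycle (triangle_graph S)"
proof (rule cyclic_order_is_cycle)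
  let ?K = "triangle_graph S"
  show "pair_graph ?K" by (rule pair_graph_triangle_graph[OF S])
  have T: "corners r \<in> triangles S" if "r \<in> set (t # ts)" for r
  proof -
    obtain a b c where "r = (a, b, c)" by (cases r)
    then show ?thesis using tri that unfolding triangles_iff[OF S] open_neighborhood_def by fastforce
  qed
  have card: "card (corners r) = 3" "finite (corners r)" if "r \<in> set (t # ts)" for r
    using triangle_card[OF T[OF that]] by simp_all
  have V: "triangles S = corners ` set (t # ts)"
  proof (intro equalityI subsetI)
    fix T assume T': "T \<in> triangles S"
    then obtain a b c where abc: "T = {a, b, c}" "(a, b) \<in> parcs S" "(b, c) \<in> parcs S" "(a, c) \<in> parcs S"
      using triangles_iff[OF S] by auto
    then obtain r where r: "r \<in> set (t # ts)" "corners_in (a, b, c) r = 3"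
      using sub pair_graph_in_verts[OF S, of a b] unfolding open_neighborhood_def by blast
    have "card T = 3" "finite T" using triangle_card[OF T'] by auto
    then have "card (T \<inter> corners r) = 3" using r(2) corners_in_card[of "(a, b, c)" r] abc(1) by simp
    then have "T = corners r"
      using \<open>card T = 3\<close> \<open>finite T\<close> card[OF r(1)] by (metis card_subset_eq inf.cobounded1 inf.cobounded2)
    then show "T \<in> corners ` set (t # ts)" using r(1) by blast
  qed (use T in blast)
  have adj: "(corners r, corners s) \<in> parcs ?K \<longleftrightarrow> corners_in r s = 2"
    if "r \<in> set (t # ts)" "s \<in> set (t # ts)" for r s
    using that overlap_card[of "corners r" "corners s"] T card corners_in_card[of r s]
    unfolding triangle_graph_arcs[OF S] by auto
  have ne: "corners r \<noteq> corners s" if "r \<in> set (t # ts)" "corners_in r s \<le> 2" for r s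
    using that(2) card[OF that(1)] corners_in_card[of r s] by auto
  have "induced_path ?K (map corners us)" if "strip_path us" "set us \<subseteq> set (t # ts)" for us
    using that
  proof (induction us rule: strip_path.induct)
    case (3 s u us)
    have mem: "s \<in> set (t # ts)" "u \<in> set (t # ts)" using 3(3) by auto
    have memr: "r \<in> set (t # ts)" if "r \<in> set us" for r using 3(3) that by auto
    have c: "corners_in s u = 2" "\<And>r. r \<in> set us \<Longrightarrow> corners_in s r < 2" using 3(2) by auto
    have "induced_path ?K (map corners (u # us))" using 3 by simp
    moreover have "corners s \<notin> set (map corners (u # us))"
    proof
      assume "corners s \<in> set (map corners (u # us))"
      then obtain r where r: "r \<in> set (u # us)" "corners s = corners r" unfolding set_map by blast
      then have "corners_in s r \<le> 2" using c(1) c(2)[of r] by (cases "r = u") simp_all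
      then show False using ne[OF mem(1)] r(2) by blast
    qed
    moreover have "(corners s, B) \<in> parcs ?K \<longleftrightarrow> B = corners u" if B: "B \<in> set (map corners (u # us))" for B
    proof -
      obtain r where r: "r \<in> set (u # us)" "B = corners r" using B unfolding set_map by blast
      show ?thesis
      proof (cases "r \<in> set us")
        case True
        then have "corners_in s r < 2" by (rule c(2))
        moreover have "corners r \<noteq> corners u"
          using calculation c(1) card[OF mem(1)] corners_in_card[of s u] corners_in_card[of s r] by auto
        ultimately show ?thesis using adj[OF mem(1) memr[OF True]] r(2) by simp
      next
        case False
        then show ?thesis using adj[OF mem] c(1) r by simp
      qed
    qed
    ultimately show ?case by simp
  qed auto
  then have ip: "induced_path ?K (map corners ts)" using path(1) by auto
  have tne: "ts \<noteq> []" using path(2) by auto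
  note split = set_hd_last_inner[OF path(2)]
  have "corners t \<notin> corners ` set ts"
  proof
    assume "corners t \<in> corners ` set ts"
    then obtain r where r: "r \<in> set ts" "corners t = corners r" by blast
    then have "r = hd ts \<or> r = last ts \<or> r \<in> set (butlast (tl ts))" using split by blast
    then have "corners_in t r \<le> 2" using closed(1,2) bspec[OF closed(3), of r]
      by (elim disjE) simp_all
    then show False using ne[of t r] r(2) by simp
  qed
  moreover have "(corners t, B) \<in> parcs ?K \<longleftrightarrow> B = hd (map corners ts) \<or> B = last (map corners ts)"
    if B: "B \<in> set (map corners ts)" for B
  proof -
    obtain r where r: "r \<in> set ts" "B = corners r" using B unfolding set_map by blast
    then have "(corners t, B) \<in> parcs ?K \<longleftrightarrow> corners_in t r = 2" using adj[of t r] by simp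
    moreover have "corners_in t r = 2 \<longleftrightarrow> corners r = corners (hd ts) \<or> corners r = corners (last ts)"
    proof
      assume "corners_in t r = 2"
      then have "r \<notin> set (butlast (tl ts))" using bspec[OF closed(3), of r] by auto
      then have "r = hd ts \<or> r = last ts" using r(1) split by blast
      then show "corners r = corners (hd ts) \<or> corners r = corners (last ts)"
        by (elim disjE) simp_all
    next
      assume "corners r = corners (hd ts) \<or> corners r = corners (last ts)"
      then show "corners_in t r = 2"
        using closed(1,2) card(1)[of t] corners_in_card[of t "hd ts"] corners_in_card[of t "last ts"]
          corners_in_card[of t r] by auto
    qed
    ultimately show ?thesis using r(2) tne by (simp add: hd_map last_map)
  qed
  ultimately show "cyclic_order ?K (corners t) (map corners ts)"
    using ip path(2) V by (simp add: cyclic_order_def triangle_graph_verts)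
qed

lemmas S_A_nbrs = S_nbrs(1-8) and S_B_nbrs = S_nbrs(9-16) and S_C_nbrs = S_nbrs(17-24) and S_D_nbrs = S_nbrs(25-32)

lemma is_cycle_S_A: "is_cycle (triangle_graph S_A)"
  by (rule is_cycle_triangle_graphI[of _ "(U 1, V 0, V 1)"
      "[(U 1, V 1, V 2), (V 1, V 2, U 2), (U 2, V 2, V 3), (U 3, V 2, V 3), (U 3, V 3, V 0), (U 4, V 3, V 0), (U 4, V 0, V 1)]"])
    (simp_all del: One_nat_def add: pair_graph_S S_A_nbrs S_A_verts)

lemma is_cycle_S_B: "is_cycle (triangle_graph S_B)"
  by (rule is_cycle_triangle_graphI[of _ "(U 1, V 1, V 2)"
      "[(V 2, V 1, U 2), (V 2, U 2, V 3), (V 2, V 3, U 3), (V 3, U 3, V 4), (V 3, V 4, V 0), (V 0, V 4, V 1), (V 0, V 1, U 1)]"])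
    (simp_all del: One_nat_def add: pair_graph_S S_B_nbrs S_B_verts)

lemma is_cycle_S_C: "is_cycle (triangle_graph S_C)"
  by (rule is_cycle_triangle_graphI[of _ "(U 1, V 1, V 2)"
      "[(V 2, V 1, U 2), (V 2, U 2, V 3), (V 2, V 3, V 4), (V 3, V 4, V 5), (V 4, V 5, V 0), (V 0, V 5, V 1), (V 0, V 1, U 1)]"])
    (simp_all del: One_nat_def add: pair_graph_S S_C_nbrs S_C_verts)

lemma is_cycle_S_D: "is_cycle (triangle_graph S_D)"
  by (rule is_cycle_triangle_graphI[of _ "(U 1, V 1, V 2)"
      "[(V 2, V 1, V 3), (V 2, V 3, V 4), (V 3, V 4, U 4), (V 4, U 4, V 5), (V 4, V 5, V 0), (V 0, V 5, V 1), (V 0, V 1, U 1)]"])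
    (simp_all del: One_nat_def add: pair_graph_S S_D_nbrs S_D_verts)

section \<open>Squares of cycles\<close>

text \<open>Unit weights make the distance the length of a shortest path; so distance one or two means a walk with one or
two arcs between different vertices.\<close>

lemma graph_square_arcs:
  assumes G: "pair_graph G"
  shows "(u, v) \<in> parcs (graph_square G) \<longleftrightarrow>
    u \<noteq> v \<and> ((u, v) \<in> parcs G \<or> (\<exists>w. (u, w) \<in> parcs G \<and> (w, v) \<in> parcs G))"
proof -
  interpret pair_graph G by (rule G)
  have cost: "awalk_cost (\<lambda>_. 1) p = real (length p)" for p by (induct p) auto
  have walk1: "awalk u [e] v \<longleftrightarrow> e = (u, v) \<and> (u, v) \<in> parcs G" for e u v
    by (cases e) (auto simp: awalk_simps dest: wellformed')
  show ?thesis
  proof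
    assume "(u, v) \<in> parcs (graph_square G)"
    then have m: "\<mu> (\<lambda>_. 1) u v \<in> {1, 2}" by (simp add: graph_square_def)
    then have "\<mu> (\<lambda>_. 1) u v < \<infinity>" by auto
    then have "u \<rightarrow>\<^sup>*\<^bsub>with_proj G\<^esub> v" using \<mu>_reach_conv by blast
    then obtain p where p: "apath u p v" "\<mu> (\<lambda>_. 1) u v = awalk_cost (\<lambda>_. 1) p"
      using min_cost_awalk[of u v "\<lambda>_. 1"] by auto
    have "ereal (length p) \<in> {1, 2}" using m p(2) by (simp add: cost)
    then have "length p = 1 \<or> length p = 2" by (auto simp: one_ereal_def numeral_eq_ereal)
    then consider e where "p = [e]" | e f where "p = [e, f]"
      by (auto simp: length_Suc_conv numeral_2_eq_2)
    then show "u \<noteq> v \<and> ((u, v) \<in> parcs G \<or> (\<exists>w. (u, w) \<in> parcs G \<and> (w, v) \<in> parcs G))"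
    proof cases
      case 1
      then show ?thesis using p(1) pair_graph_irrefl[OF G] by (auto simp: apath_def walk1)
    next
      case 2
      then show ?thesis using p(1) by (cases e; cases f) (auto simp: apath_def awalk_simps)
    qed
  next
    assume uv: "u \<noteq> v \<and> ((u, v) \<in> parcs G \<or> (\<exists>w. (u, w) \<in> parcs G \<and> (w, v) \<in> parcs G))"
    then have V: "u \<in> pverts G" "v \<in> pverts G" using pair_graph_in_verts[OF G] by blast+
    obtain q where q: "awalk u q v" "length q \<le> 2"
    proof (cases "(u, v) \<in> parcs G")
      case True
      then show ?thesis using that[of "[(u, v)]"] walk1 by simp
    next
      case False
      then obtain w where "(u, w) \<in> parcs G" "(w, v) \<in> parcs G" using uv by blast
      then show ?thesis using that[of "[(u, w), (w, v)]"] V by (auto simp: awalk_simps)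
    qed
    have "\<mu> (\<lambda>_. 1) u v \<le> awalk_cost (\<lambda>_. 1) q" by (rule min_cost_le_walk_cost[OF q(1)])
    also have "ereal (awalk_cost (\<lambda>_. 1) q) \<le> ereal 2" using q(2) by (simp add: cost)
    finally have le: "\<mu> (\<lambda>_. 1) u v \<le> ereal 2" .
    have "u \<rightarrow>\<^sup>*\<^bsub>with_proj G\<^esub> v" unfolding reachable_awalk using q(1) by (rule exI)
    then obtain p where p: "apath u p v" "\<mu> (\<lambda>_. 1) u v = awalk_cost (\<lambda>_. 1) p"
      using min_cost_awalk[of u v "\<lambda>_. 1"] by auto
    have "p \<noteq> []" using p(1) uv by (auto simp: apath_def awalk_Nil_iff)
    then have "length p \<noteq> 0" by simp
    moreover have "length p \<le> 2" using le p(2) by (simp add: cost)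
    ultimately have "length p = 1 \<or> length p = 2" by linarith
    then have "\<mu> (\<lambda>_. 1) u v \<in> {1, 2}" using p(2) by (auto simp: cost one_ereal_def numeral_eq_ereal)
    then show "(u, v) \<in> parcs (graph_square G)" using V by (simp add: graph_square_def)
  qed
qed

lemma graph_square_verts: "pverts (graph_square G) = pverts G"
  by (simp add: graph_square_def)

lemma pair_graph_graph_square:
  assumes G: "pair_graph G"
  shows "pair_graph (graph_square G)"
proof (rule pair_graphI)
  show "finite (pverts (graph_square G))" using pair_graph_finite[OF G] by (simp add: graph_square_verts)
  show "parcs (graph_square G) \<subseteq> pverts (graph_square G) \<times> pverts (graph_square G)"
    by (auto simp: graph_square_def)
  show "(u, v) \<in> parcs (graph_square G) \<Longrightarrow> (v, u) \<in> parcs (graph_square G)" for u v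
    unfolding graph_square_arcs[OF G] using pair_graph_sym[OF G] by metis
  show "(u, u) \<notin> parcs (graph_square G)" for u unfolding graph_square_arcs[OF G] by simp
qed

text \<open>The tool for computing modulo \<open>k\<close>: all differences of offsets that occur below are smaller than \<open>k\<close>, so
congruences between offsets are equations.\<close>

lemma small_dvd_zero: "int k dvd c \<Longrightarrow> \<bar>c\<bar> < int k \<Longrightarrow> c = 0"
  using dvd_imp_le_int by force

context
  fixes k :: nat
  assumes k: "7 \<le> k"
begin

text \<open>The vertices of \<open>C\<^sub>k\<close> are indexed by all integers, so that no case distinction is needed where the numbering
wraps around.\<close>

definition res :: "int \<Rightarrow> nat" where
  "res i = nat (i mod int k)"

lemma res_eq: "res i = res j \<longleftrightarrow> int k dvd i - j"
  using k by (simp add: res_def nat_eq_iff mod_eq_dvd_iff)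

lemma res_less: "res i < k"
  using k by (simp add: res_def nat_less_iff)

lemma res_int: "i < k \<Longrightarrow> res (int i) = i"
  by (simp add: res_def nat_mod_as_int)

lemma res_shift: "res i = res j \<Longrightarrow> res (i + d) = res (j + d)"
  by (simp add: res_eq)

lemma Suc_res: "Suc (res i) mod k = res (i + 1)"
proof -
  have "int (Suc (res i) mod k) = (i mod int k + 1) mod int k"
    using k by (simp add: res_def zmod_int add.commute)
  then show ?thesis by (simp add: res_def mod_add_left_eq)
qed

lemma cycle_arcs_res: "(res i, v) \<in> parcs (cycle_graph k) \<longleftrightarrow> v = res (i + 1) \<or> v = res (i - 1)"
proof -
  have "res i = Suc v mod k \<longleftrightarrow> v = res (i - 1)" if "v < k"
  proof -
    have "Suc v mod k = res (int v + 1)" using Suc_res[of "int v"] res_int[OF that] by simp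
    then have "res i = Suc v mod k \<longleftrightarrow> int k dvd (i - 1) - int v" by (simp add: res_eq algebra_simps)
    then show ?thesis using res_eq[of "i - 1" "int v"] res_int[OF that] by auto
  qed
  then show ?thesis using res_less by (auto simp: cycle_graph_arcs Suc_res)
qed

lemma square_arcs_res: "(res i, v) \<in> parcs (graph_square (cycle_graph k)) \<longleftrightarrow>
    v \<in> {res (i - 2), res (i - 1), res (i + 1), res (i + 2)}"
proof -
  have C: "pair_graph (cycle_graph k)" using k by (intro pair_graph_cycle_graph) simp
  have ne: "res i \<noteq> res (i + d)" if "d \<in> {-2, -1, 1, 2}" for d
    using that k by (auto simp: res_eq dest!: small_dvd_zero)
  have "res i \<noteq> res (i - 1)" "res i \<noteq> res (i - 2)" "res i \<noteq> res (i + 1)" "res i \<noteq> res (i + 2)"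
    using ne[of "-1"] ne[of "-2"] ne[of 1] ne[of 2] by simp_all
  moreover have "(\<exists>w. (res i, w) \<in> parcs (cycle_graph k) \<and> (w, v) \<in> parcs (cycle_graph k)) \<longleftrightarrow>
      v \<in> {res (i - 2), res i, res (i + 2)}"
  proof -
    have eqs: "i + 1 + 1 = i + 2" "i + 1 - 1 = i" "i - 1 + 1 = i" "i - 1 - 1 = i - 2" by simp_all
    have "(\<exists>w. (res i, w) \<in> parcs (cycle_graph k) \<and> (w, v) \<in> parcs (cycle_graph k)) \<longleftrightarrow>
        (res (i + 1), v) \<in> parcs (cycle_graph k) \<or> (res (i - 1), v) \<in> parcs (cycle_graph k)"
      unfolding cycle_arcs_res[of i] by blast
    then show ?thesis unfolding cycle_arcs_res eqs by blast
  qed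
  ultimately show ?thesis unfolding graph_square_arcs[OF C] cycle_arcs_res by auto
qed

definition interval3 :: "int \<Rightarrow> nat set" where
  "interval3 i = {res i, res (i + 1), res (i + 2)}"

text \<open>Two neighbours \<open>i + d\<close> and \<open>i + e\<close> of \<open>i\<close> with \<open>d, e \<in> {-2, -1, 1, 2}\<close> are adjacent only if
\<open>e - d \<in> {-2, -1, 1, 2}\<close>, since \<open>\<bar>e - d\<bar> + 2 < k\<close>. Then \<open>0\<close>, \<open>d\<close> and \<open>e\<close> are three consecutive numbers.\<close>

lemma square_triangles: "triangles (graph_square (cycle_graph k)) = range interval3"
proof -
  let ?Q = "graph_square (cycle_graph k)"
  have Q: "pair_graph ?Q" using k by (intro pair_graph_graph_square pair_graph_cycle_graph) simp
  show ?thesis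
  proof (intro equalityI subsetI)
    fix T assume "T \<in> triangles ?Q"
    then obtain a b c where T: "T = {a, b, c}" "(a, b) \<in> parcs ?Q" "(b, c) \<in> parcs ?Q" "(a, c) \<in> parcs ?Q"
      using triangles_iff[OF Q] by auto
    have "a < k" using T(2) by (simp add: graph_square_def cycle_graph_verts)
    then obtain i where a: "a = res i" using res_int by metis
    obtain d where d: "b = res (i + d)" "d \<in> {-2, -1, 1, 2}"
    proof -
      have "b \<in> {res (i + -2), res (i + -1), res (i + 1), res (i + 2)}"
        using T(2) unfolding a square_arcs_res by simp
      then show ?thesis using that by blast
    qed
    obtain e where e: "c = res (i + e)" "e \<in> {-2, -1, 1, 2}"
    proof -
      have "c \<in> {res (i + -2), res (i + -1), res (i + 1), res (i + 2)}"
        using T(4) unfolding a square_arcs_res by simp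
      then show ?thesis using that by blast
    qed
    obtain f where f: "res (i + e) = res (i + d + f)" "f \<in> {-2, -1, 1, 2}"
    proof -
      have "c \<in> {res (i + d + -2), res (i + d + -1), res (i + d + 1), res (i + d + 2)}"
        using T(3) unfolding d(1) square_arcs_res by simp
      then show ?thesis using that unfolding e(1) by blast
    qed
    have "e = d + f"
    proof -
      have "int k dvd e - d - f" using f(1) by (simp add: res_eq algebra_simps)
      moreover have "\<bar>d\<bar> \<le> 2" "\<bar>e\<bar> \<le> 2" "\<bar>f\<bar> \<le> 2" using d(2) e(2) f(2) by auto
      then have "\<bar>e - d - f\<bar> < int k" using k by linarith
      ultimately have "e - d - f = 0" by (rule small_dvd_zero)
      then show ?thesis by simp
    qed
    then have de: "(d, e) \<in> {(1, 2), (2, 1), (-1, 1), (1, -1), (-1, -2), (-2, -1)}"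
      using d(2) e(2) f(2) by (elim insertE emptyE; hypsubst) simp_all
    have "interval3 i = {res i, res (i + 1), res (i + 2)}"
      "interval3 (i - 1) = {res (i - 1), res i, res (i + 1)}"
      "interval3 (i - 2) = {res (i - 2), res (i - 1), res i}"
    proof -
      have "i - 1 + 1 = i" "i - 1 + 2 = i + 1" "i - 2 + 1 = i - 1" "i - 2 + 2 = i" by simp_all
      then show "interval3 i = {res i, res (i + 1), res (i + 2)}"
        "interval3 (i - 1) = {res (i - 1), res i, res (i + 1)}"
        "interval3 (i - 2) = {res (i - 2), res (i - 1), res i}"
        unfolding interval3_def by (simp_all only:)
    qed
    moreover have "T = {res i, res (i + d), res (i + e)}" using T(1) a d(1) e(1) by simp
    ultimately have "T \<in> {interval3 i, interval3 (i - 1), interval3 (i - 2)}"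
      using de by (elim insertE emptyE) (simp_all add: insert_commute)
    then show "T \<in> range interval3" by auto
  next
    fix T assume "T \<in> range interval3"
    then obtain i where "T = {res i, res (i + 1), res (i + 2)}" by (auto simp: interval3_def)
    moreover have "(res i, res (i + 1)) \<in> parcs ?Q" "(res (i + 1), res (i + 2)) \<in> parcs ?Q"
      "(res i, res (i + 2)) \<in> parcs ?Q"
      unfolding square_arcs_res by (simp_all add: add.commute[of i])
    ultimately show "T \<in> triangles ?Q" unfolding triangles_iff[OF Q] by blast
  qed
qed

lemma interval3_common:
  "(\<exists>a b. a \<noteq> b \<and> a \<in> interval3 i \<inter> interval3 j \<and> b \<in> interval3 i \<inter> interval3 j) \<longleftrightarrow>
   (\<exists>d\<in>{-1, 0, 1}. int k dvd j - i - d)" (is "?L \<longleftrightarrow> ?R")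
proof
  assume ?L
  then obtain a b where ab: "a \<noteq> b" "a \<in> interval3 i" "a \<in> interval3 j" "b \<in> interval3 i" "b \<in> interval3 j"
    by blast
  have mem: "\<exists>d\<in>{0, 1, 2}. x = res (m + d)" if "x \<in> interval3 m" for x m
    using that by (auto simp: interval3_def)
  obtain p q r s where pqrs: "a = res (i + p)" "a = res (j + q)" "b = res (i + r)" "b = res (j + s)"
    and small: "p \<in> {0, 1, 2}" "q \<in> {0, 1, 2}" "r \<in> {0, 1, 2}" "s \<in> {0, 1, 2}"
    using mem ab by meson
  have 1: "int k dvd j - i - (p - q)" and 2: "int k dvd j - i - (r - s)"
    using pqrs res_eq[of "j + q" "i + p"] res_eq[of "j + s" "i + r"] by (simp_all add: algebra_simps)
  have "int k dvd (p - q) - (r - s)" using dvd_diff[OF 2 1] by (simp add: algebra_simps)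
  moreover have "0 \<le> p" "p \<le> 2" "0 \<le> q" "q \<le> 2" "0 \<le> r" "r \<le> 2" "0 \<le> s" "s \<le> 2"
    using small by auto
  then have "\<bar>(p - q) - (r - s)\<bar> < int k" using k by linarith
  ultimately have "(p - q) - (r - s) = 0" by (rule small_dvd_zero)
  then have "p - q = r - s" by simp
  moreover have "p \<noteq> r" using ab(1) pqrs by auto
  ultimately have "p - q \<in> {-1, 0, 1}" using small by auto
  then show ?R using 1 by blast
next
  assume ?R
  then obtain d where d: "d \<in> {-1, 0, 1}" "int k dvd j - i - d" by blast
  have eq: "res (j + m) = res (i + (d + m))" for m using d(2) by (simp add: res_eq algebra_simps)
  have j: "interval3 j = {res (i + d), res (i + (d + 1)), res (i + (d + 2))}"
    unfolding interval3_def using eq[of 0] eq[of 1] eq[of 2] by simp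
  have "res (i + 1) \<noteq> res i" "res (i + 2) \<noteq> res (i + 1)"
    using k by (auto simp: res_eq dest!: small_dvd_zero)
  moreover have "res i \<in> interval3 i" "res (i + 1) \<in> interval3 i" "res (i + 2) \<in> interval3 i"
    by (simp_all add: interval3_def)
  moreover have "res i \<in> interval3 j \<and> res (i + 1) \<in> interval3 j \<or>
      res (i + 1) \<in> interval3 j \<and> res (i + 2) \<in> interval3 j"
    unfolding j using d(1) by auto
  ultimately show ?L by blast
qed

lemma interval3_eq: "interval3 i = interval3 j \<longleftrightarrow> int k dvd j - i"
proof
  assume eq: "interval3 i = interval3 j"
  have "res (i + 1) \<noteq> res i" using k by (auto simp: res_eq dest!: small_dvd_zero)
  then have "\<exists>a b. a \<noteq> b \<and> a \<in> interval3 i \<inter> interval3 j \<and> b \<in> interval3 i \<inter> interval3 j"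
    unfolding eq[symmetric] by (intro exI[of _ "res i"] exI[of _ "res (i + 1)"]) (simp add: interval3_def)
  then obtain d where d: "d \<in> {-1, 0, 1}" "int k dvd j - i - d" unfolding interval3_common by blast
  have e: "res (j + m) = res (i + (d + m))" for m using d(2) by (simp add: res_eq algebra_simps)
  have "d \<noteq> 1"
  proof
    assume "d = 1"
    then have "res (i + 3) \<in> interval3 i" using e[of 2] unfolding eq by (simp add: interval3_def)
    then show False using k by (auto simp: interval3_def res_eq dest!: small_dvd_zero)
  qed
  moreover have "d \<noteq> -1"
  proof
    assume "d = -1"
    then have "res (i - 1) \<in> interval3 i" using e[of 0] unfolding eq by (simp add: interval3_def)
    then show False using k by (auto simp: interval3_def res_eq dest!: small_dvd_zero)
  qed
  ultimately have "d = 0" using d(1) by blast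
  then show "int k dvd j - i" using d(2) by simp
next
  assume "int k dvd j - i"
  then have "res i = res j" by (simp add: res_eq dvd_diff_commute)
  then show "interval3 i = interval3 j" unfolding interval3_def using res_shift[of i j] by simp
qed

lemma is_cycle_square_triangles: "is_cycle (triangle_graph (graph_square (cycle_graph k)))"
proof -
  let ?Q = "graph_square (cycle_graph k)"
  have C: "pair_graph (cycle_graph k)" using k by (intro pair_graph_cycle_graph) simp
  have Q: "pair_graph ?Q" by (rule pair_graph_graph_square[OF C])
  have T: "pair_graph (triangle_graph ?Q)" by (rule pair_graph_triangle_graph[OF Q])
  let ?f = "\<lambda>i. interval3 (int i)"
  have "graph_iso_map (cycle_graph k) (triangle_graph ?Q) ?f"
    unfolding graph_iso_map_def
  proof (intro conjI ballI)
    have "inj_on ?f {..<k}"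
    proof (rule inj_onI)
      fix i j assume ij: "i \<in> {..<k}" "j \<in> {..<k}" "?f i = ?f j"
      then have "int k dvd int j - int i" by (simp add: interval3_eq)
      moreover have "\<bar>int j - int i\<bar> < int k" using ij by auto
      ultimately have "int j - int i = 0" by (rule small_dvd_zero)
      then show "i = j" by simp
    qed
    moreover have "?f ` {..<k} = range interval3"
    proof (intro equalityI subsetI)
      fix T assume "T \<in> range interval3"
      then obtain i where "T = interval3 i" by blast
      also have "\<dots> = ?f (res i)"
        using res_int[OF res_less[of i]] unfolding interval3_eq res_eq[symmetric] by simp
      finally show "T \<in> ?f ` {..<k}" using res_less by blast
    qed auto
    ultimately show "bij_betw ?f (pverts (cycle_graph k)) (pverts (triangle_graph ?Q))"
      by (simp add: bij_betw_def cycle_graph_verts triangle_graph_verts square_triangles)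
    fix i j assume "i \<in> pverts (cycle_graph k)" "j \<in> pverts (cycle_graph k)"
    then have ij: "i < k" "j < k" by (simp_all add: cycle_graph_verts)
    have "(i, j) \<in> parcs (cycle_graph k) \<longleftrightarrow> res j = res (int i + 1) \<or> res j = res (int i - 1)"
      using cycle_arcs_res[of "int i" j] res_int[OF ij(1)] res_int[OF ij(2)] by simp
    also have "\<dots> \<longleftrightarrow> int k dvd int j - int i - 1 \<or> int k dvd int j - int i - (-1)"
      by (simp add: res_eq algebra_simps)
    also have "\<dots> \<longleftrightarrow> overlap (?f i) (?f j)"
    proof -
      have "\<not> int k dvd int j - int i" if "d \<in> {-1, 1}" "int k dvd int j - int i - d" for d
      proof
        assume "int k dvd int j - int i"
        from dvd_diff[OF this that(2)] have "int k dvd d" by simp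
        then show False using that(1) k by (auto dest!: small_dvd_zero)
      qed
      then have "int k dvd int j - int i - 1 \<or> int k dvd int j - int i - (-1) \<longleftrightarrow>
          \<not> int k dvd int j - int i \<and> (\<exists>d\<in>{-1, 0, 1}. int k dvd int j - int i - d)"
        by (simp only: bex_simps insert_iff empty_iff diff_zero) blast
      then show ?thesis unfolding overlap_def interval3_common interval3_eq .
    qed
    also have "\<dots> \<longleftrightarrow> (?f i, ?f j) \<in> parcs (triangle_graph ?Q)"
      unfolding triangle_graph_arcs[OF Q] square_triangles by simp
    finally show "(i, j) \<in> parcs (cycle_graph k) \<longleftrightarrow> (?f i, ?f j) \<in> parcs (triangle_graph ?Q)" .
  qed
  from graph_iso_map_inv[OF this] show ?thesis
    unfolding is_cycle_iff[OF T] using k by (intro exI[of _ k]) auto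
qed

end

section \<open>Triangulated strips\<close>

text \<open>The edge \<open>vr\<close> lies in the triangle \<open>vru\<close> and in no other.\<close>

definition boundary_edge :: "'a pair_pre_digraph \<Rightarrow> 'a \<Rightarrow> 'a \<Rightarrow> 'a \<Rightarrow> bool" where
  "boundary_edge G v r u \<longleftrightarrow> (v, r) \<in> parcs G \<and> open_neighborhood G v \<inter> open_neighborhood G r = {u}"

text \<open>The edge \<open>vr\<close> lies in the two triangles \<open>vrp\<close> and \<open>vrq\<close>, and in no other.\<close>

definition inner_edge :: "'a pair_pre_digraph \<Rightarrow> 'a \<Rightarrow> 'a \<Rightarrow> 'a \<Rightarrow> 'a \<Rightarrow> bool" where
  "inner_edge G v r p q \<longleftrightarrow> (v, r) \<in> parcs G \<and> p \<noteq> q \<and>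
     open_neighborhood G v \<inter> open_neighborhood G r = {p, q}"

text \<open>For an edge, this says that it is a boundary edge, whatever its third vertex.\<close>

definition solo :: "'a pair_pre_digraph \<Rightarrow> 'a \<Rightarrow> 'a \<Rightarrow> bool" where
  "solo G v r \<longleftrightarrow> (\<exists>u. open_neighborhood G v \<inter> open_neighborhood G r = {u})"

lemma solo_sym: "solo G v r \<longleftrightarrow> solo G r v"
  by (simp add: solo_def Int_commute)

lemma boundary_edge_solo: "boundary_edge G v r u \<Longrightarrow> solo G v r"
  by (auto simp: boundary_edge_def solo_def)

lemma inner_edge_not_solo: "inner_edge G v r p q \<Longrightarrow> \<not> solo G v r"
  by (auto simp: inner_edge_def solo_def)

lemma inner_edge_swap: "inner_edge G v r p q \<Longrightarrow> inner_edge G v r q p"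
  by (auto simp: inner_edge_def)

lemma boundary_edge_unique: "boundary_edge G v r u \<Longrightarrow> boundary_edge G v r u' \<Longrightarrow> u' = u"
  by (auto simp: boundary_edge_def)

lemma inner_edge_unique: "inner_edge G v r p q \<Longrightarrow> inner_edge G v r p q' \<Longrightarrow> q' = q"
  by (auto simp: inner_edge_def doubleton_eq_iff)

lemma inner_edge_set_unique: "inner_edge G v r p q \<Longrightarrow> inner_edge G v r p' q' \<Longrightarrow> {p', q'} = {p, q}"
  by (simp add: inner_edge_def)

lemma open_neighborhood_iff: "u \<in> open_neighborhood G v \<longleftrightarrow> (v, u) \<in> parcs G"
  by (simp add: open_neighborhood_def)

lemma boundary_edge_arcs: "boundary_edge G v r u \<Longrightarrow> (v, r) \<in> parcs G \<and> (v, u) \<in> parcs G \<and> (r, u) \<in> parcs G"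
  by (auto simp: boundary_edge_def open_neighborhood_def)

lemma inner_edge_arcs: "inner_edge G v r p q \<Longrightarrow>
    (v, r) \<in> parcs G \<and> (v, p) \<in> parcs G \<and> (r, p) \<in> parcs G \<and> (v, q) \<in> parcs G \<and> (r, q) \<in> parcs G"
  by (auto simp: inner_edge_def open_neighborhood_def)

context
  fixes G :: "'a pair_pre_digraph"
  assumes G: "pair_graph G"
begin

lemma boundary_edge_commute: "boundary_edge G v r u \<longleftrightarrow> boundary_edge G r v u"
  using pair_graph_sym[OF G, of v r] by (simp add: boundary_edge_def Int_commute)

lemma inner_edge_commute: "inner_edge G v r p q \<longleftrightarrow> inner_edge G r v p q"
  using pair_graph_sym[OF G, of v r] by (simp add: inner_edge_def Int_commute)

lemma link_common:
  assumes "link G v ps" "r \<in> set ps"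
  shows "open_neighborhood G v \<inter> open_neighborhood G r = {u \<in> set ps. (r, u) \<in> parcs G}" "(v, r) \<in> parcs G"
  using assms by (auto simp: link_def open_neighborhood_def)

lemma link_inner:
  assumes "link G v (as @ p # r # q # bs)"
  shows "inner_edge G v r p q"
proof -
  have ip: "induced_path G (as @ p # r # q # bs)" using assms by (simp add: link_def)
  have "(r, u) \<in> parcs G \<longleftrightarrow> u = p \<or> u = q" if "u \<in> set (as @ p # r # q # bs)" for u
  proof -
    have "(u, r) \<notin> parcs G" if "u \<in> set as" for u
      using ip that unfolding induced_path_append[OF G] by auto
    moreover have "p \<noteq> r" "(p, r) \<in> parcs G" "(r, q) \<in> parcs G" "\<And>u. u \<in> set bs \<Longrightarrow> (r, u) \<notin> parcs G"
      using ip unfolding induced_path_append[OF G] by auto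
    moreover have "p \<notin> set as" "q \<notin> set as" "p \<notin> set bs" "q \<notin> set bs"
      using induced_path_distinct[OF ip] by auto
    ultimately show ?thesis
      using that pair_graph_sym[OF G, of u r] pair_graph_sym[OF G, of p r] pair_graph_irrefl[OF G, of r] by auto
  qed
  then have "{u \<in> set (as @ p # r # q # bs). (r, u) \<in> parcs G} = {p, q}" by auto
  moreover have "p \<noteq> q" using induced_path_distinct[OF ip] by auto
  ultimately show ?thesis using link_common[OF assms, of r] by (simp add: inner_edge_def)
qed

lemma link_first:
  assumes "link G v (r # u # bs)"
  shows "boundary_edge G v r u"
proof -
  have ip: "induced_path G (r # u # bs)" using assms by (simp add: link_def)
  then have "{x \<in> set (r # u # bs). (r, x) \<in> parcs G} = {u}"
    using pair_graph_irrefl[OF G, of r] induced_path_distinct[OF ip] by auto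
  then show ?thesis using link_common[OF assms, of r] by (simp add: boundary_edge_def)
qed

lemma link_last:
  assumes "link G v (as @ [u, r])"
  shows "boundary_edge G v r u"
proof -
  have "link G v (r # u # rev as)" using assms link_rev[OF G, of v "as @ [u, r]"] by simp
  then show ?thesis by (rule link_first)
qed

text \<open>Links are traversed from left to right: the two triangles on an inner edge \<open>vr\<close> determine what follows \<open>r\<close>
in the link of \<open>v\<close>, and \<open>link_stop\<close> recognises the end.\<close>

lemma link_step:
  assumes l: "link G v (as @ p # r # bs)" and i: "inner_edge G v r p q"
  shows "\<exists>cs. bs = q # cs"
proof (cases bs)
  case Nil
  then have "boundary_edge G v r p" using link_last l by simp
  then show ?thesis using i inner_edge_not_solo boundary_edge_solo by metis
next
  case (Cons b cs)
  then have "inner_edge G v r p b" using link_inner l by simp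
  then show ?thesis using Cons inner_edge_unique[OF i] by simp
qed

lemma link_stop:
  assumes l: "link G v (as @ p # r # bs)" and i: "boundary_edge G v r u"
  shows "bs = []"
proof (cases bs)
  case (Cons b cs)
  then have "inner_edge G v r p b" using link_inner l by simp
  then show ?thesis using i inner_edge_not_solo boundary_edge_solo by metis
qed simp

end

locale path_links =
  fixes G :: "'a pair_pre_digraph"
  assumes graph: "pair_graph G"
    and links: "v \<in> pverts G \<Longrightarrow> \<exists>ps. link G v ps \<and> 2 \<le> length ps"
begin

lemma boundary_or_inner_edge:
  assumes "(v, r) \<in> parcs G"
  shows "(\<exists>u bs. boundary_edge G v r u \<and> link G v (r # u # bs)) \<or> (\<exists>p q as bs. inner_edge G v r p q \<and> link G v (as @ p # r # q # bs))"
proof -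
  obtain ps where ps: "link G v ps" "2 \<le> length ps"
    using links pair_graph_in_verts[OF graph assms] by blast
  then have "r \<in> set ps" using assms by (auto simp: link_def open_neighborhood_def)
  then obtain as cs where sp: "ps = as @ r # cs" by (auto simp: in_set_conv_decomp)
  consider "as = []" "cs \<noteq> []" | "cs = []" "as \<noteq> []" | "as \<noteq> []" "cs \<noteq> []"
    using ps(2) sp by (cases as; cases cs) auto
  then show ?thesis
  proof cases
    case 1
    then obtain u bs where "ps = r # u # bs" using sp by (cases cs) auto
    then show ?thesis using ps(1) link_first[OF graph] by blast
  next
    case 2
    then obtain u bs where "ps = bs @ [u, r]" using sp by (cases as rule: rev_cases) auto
    then have "link G v (r # u # rev bs)" using ps(1) link_rev[OF graph, of v "bs @ [u, r]"] by simp
    then show ?thesis using link_first[OF graph] by blast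
  next
    case 3
    then obtain p q as' bs where "ps = as' @ p # r # q # bs"
      using sp by (cases as rule: rev_cases; cases cs) auto
    then show ?thesis using ps(1) link_inner[OF graph] by blast
  qed
qed

end

text \<open>Closed strips of triangles, described locally. Connectedness is phrased by closed vertex sets, because it is used to
show that a set of vertices whose neighbourhoods are known is the whole graph.\<close>

locale strip = path_links +
  assumes one_solo: "\<lbrakk>(a, b) \<in> parcs G; (b, c) \<in> parcs G; (a, c) \<in> parcs G\<rbrakk> \<Longrightarrow>
      solo G a b \<and> \<not> solo G b c \<and> \<not> solo G a c \<or> \<not> solo G a b \<and> solo G b c \<and> \<not> solo G a c \<or>
      \<not> solo G a b \<and> \<not> solo G b c \<and> solo G a c"
    and connected: "\<lbrakk>S \<noteq> {}; S \<subseteq> pverts G; \<And>v. v \<in> S \<Longrightarrow> open_neighborhood G v \<subseteq> S\<rbrakk> \<Longrightarrow> S = pverts G"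
    and nonempty: "pverts G \<noteq> {}"
begin

lemma link_nbr: "link G v ps \<Longrightarrow> (v, u) \<in> parcs G \<longleftrightarrow> u \<in> set ps"
  by (simp add: link_def open_neighborhood_def)

lemmas boundary_edge_comm = boundary_edge_commute[OF graph, THEN iffD1]
lemmas inner_edge_comm = inner_edge_commute[OF graph, THEN iffD1]

lemma link_start:
  assumes "boundary_edge G v r u"
  shows "\<exists>bs. link G v (r # u # bs)"
  using boundary_or_inner_edge[of v r] assms boundary_edge_unique[OF assms] boundary_edge_solo inner_edge_not_solo
  by (metis boundary_edge_def)

lemma link_around:
  assumes i: "inner_edge G v r p q"
  shows "\<exists>as bs. link G v (as @ p # r # q # bs)"
proof -
  obtain p' q' as bs where l: "inner_edge G v r p' q'" "link G v (as @ p' # r # q' # bs)"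
    using boundary_or_inner_edge[of v r] i boundary_edge_solo inner_edge_not_solo by (metis inner_edge_def)
  have "p' = p \<and> q' = q \<or> p' = q \<and> q' = p"
    using inner_edge_set_unique[OF i l(1)] by (auto simp: doubleton_eq_iff)
  moreover have "link G v (rev bs @ q' # r # p' # rev as)"
    using l(2) link_rev[OF graph, of v "as @ p' # r # q' # bs"] by simp
  ultimately show ?thesis using l(2) by blast
qed

text \<open>The link of \<open>v\<close> is assembled from what the links of its neighbours say about the edges at \<open>v\<close>. The same
works for links with four and five vertices.\<close>

lemma link3I:
  assumes "boundary_edge G v a b" "inner_edge G v b a c" "boundary_edge G v c b"
  shows "link G v [a, b, c]"
proof -
  obtain bs where 1: "link G v ([] @ a # b # bs)" using link_start[OF assms(1)] by auto
  obtain cs where 2: "bs = c # cs" using link_step[OF graph 1 assms(2)] by auto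
  have "cs = []" using link_stop[OF graph _ assms(3), of "[a]" b] 1 2 by simp
  then show ?thesis using 1 2 by simp
qed

lemma link4I:
  assumes "boundary_edge G v a b" "inner_edge G v b a c" "inner_edge G v c b d" "boundary_edge G v d c"
  shows "link G v [a, b, c, d]"
proof -
  obtain bs where 1: "link G v ([] @ a # b # bs)" using link_start[OF assms(1)] by auto
  obtain cs where 2: "bs = c # cs" using link_step[OF graph 1 assms(2)] by auto
  obtain ds where 3: "cs = d # ds" using link_step[OF graph _ assms(3), of "[a]"] 1 2 by auto
  have "ds = []" using link_stop[OF graph _ assms(4), of "[a, b]" c] 1 2 3 by simp
  then show ?thesis using 1 2 3 by simp
qed

lemma link5I:
  assumes "boundary_edge G v a b" "inner_edge G v b a c" "inner_edge G v c b d" "inner_edge G v d c e" "boundary_edge G v e d"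
  shows "link G v [a, b, c, d, e]"
proof -
  obtain bs where 1: "link G v ([] @ a # b # bs)" using link_start[OF assms(1)] by auto
  obtain cs where 2: "bs = c # cs" using link_step[OF graph 1 assms(2)] by auto
  obtain ds where 3: "cs = d # ds" using link_step[OF graph _ assms(3), of "[a]"] 1 2 by auto
  obtain es where 4: "ds = e # es" using link_step[OF graph _ assms(4), of "[a, b]"] 1 2 3 by auto
  have "es = []" using link_stop[OF graph _ assms(5), of "[a, b, c]" d] 1 2 3 4 by simp
  then show ?thesis using 1 2 3 4 by simp
qed

lemma solo_boundary_edge:
  assumes "solo G q r" "(q, r) \<in> parcs G" "(q, v) \<in> parcs G" "(r, v) \<in> parcs G"
  shows "boundary_edge G q r v"
proof -
  obtain u where u: "open_neighborhood G q \<inter> open_neighborhood G r = {u}" using assms(1) by (auto simp: solo_def)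
  then have "v \<in> {u}" using assms(3,4) unfolding open_neighborhood_iff[symmetric] by blast
  then show ?thesis using assms(2) u by (simp add: boundary_edge_def)
qed

text \<open>The triangle \<open>vqr\<close> has the inner edges \<open>vq\<close> and \<open>vr\<close>, so its third edge is on the boundary.\<close>

lemma fan_edge:
  assumes l: "link G v (as @ p # q # r # s # bs)"
  shows "boundary_edge G q r v"
proof -
  have q: "inner_edge G v q p r" using link_inner[OF graph l] .
  have r: "inner_edge G v r q s" using link_inner[OF graph, of v "as @ [p]" q r s bs] l by simp
  have e: "(v, q) \<in> parcs G" "(q, r) \<in> parcs G" "(v, r) \<in> parcs G"
    using inner_edge_arcs[OF q] inner_edge_arcs[OF r] by auto
  have "solo G q r" using one_solo[OF e] inner_edge_not_solo[OF q] inner_edge_not_solo[OF r] by blast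
  then show ?thesis using e pair_graph_sym[OF graph] by (intro solo_boundary_edge) blast+
qed

text \<open>Both rim edges at \<open>r\<close> are on the boundary by \<open>fan_edge\<close>, so nothing else is attached at \<open>r\<close>.\<close>

lemma fan_centre:
  assumes l: "link G v (as @ p # q # r # s # t # bs)"
  shows "link G r [q, v, s]"
proof (rule link3I)
  show "boundary_edge G r q v" using fan_edge[OF l] by (rule boundary_edge_comm)
  show "boundary_edge G r s v" using fan_edge[of v "as @ [p]" q r s t bs] l by simp
  have "inner_edge G v r q s" using link_inner[OF graph, of v "as @ [p]" q r s] l by simp
  then show "inner_edge G r v q s" by (rule inner_edge_comm)
qed

text \<open>The first triangle of a fan already has the boundary edge \<open>vp\<close>, so its other two edges are inner.\<close>

lemma rim_edges:
  assumes l: "link G v (p # q # bs)"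
  shows "\<not> solo G v q" "\<not> solo G p q"
proof -
  have b: "boundary_edge G v p q" by (rule link_first[OF graph l])
  have "(v, p) \<in> parcs G" "(p, q) \<in> parcs G" "(v, q) \<in> parcs G" using boundary_edge_arcs[OF b] by auto
  from one_solo[OF this] show "\<not> solo G v q" "\<not> solo G p q" using boundary_edge_solo[OF b] by auto
qed

lemma link_length:
  assumes l: "link G v ps"
  shows "3 \<le> length ps"
proof -
  obtain qs where qs: "link G v qs" "2 \<le> length qs" using links[of v] l unfolding link_def by blast
  have "card (set ps) = length ps" "card (set qs) = length qs"
    using l qs induced_path_distinct[of G ps] induced_path_distinct[of G qs] distinct_card
    unfolding link_def by blast+
  then have "2 \<le> length ps" using l qs by (simp add: link_def)
  then obtain p q bs where ps: "ps = p # q # bs" by (cases ps; cases "tl ps") auto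
  have "bs \<noteq> []"
    using rim_edges(1)[of v p q bs] boundary_edge_solo[OF link_last[OF graph, of v "[]" p q]] l ps by auto
  then show ?thesis using ps by (cases bs) auto
qed

end

section \<open>Irreducible strips with a vertex of degree three\<close>

text \<open>Strips in which no vertex of degree three arises from splitting an edge: the edge \<open>xy\<close> that would have been split
would lie in the second triangle \<open>xyq\<close>.\<close>

locale irreducible_strip = strip +
  assumes irreducible: "link G w [x, z, y] \<Longrightarrow>
    \<exists>q. (x, q) \<in> parcs G \<and> (y, q) \<in> parcs G \<and> q \<noteq> z \<and> q \<noteq> w"
begin

lemma sym: "(u, v) \<in> parcs G \<longleftrightarrow> (v, u) \<in> parcs G"
  by (rule pair_graph_sym[OF graph])

text \<open>A vertex \<open>v\<close> with at least six neighbours \<open>p, q, r, s, t, u\<close> in its link makes \<open>r\<close> and \<open>s\<close> vertices of degree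
three. By irreducibility \<open>q\<close> and \<open>s\<close> have a common neighbour other than \<open>v\<close> and \<open>r\<close>, which can only be \<open>t\<close>; but
\<open>qt\<close> would be a chord of the link of \<open>v\<close>.\<close>

lemma link_length_le_5:
  assumes l: "link G v ps"
  shows "length ps \<le> 5"
proof (rule ccontr)
  assume "\<not> length ps \<le> 5"
  then have "Suc (Suc (Suc (Suc (Suc (Suc 0))))) \<le> length ps" by simp
  then obtain p q r s t u bs where ps: "ps = p # q # r # s # t # u # bs"
    unfolding Suc_le_length_iff by blast
  have r: "link G r [q, v, s]" using fan_centre[of v "[]"] l ps by simp
  have s: "link G s [r, v, t]" using fan_centre[of v "[p]"] l ps by simp
  obtain q' where q': "(q, q') \<in> parcs G" "(s, q') \<in> parcs G" "q' \<noteq> v" "q' \<noteq> r"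
    using irreducible[OF r] by blast
  then have "q' = t" using link_nbr[OF s] by simp
  then have "(q, t) \<in> parcs G" using q' by simp
  then show False using l ps by (auto simp: link_def)
qed

text \<open>A vertex \<open>w\<close> of degree three together with its hub \<open>z\<close>. By \<open>hub_exists\<close> this is the
only way in which a vertex of degree three occurs.\<close>

definition hub :: "'a \<Rightarrow> 'a \<Rightarrow> 'a \<Rightarrow> 'a \<Rightarrow> 'a \<Rightarrow> 'a \<Rightarrow> bool" where
  "hub w z x y a b \<longleftrightarrow> link G w [x, z, y] \<and> link G z [a, x, w, y, b]"

lemma hub_swap: "hub w z x y a b \<longleftrightarrow> hub w z y x b a"
  using link_rev[OF graph, of w "[x, z, y]"] link_rev[OF graph, of z "[a, x, w, y, b]"]
  by (simp add: hub_def)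

text \<open>The link of \<open>z\<close> contains \<open>x, w, y\<close>, and continues on both sides since \<open>zx\<close> and \<open>zy\<close> are inner edges. As it has
at most five vertices, it continues by exactly one on each side.\<close>

lemma hub_exists:
  assumes l: "link G w [x, z, y]"
  shows "\<exists>a b. hub w z x y a b"
proof -
  have "inner_edge G w z x y" using link_inner[OF graph, of w "[]" x z y] l by simp
  then obtain as bs where z: "link G z (as @ x # w # y # bs)" using link_around inner_edge_comm by blast
  have wl: "link G w [y, z, x]" using l link_rev[OF graph, of w "[x, z, y]"] by simp
  have "\<not> solo G x z" "\<not> solo G y z" using rim_edges(2) l wl by blast+
  then have ns: "\<not> solo G z x" "\<not> solo G z y" by (simp_all add: solo_sym)
  have "as \<noteq> []" using z ns(1) boundary_edge_solo link_first[OF graph, of z x w] by fastforce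
  moreover have "bs \<noteq> []" using z ns(2) boundary_edge_solo link_last[OF graph, of z "as @ [x]" w y] by fastforce
  moreover have "length as + length bs \<le> 2" using link_length_le_5[OF z] by simp
  ultimately have "length as = 1" "length bs = 1" by (cases as; cases bs; simp)+
  then obtain a b where "as = [a]" "bs = [b]" by (auto simp: length_Suc_conv)
  then show ?thesis using z l by (auto simp: hub_def)
qed

lemma hub_arm:
  assumes h: "hub w z x y a b"
  shows "\<exists>bs. link G x (w # z # a # bs) \<and> length bs \<le> 2"
proof -
  have w: "link G w [x, z, y]" and z: "link G z [a, x, w, y, b]" using h by (auto simp: hub_def)
  have "boundary_edge G x w z" using link_first[OF graph w] by (rule boundary_edge_comm)
  then obtain cs where 1: "link G x ([] @ w # z # cs)" using link_start by fastforce
  have "inner_edge G z x w a" using link_inner[OF graph, of z "[]" a x w] z inner_edge_swap by fastforce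
  then have "inner_edge G x z w a" by (rule inner_edge_comm)
  then obtain bs where "cs = a # bs" using link_step[OF graph 1] by blast
  then show ?thesis using 1 link_length_le_5[OF 1] by auto
qed

text \<open>The link of \<open>q\<close> has the ends \<open>x\<close> and \<open>y\<close>, next to which are \<open>c\<close> and \<open>b\<close>; the bound on its length leaves room
for at most one further vertex.\<close>

lemma link_between:
  assumes x: "boundary_edge G q x c" and y: "boundary_edge G q y b" and ne: "x \<noteq> y"
  shows "link G q [x, c, y] \<and> b = c \<or> link G q [x, c, b, y] \<or> (\<exists>e. link G q [x, c, e, b, y])"
proof -
  obtain cs where l: "link G q (x # c # cs)" using link_start[OF x] by blast
  have "y \<in> set (x # c # cs)" using y link_nbr[OF l] by (auto simp: boundary_edge_def)
  moreover have "y \<noteq> c"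
  proof
    assume "y = c"
    have "cs \<noteq> []" using link_length[OF l] by auto
    then obtain d ds where "cs = d # ds" by (cases cs) auto
    then have "inner_edge G q c x d" using link_inner[OF graph, of q "[]" x c d ds] l by simp
    then show False using y \<open>y = c\<close> inner_edge_not_solo boundary_edge_solo by metis
  qed
  ultimately have "y \<in> set cs" using ne by simp
  then obtain ds es where cs: "cs = ds @ y # es" by (auto simp: in_set_conv_decomp)
  obtain fs g where fg: "x # c # ds = fs @ [g]" by (metis rev_exhaust list.distinct(1))
  have l': "link G q (fs @ g # y # es)" using l cs fg by (metis append_Cons append_assoc append_Nil)
  have "es = []" using link_stop[OF graph l' y] .
  moreover have "g = b"
    using boundary_edge_unique[OF y link_last[OF graph, of q fs g y]] l' calculation by simp
  moreover have "length ds \<le> 2" using link_length_le_5[OF l] cs by simp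
  ultimately show ?thesis using l cs fg
    by (cases ds; cases "tl ds") (auto simp: append_eq_Cons_conv Cons_eq_append_conv)
qed

end

context strip
begin

text \<open>Comparing neighbourhoods suffices: the image of \<open>f\<close> is then closed under taking neighbours, hence is the
whole graph by connectedness.\<close>

lemma is_S_graphI:
  assumes S: "S \<in> {S_A, S_B, S_C, S_D}"
    and inj: "inj_on f (pverts S)"
    and nbrs: "\<forall>s\<in>pverts S. open_neighborhood S s \<noteq> {} \<and>
      open_neighborhood G (f s) = f ` open_neighborhood S s"
  shows "is_S_graph G"
proof -
  have SG: "pair_graph S" by (rule pair_graph_S[OF S])
  have sub: "open_neighborhood S s \<subseteq> pverts S" for s
    using pair_graph_in_verts[OF SG] by (auto simp: open_neighborhood_def)
  have V: "f s \<in> pverts G" if s: "s \<in> pverts S" for s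
  proof -
    obtain t where "t \<in> open_neighborhood S s" using nbrs s by blast
    then have "f t \<in> open_neighborhood G (f s)" using nbrs s by blast
    then show ?thesis using pair_graph_in_verts[OF graph] by (auto simp: open_neighborhood_def)
  qed
  have "pverts S \<noteq> {}" using S by (auto simp: S_A_verts S_B_verts S_C_verts S_D_verts)
  then have im: "f ` pverts S = pverts G"
  proof (intro connected)
    fix v assume "v \<in> f ` pverts S"
    then obtain s where "s \<in> pverts S" "v = f s" by blast
    then show "open_neighborhood G v \<subseteq> f ` pverts S" using nbrs image_mono[OF sub[of s], of f] by simp
  qed (use V in auto)
  have "(s, t) \<in> parcs S \<longleftrightarrow> (f s, f t) \<in> parcs G" if "s \<in> pverts S" "t \<in> pverts S" for s t
  proof -
    have "(f s, f t) \<in> parcs G \<longleftrightarrow> f t \<in> f ` open_neighborhood S s"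
      using bspec[OF nbrs that(1)] unfolding open_neighborhood_iff[symmetric] by simp
    also have "\<dots> \<longleftrightarrow> t \<in> open_neighborhood S s"
      using inj_on_image_mem_iff[OF inj that(2) sub] .
    finally show ?thesis by (simp add: open_neighborhood_iff)
  qed
  then have "graph_iso_map S G f" using inj im by (simp add: graph_iso_map_def bij_betw_def)
  then have "digraph_iso (with_proj G) (with_proj S)"
    using graph_iso_map_inv digraph_iso_with_proj_iff[OF pair_graph_wf[OF graph] pair_graph_wf[OF SG]]
    by blast
  then show ?thesis using S unfolding is_S_graph_def by blast
qed

lemma is_S_AI:
  assumes "distinct [v1, v2, v3, v0, u1, u2, u3, u4]"
    "open_neighborhood G v0 = {v1, v3, u1, u3, u4}" "open_neighborhood G v1 = {v0, v2, u1, u2, u4}"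
    "open_neighborhood G v2 = {v1, v3, u1, u2, u3}" "open_neighborhood G v3 = {v0, v2, u2, u3, u4}"
    "open_neighborhood G u1 = {v0, v1, v2}" "open_neighborhood G u2 = {v1, v2, v3}"
    "open_neighborhood G u3 = {v0, v2, v3}" "open_neighborhood G u4 = {v0, v1, v3}"
  shows "is_S_graph G"
  by (rule is_S_graphI[of S_A "(\<lambda>_. v0)(V 1 := v1, V 2 := v2, V 3 := v3, U 1 := u1, U 2 := u2, U 3 := u3, U 4 := u4)"];
      insert assms; simp add: S_A_verts S_A_nbrs del: One_nat_def)

lemma is_S_BI:
  assumes "distinct [v1, v2, v3, v4, v0, u1, u2, u3]"
    "open_neighborhood G v0 = {v1, v3, v4, u1}" "open_neighborhood G v1 = {v0, v2, v4, u1, u2}"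
    "open_neighborhood G v2 = {v1, v3, u1, u2, u3}" "open_neighborhood G v3 = {v0, v2, v4, u2, u3}"
    "open_neighborhood G v4 = {v0, v1, v3, u3}"
    "open_neighborhood G u1 = {v0, v1, v2}" "open_neighborhood G u2 = {v1, v2, v3}"
    "open_neighborhood G u3 = {v2, v3, v4}"
  shows "is_S_graph G"
  by (rule is_S_graphI[of S_B "(\<lambda>_. v0)(V 1 := v1, V 2 := v2, V 3 := v3, V 4 := v4, U 1 := u1, U 2 := u2, U 3 := u3)"];
      insert assms; simp add: S_B_verts S_B_nbrs del: One_nat_def)

lemma is_S_CI:
  assumes "distinct [v1, v2, v3, v4, v5, v0, u1, u2]"
    "open_neighborhood G v0 = {v1, v4, v5, u1}" "open_neighborhood G v1 = {v0, v2, v5, u1, u2}"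
    "open_neighborhood G v2 = {v1, v3, v4, u1, u2}" "open_neighborhood G v3 = {v2, v4, v5, u2}"
    "open_neighborhood G v4 = {v0, v2, v3, v5}" "open_neighborhood G v5 = {v0, v1, v3, v4}"
    "open_neighborhood G u1 = {v0, v1, v2}" "open_neighborhood G u2 = {v1, v2, v3}"
  shows "is_S_graph G"
  by (rule is_S_graphI[of S_C "(\<lambda>_. v0)(V 1 := v1, V 2 := v2, V 3 := v3, V 4 := v4, V 5 := v5, U 1 := u1, U 2 := u2)"];
      insert assms; simp add: S_C_verts S_C_nbrs del: One_nat_def)

lemma is_S_DI:
  assumes "distinct [v1, v2, v3, v4, v5, v0, u1, u4]"
    "open_neighborhood G v0 = {v1, v4, v5, u1}" "open_neighborhood G v1 = {v0, v2, v3, v5, u1}"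
    "open_neighborhood G v2 = {v1, v3, v4, u1}" "open_neighborhood G v3 = {v1, v2, v4, u4}"
    "open_neighborhood G v4 = {v0, v2, v3, v5, u4}" "open_neighborhood G v5 = {v0, v1, v4, u4}"
    "open_neighborhood G u1 = {v0, v1, v2}" "open_neighborhood G u4 = {v3, v4, v5}"
  shows "is_S_graph G"
  by (rule is_S_graphI[of S_D "(\<lambda>_. v0)(V 1 := v1, V 2 := v2, V 3 := v3, V 4 := v4, V 5 := v5, U 1 := u1, U 4 := u4)"];
      insert assms; simp add: S_D_verts S_D_nbrs del: One_nat_def)

lemma link_distinct: "link G v ps \<Longrightarrow> distinct (v # ps)"
  using pair_graph_irrefl[OF graph, of v] by (auto simp: link_def open_neighborhood_def dest: induced_path_distinct)

lemma link_set: "link G v ps \<Longrightarrow> open_neighborhood G v = set ps"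
  by (simp add: link_def)

end

context irreducible_strip
begin

lemma link_edges5:
  assumes "link G v [a, b, c, d, e]"
  shows "boundary_edge G a v b" "inner_edge G b v a c" "inner_edge G c v b d" "inner_edge G d v c e" "boundary_edge G e v d"
  using link_first[OF graph assms] link_inner[OF graph, of v "[]" a b c "[d, e]"]
    link_inner[OF graph, of v "[a]" b c d "[e]"] link_inner[OF graph, of v "[a, b]" c d e "[]"]
    link_last[OF graph, of v "[a, b, c]" d e] assms
  by (auto intro: boundary_edge_comm inner_edge_comm)

lemma link_edges4:
  assumes "link G v [a, b, c, d]"
  shows "boundary_edge G a v b" "inner_edge G b v a c" "inner_edge G c v b d" "boundary_edge G d v c"
  using link_first[OF graph assms] link_inner[OF graph, of v "[]" a b c "[d]"]
    link_inner[OF graph, of v "[a]" b c d "[]"] link_last[OF graph, of v "[a, b]" c d] assms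
  by (auto intro: boundary_edge_comm inner_edge_comm)

lemma link_edges3:
  assumes "link G v [a, b, c]"
  shows "boundary_edge G a v b" "inner_edge G b v a c" "boundary_edge G c v b"
  using link_first[OF graph assms] link_inner[OF graph, of v "[]" a b c "[]"]
    link_last[OF graph, of v "[a]" b c] assms
  by (auto intro: boundary_edge_comm inner_edge_comm)

lemma fan_centre5: "link G v [p, q, r, s, t] \<Longrightarrow> link G r [q, v, s]"
  using fan_centre[of v "[]" p q r s t "[]"] by simp

text \<open>The arms of a hub are the links of \<open>x\<close> and \<open>y\<close>. An arm is short if it ends with \<open>q\<close> at degree four, medium if
\<open>q\<close> is followed by one more vertex, and long if one vertex precedes \<open>q\<close>. In each combination the link
of \<open>q\<close> is pinned down by \<open>link_between\<close>, and then all links are known.\<close>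

lemma short_arms:
  assumes h: "hub w z x y a b" and x: "link G x [w, z, a, q]" and y: "link G y [w, z, b, q]"
  shows "is_S_graph G"
proof -
  have w: "link G w [x, z, y]" and z: "link G z [a, x, w, y, b]" using h by (auto simp: hub_def)
  note Z = link_edges5[OF z] and X = link_edges4[OF x] and Y = link_edges4[OF y]
  have xy: "x \<noteq> y" using link_distinct[OF w] by auto
  obtain e where q: "link G q [x, a, e, b, y]"
  proof -
    have "b \<noteq> a" using link_distinct[OF z] by auto
    moreover have "\<not> link G q [x, a, b, y]"
    proof
      assume "link G q [x, a, b, y]"
      then have "(a, b) \<in> parcs G" by (simp add: link_def)
      then show False using z by (auto simp: link_def)
    qed
    ultimately show ?thesis using link_between[OF X(4) Y(4) xy] that by blast
  qed
  note Q = link_edges5[OF q]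
  have e: "link G e [a, q, b]" by (rule fan_centre5[OF q])
  note E = link_edges3[OF e]
  have a: "link G a [z, x, q, e]"
    using Z(1) X(3) Q(2) E(1) inner_edge_swap by (intro link4I) blast+
  have b: "link G b [z, y, q, e]"
    using Z(5) Y(3) Q(4) E(3) inner_edge_swap by (intro link4I) blast+
  note d = link_distinct[OF w] link_distinct[OF z] link_distinct[OF x] link_distinct[OF y]
    link_distinct[OF a] link_distinct[OF b] link_distinct[OF q] link_distinct[OF e]
  note s = link_set[OF w] link_set[OF z] link_set[OF x] link_set[OF y]
    link_set[OF a] link_set[OF b] link_set[OF q] link_set[OF e]
  have "w \<noteq> e" using s(1,8) d by auto
  then show ?thesis
    using d s by (intro is_S_DI[of z x a q b y w e]; auto)
qed

lemma fan_edge4: "link G v [p, q, r, s] \<Longrightarrow> boundary_edge G q r v"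
  using fan_edge[of v "[]" p q r s "[]"] by simp

text \<open>The irreducibility of the degree three vertex \<open>a\<close>: the common neighbour of \<open>z\<close> and \<open>c\<close> lies in the link
\<open>a, x, w, y, b\<close> of \<open>z\<close>, and only \<open>y\<close> and \<open>b\<close> are possible. This is what excludes
links of \<open>q\<close> that are too long.\<close>

lemma hub_second:
  assumes h: "hub w z x y a b" and a: "link G a [z, x, c]"
  shows "(c, y) \<in> parcs G \<or> (c, b) \<in> parcs G"
proof -
  have w: "link G w [x, z, y]" and z: "link G z [a, x, w, y, b]" using h by (auto simp: hub_def)
  obtain r where r: "(z, r) \<in> parcs G" "(c, r) \<in> parcs G" "r \<noteq> x" "r \<noteq> a"
    using irreducible[OF a] by blast
  have "r \<in> {w, y, b}" using r(1,3,4) link_nbr[OF z] by auto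
  moreover have "(c, w) \<notin> parcs G"
  proof
    assume "(c, w) \<in> parcs G"
    then have "c \<in> {x, z, y}" using link_nbr[OF w] sym[of c w] by auto
    then have "c = y" using link_distinct[OF a] by auto
    then show False using a w by (auto simp: link_def)
  qed
  ultimately show ?thesis using r(2) by blast
qed

lemma long_arm_short_arm:
  assumes h: "hub w z x y a b" and x: "link G x [w, z, a, c, q]" and y: "link G y [w, z, b, q]"
  shows "is_S_graph G"
proof -
  have w: "link G w [x, z, y]" and z: "link G z [a, x, w, y, b]" using h by (auto simp: hub_def)
  have ne: "x \<noteq> y" "a \<noteq> b" "a \<noteq> y" "x \<noteq> b" using link_distinct[OF z] by auto
  have nadj: "(x, y) \<notin> parcs G" "(x, b) \<notin> parcs G" using z by (auto simp: link_def)
  note Z = link_edges5[OF z] and X = link_edges5[OF x] and Y = link_edges4[OF y]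
  have a: "link G a [z, x, c]" by (rule fan_centre5[OF x])
  note A = link_edges3[OF a]
  have "b \<noteq> c" using nadj(2) link_nbr[OF x] by auto
  moreover have "\<not> link G q [x, c, e, b, y]" for e
    using hub_second[OF h a] by (auto simp: link_def)
  ultimately have q: "link G q [x, c, b, y]" using link_between[OF X(5) Y(4) ne(1)] by blast
  note Q = link_edges4[OF q]
  have cb: "boundary_edge G c b q" by (rule fan_edge4[OF q])
  have b: "link G b [z, y, q, c]" by (rule link4I[OF Z(5) Y(3) inner_edge_swap[OF Q(3)] boundary_edge_comm[OF cb]])
  have c: "link G c [a, x, q, b]" by (rule link4I[OF A(3) X(4) Q(2) cb])
  note d = link_distinct[OF w] link_distinct[OF z] link_distinct[OF x] link_distinct[OF y] link_distinct[OF a] link_distinct[OF b] link_distinct[OF q] link_distinct[OF c]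
  note s = link_set[OF w] link_set[OF z] link_set[OF x] link_set[OF y] link_set[OF a] link_set[OF b] link_set[OF q] link_set[OF c]
  show ?thesis
    using d s by (intro is_S_CI[of z x c q b y w a]; auto)
qed

lemma medium_arm_short_arm:
  assumes h: "hub w z x y a b" and x: "link G x [w, z, a, q, e]" and y: "link G y [w, z, b, q]"
  shows "is_S_graph G"
proof -
  have w: "link G w [x, z, y]" and z: "link G z [a, x, w, y, b]" using h by (auto simp: hub_def)
  have ne: "x \<noteq> y" "a \<noteq> b" "a \<noteq> y" "x \<noteq> b" using link_distinct[OF z] by auto
  have nadj: "(x, y) \<notin> parcs G" "(x, b) \<notin> parcs G" using z by (auto simp: link_def)
  note Z = link_edges5[OF z] and X = link_edges5[OF x] and Y = link_edges4[OF y]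
  have a: "link G a [z, x, q]" by (rule fan_centre5[OF x])
  note A = link_edges3[OF a]
  have "\<not> link G q [a, x, b, y]" using nadj(2) by (auto simp: link_def)
  then obtain f where q: "link G q [a, x, f, b, y]"
    using link_between[OF A(3) Y(4) ne(3)] ne(4) by blast
  note Q = link_edges5[OF q]
  have "f = e" by (rule inner_edge_unique[OF inner_edge_comm[OF X(4)] Q(2)])
  then have e: "link G e [x, q, b]" using fan_centre5[OF q] by simp
  note E = link_edges3[OF e]
  have b: "link G b [z, y, q, e]"
    using link4I[OF Z(5) Y(3) inner_edge_swap[OF Q(4)]] E(3) \<open>f = e\<close> by blast
  note d = link_distinct[OF w] link_distinct[OF z] link_distinct[OF x] link_distinct[OF y] link_distinct[OF a] link_distinct[OF b] link_distinct[OF q] link_distinct[OF e]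
  note s = link_set[OF w] link_set[OF z] link_set[OF x] link_set[OF y] link_set[OF a] link_set[OF b] link_set[OF q] link_set[OF e]
  show ?thesis
    using d s \<open>f = e\<close> by (intro is_S_BI[of z x q b y w a e]; auto)
qed

lemma long_arm_medium_arm:
  assumes h: "hub w z x y a b" and x: "link G x [w, z, a, c, q]" and y: "link G y [w, z, b, q, e]"
  shows "is_S_graph G"
proof -
  have w: "link G w [x, z, y]" and z: "link G z [a, x, w, y, b]" using h by (auto simp: hub_def)
  have ne: "x \<noteq> y" "a \<noteq> b" "a \<noteq> y" "x \<noteq> b" using link_distinct[OF z] by auto
  have nadj: "(x, y) \<notin> parcs G" "(x, b) \<notin> parcs G" using z by (auto simp: link_def)
  note X = link_edges5[OF x] and Y = link_edges5[OF y]
  have a: "link G a [z, x, c]" by (rule fan_centre5[OF x])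
  have b: "link G b [z, y, q]" by (rule fan_centre5[OF y])
  note A = link_edges3[OF a] and B = link_edges3[OF b]
  have "y \<noteq> c" using nadj(1) link_nbr[OF x] by auto
  moreover have "\<not> link G q [x, c, f, y, b]" for f
    using hub_second[OF h a] by (auto simp: link_def)
  ultimately have q: "link G q [x, c, y, b]" using link_between[OF X(5) B(3) ne(4)] by blast
  note Q = link_edges4[OF q]
  have "c = e" by (rule inner_edge_unique[OF inner_edge_comm[OF Y(4)] inner_edge_swap[OF Q(3)]])
  then have c: "link G c [a, x, q, y]" using link4I[OF A(3) X(4) Q(2)] Y(5) by blast
  note d = link_distinct[OF w] link_distinct[OF z] link_distinct[OF x] link_distinct[OF y] link_distinct[OF a] link_distinct[OF b] link_distinct[OF q] link_distinct[OF c]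
  note s = link_set[OF w] link_set[OF z] link_set[OF x] link_set[OF y] link_set[OF a] link_set[OF b] link_set[OF q] link_set[OF c]
  show ?thesis
    using d s \<open>c = e\<close> by (intro is_S_BI[of x z y q c a w b]; auto)
qed

lemma long_arms:
  assumes h: "hub w z x y a b" and x: "link G x [w, z, a, c, q]" and y: "link G y [w, z, b, e, q]"
  shows "is_S_graph G"
proof -
  have w: "link G w [x, z, y]" and z: "link G z [a, x, w, y, b]" using h by (auto simp: hub_def)
  have ne: "x \<noteq> y" "a \<noteq> b" "a \<noteq> y" "x \<noteq> b" using link_distinct[OF z] by auto
  have nadj: "(x, y) \<notin> parcs G" "(x, b) \<notin> parcs G" using z by (auto simp: link_def)
  note X = link_edges5[OF x] and Y = link_edges5[OF y]
  have a: "link G a [z, x, c]" by (rule fan_centre5[OF x])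
  have b: "link G b [z, y, e]" by (rule fan_centre5[OF y])
  note A = link_edges3[OF a] and B = link_edges3[OF b]
  have "(c, y) \<in> parcs G \<or> c = e"
  proof -
    have "(c, b) \<in> parcs G \<Longrightarrow> c \<in> {z, y, e}" using link_nbr[OF b] sym[of c b] by simp
    moreover have "c \<noteq> z" "c \<noteq> y" using link_distinct[OF x] nadj(1) link_nbr[OF x] by auto
    ultimately show ?thesis using hub_second[OF h a] by blast
  qed
  then have "\<not> link G q [x, c, e, y]" "\<not> link G q [x, c, f, e, y]" for f
    by (auto simp: link_def)
  then have q: "link G q [x, c, y]" and "e = c" using link_between[OF X(5) Y(5) ne(1)] by blast+
  note Q = link_edges3[OF q]
  have c: "link G c [a, x, q, y, b]"
    using link5I[OF A(3) X(4) Q(2)] inner_edge_swap[OF Y(4)] B(3) \<open>e = c\<close> by blast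
  note d = link_distinct[OF w] link_distinct[OF z] link_distinct[OF x] link_distinct[OF y] link_distinct[OF a] link_distinct[OF b] link_distinct[OF q] link_distinct[OF c]
  note s = link_set[OF w] link_set[OF z] link_set[OF x] link_set[OF y] link_set[OF a] link_set[OF b] link_set[OF q] link_set[OF c]
  show ?thesis
    using d s \<open>e = c\<close> by (intro is_S_AI[of z x c y w a q b]; auto)
qed

lemma medium_arms:
  assumes h: "hub w z x y a b" and x: "link G x [w, z, a, q, e]" and y: "link G y [w, z, b, q, f]"
  shows "is_S_graph G"
proof -
  have w: "link G w [x, z, y]" and z: "link G z [a, x, w, y, b]" using h by (auto simp: hub_def)
  have ne: "x \<noteq> y" "a \<noteq> b" "a \<noteq> y" "x \<noteq> b" using link_distinct[OF z] by auto
  have nadj: "(x, y) \<notin> parcs G" "(x, b) \<notin> parcs G" using z by (auto simp: link_def)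
  note X = link_edges5[OF x] and Y = link_edges5[OF y]
  have a: "link G a [z, x, q]" by (rule fan_centre5[OF x])
  have b: "link G b [z, y, q]" by (rule fan_centre5[OF y])
  note A = link_edges3[OF a] and B = link_edges3[OF b]
  have "\<not> link G q [a, x, y, b]" using nadj(1) by (auto simp: link_def)
  then obtain g where q: "link G q [a, x, g, y, b]"
    using link_between[OF A(3) B(3) ne(2)] ne(1) by blast
  note Q = link_edges5[OF q]
  have "g = e" by (rule inner_edge_unique[OF inner_edge_comm[OF X(4)] Q(2)])
  have "g = f" by (rule inner_edge_unique[OF inner_edge_comm[OF Y(4)] inner_edge_swap[OF Q(4)]])
  have e: "link G e [x, q, y]" using fan_centre5[OF q] \<open>g = e\<close> by simp
  note d = link_distinct[OF w] link_distinct[OF z] link_distinct[OF x] link_distinct[OF y] link_distinct[OF a] link_distinct[OF b] link_distinct[OF q] link_distinct[OF e]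
  note s = link_set[OF w] link_set[OF z] link_set[OF x] link_set[OF y] link_set[OF a] link_set[OF b] link_set[OF q] link_set[OF e]
  show ?thesis
    using d s \<open>g = e\<close> \<open>g = f\<close> by (intro is_S_AI[of z x q y w a e b]; auto)
qed

text \<open>The link of \<open>x\<close> starts with \<open>w, z, a\<close> and has at most two more vertices, and \<open>q\<close> is not \<open>a\<close> because
\<open>ay\<close> would be a chord of the link of \<open>z\<close>.\<close>

lemma arm_cases:
  assumes h: "hub w z x y a b" and q: "(x, q) \<in> parcs G" "(y, q) \<in> parcs G" "q \<noteq> z" "q \<noteq> w"
  shows "link G x [w, z, a, q] \<or> (\<exists>e. link G x [w, z, a, q, e]) \<or> (\<exists>c. link G x [w, z, a, c, q])"
proof -
  obtain bs where x: "link G x (w # z # a # bs)" "length bs \<le> 2" using hub_arm[OF h] by blast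
  have "q \<noteq> a"
  proof
    assume "q = a"
    then have "(a, y) \<in> parcs G" using q(2) sym[of y q] by simp
    then show False using h by (auto simp: hub_def link_def)
  qed
  then have "q \<in> set bs" using link_nbr[OF x(1)] q by simp
  moreover have "bs = [] \<or> (\<exists>c. bs = [c]) \<or> (\<exists>c e. bs = [c, e])"
    using x(2) by (simp add: le_Suc_eq length_Suc_conv numeral_2_eq_2) blast
  ultimately consider "bs = [q]" | e where "bs = [q, e]" | c where "bs = [c, q]" by fastforce
  then show ?thesis using x(1) by cases blast+
qed

theorem is_S_graph_of_degree_three:
  assumes w: "link G w [x, z, y]"
  shows "is_S_graph G"
proof -
  obtain a b where h: "hub w z x y a b" using hub_exists[OF w] by blast
  then have h': "hub w z y x b a" using hub_swap by blast
  obtain q where q: "(x, q) \<in> parcs G" "(y, q) \<in> parcs G" "q \<noteq> z" "q \<noteq> w"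
    using irreducible[OF w] by blast
  note X = arm_cases[OF h q] and Y = arm_cases[OF h' q(2,1,3,4)]
  show ?thesis
    using X Y
    by (elim disjE exE)
      (erule (1) short_arms[OF h] long_arm_short_arm[OF h] long_arm_short_arm[OF h']
        medium_arm_short_arm[OF h] medium_arm_short_arm[OF h'] long_arm_medium_arm[OF h]
        long_arm_medium_arm[OF h'] long_arms[OF h] medium_arms[OF h])+
qed

end

section \<open>Strips without vertices of degree three\<close>

locale zigzag_strip = strip +
  assumes no_degree_three: "\<not> link G v [p, q, r]"
begin

text \<open>A fifth vertex in the link would make its middle vertex have degree three, by \<open>fan_centre\<close>.\<close>

lemma link4_cases:
  assumes l: "link G v ps"
  obtains p q r s where "ps = [p, q, r, s]"
proof -
  have "Suc (Suc (Suc 0)) \<le> length ps" using link_length[OF l] by simp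
  then obtain p q r bs where ps: "ps = p # q # r # bs" unfolding Suc_le_length_iff by blast
  then obtain s cs where bs: "bs = s # cs" using no_degree_three l by (cases bs) auto
  have "cs = []"
  proof (rule ccontr)
    assume "cs \<noteq> []"
    then obtain t ds where "cs = t # ds" by (cases cs) auto
    then have "link G r [q, v, s]" using fan_centre[of v "[]" p q r s t ds] l ps bs by simp
    then show False using no_degree_three by blast
  qed
  then show ?thesis using that ps bs by simp
qed

text \<open>The edge \<open>qr\<close> is on the boundary, so the link of \<open>r\<close> starts with \<open>q\<close>, and then runs parallel to that of
\<open>v\<close>.\<close>

lemma zigzag_step:
  assumes l: "link G v [p, q, r, s]"
  shows "\<exists>t. link G r [q, v, s, t]"
proof -
  have "boundary_edge G r q v" using fan_edge[of v "[]" p q r s "[]"] l boundary_edge_comm by simp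
  then obtain bs where 1: "link G r ([] @ q # v # bs)" using link_start by fastforce
  have "inner_edge G v r q s" using link_inner[OF graph, of v "[p]" q r s "[]"] l by simp
  then obtain cs where "bs = s # cs" using link_step[OF graph 1 inner_edge_comm] by blast
  then show ?thesis using 1 link4_cases[OF 1] by fastforce
qed

lemma link4_unique:
  assumes l: "link G v [a, b, c, d]" and l': "link G v [a', b', c', d']"
  shows "a' = a \<and> b' = b \<and> c' = c \<and> d' = d \<or> a' = d \<and> b' = c \<and> c' = b \<and> d' = a"
proof -
  have start: "b' = b \<and> c' = c \<and> d' = d"
    if m: "link G v [a, b, c, d]" "link G v [a, b', c', d']" for a b c d b' c' d'
  proof -
    have b: "b' = b" using boundary_edge_unique[OF link_first[OF graph m(1)] link_first[OF graph m(2)]] .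
    have c: "c' = c" using inner_edge_unique[of G v b a c c'] link_inner[OF graph, of v "[]"] m b by simp
    show ?thesis using inner_edge_unique[of G v c b d d'] link_inner[OF graph, of v "[a]"] m b c by simp
  qed
  have r: "link G v [d, c, b, a]" using l link_rev[OF graph, of v "[a, b, c, d]"] by simp
  have "a' \<in> {a, b, c, d}" using link_set[OF l] link_set[OF l'] by auto
  moreover have "solo G v a'" using link_first[OF graph l'] by (rule boundary_edge_solo)
  moreover have "\<not> solo G v b" "\<not> solo G v c"
    using link_inner[OF graph, of v "[]" a b c "[d]"] link_inner[OF graph, of v "[a]" b c d "[]"] l
      inner_edge_not_solo by fastforce+
  ultimately have "a' = a \<or> a' = d" by blast
  then show ?thesis using start[OF l] start[OF r] l' by blast
qed

lemma zigzag_exists: "\<exists>g :: nat \<Rightarrow> 'a. \<forall>i. link G (g (i + 2)) [g i, g (i + 1), g (i + 3), g (i + 4)]"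
proof -
  let ?P = "\<lambda>(_::nat) x. \<exists>p q v r s. x = [p, q, v, r, s] \<and> link G v [p, q, r, s]"
  let ?Q = "\<lambda>(_::nat) x y. \<exists>t. y = tl x @ [t]"
  obtain v where "v \<in> pverts G" using nonempty by blast
  then obtain ps where ps: "link G v ps" using links by blast
  obtain p q r s where "ps = [p, q, r, s]" by (rule link4_cases[OF ps])
  then have start: "?P 0 [p, q, v, r, s]" using ps by simp
  have "\<exists>f. \<forall>n. ?P n (f n) \<and> ?Q n (f n) (f (Suc n))"
  proof (rule dependent_nat_choice)
    show "\<exists>x. ?P 0 x" using start by blast
    show "\<exists>y. ?P (Suc n) y \<and> ?Q n x y" if Px: "?P n x" for x n
    proof -
      obtain p q v r s where x: "x = [p, q, v, r, s]" "link G v [p, q, r, s]" using Px by blast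
      then obtain t where "link G r [q, v, s, t]" using zigzag_step by blast
      then show ?thesis using x(1) by (intro exI[of _ "[q, v, r, s, t]"]) simp
    qed
  qed
  then obtain f where f: "\<And>n. ?P n (f n)" "\<And>n. ?Q n (f n) (f (Suc n))" by blast
  have len: "length (f n) = 5" for n
    using f(1)[of n] by (elim exE conjE) simp
  define g where "g n = f n ! 0" for n
  have shift: "f n ! Suc i = f (Suc n) ! i" if "i < 4" for n i
  proof -
    obtain t where "f (Suc n) = tl (f n) @ [t]" using f(2) by blast
    then show ?thesis using that len[of n] by (simp add: nth_append nth_tl)
  qed
  have nth: "f n ! i = g (n + i)" if "i < 5" for n i
    using that
  proof (induction i arbitrary: n)
    case (Suc i)
    then show ?case using shift[of i n] by simp
  qed (simp add: g_def)
  have "link G (g (i + 2)) [g i, g (i + 1), g (i + 3), g (i + 4)]" for i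
  proof -
    obtain p q v r s where x: "f i = [p, q, v, r, s]" "link G v [p, q, r, s]" using f(1) by blast
    have "p = g i" "q = g (i + 1)" "v = g (i + 2)" "r = g (i + 3)" "s = g (i + 4)"
      using nth[of 0 i] nth[of 1 i] nth[of 2 i] nth[of 3 i] nth[of 4 i] x(1) by simp_all
    then show ?thesis using x(2) by simp
  qed
  then show ?thesis by blast
qed

lemma zigzag_local:
  assumes g: "\<And>i. link G (g (i + 2)) [g i, g (i + 1), g (i + 3), g (i + 4)]"
    and eq: "g i = g j" and lt: "(i::nat) < j"
  shows "i + 5 \<le> j"
proof (rule ccontr)
  assume "\<not> i + 5 \<le> j"
  then have "j \<in> {i + 1, i + 2, i + 3, i + 4}" using lt by auto
  then show False using link_distinct[OF g[of i]] eq by auto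
qed

text \<open>Let \<open>d\<close> be the smallest distance at which a value repeats. The links at the two places agree, or one is the
reversal of the other. A reversal would make the values next to the two places, on their inner sides, coincide at
distance \<open>d - 2\<close>, which is positive as \<open>d \<ge> 5\<close>; this contradicts minimality. So the links agree, and the
repetition propagates.\<close>

lemma periodic_zigzag:
  shows "\<exists>(h :: nat \<Rightarrow> 'a) d. (\<forall>i. link G (h (i + 2)) [h i, h (i + 1), h (i + 3), h (i + 4)]) \<and>
    (\<forall>i. h (i + d) = h i) \<and> (\<forall>i j. i < j \<longrightarrow> h i = h j \<longrightarrow> i + d \<le> j) \<and> 0 < d"
proof -
  obtain g :: "nat \<Rightarrow> 'a" where g: "\<And>i. link G (g (i + 2)) [g i, g (i + 1), g (i + 3), g (i + 4)]"
    using zigzag_exists by blast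
  \<comment> \<open>Indices start at \<open>2\<close> because the link is known only for \<open>g (i + 2)\<close>.\<close>
  define D where "D = {d. 0 < d \<and> (\<exists>i\<ge>2. g i = g (i + d))}"
  have "\<exists>i\<ge>2. \<exists>j\<ge>2. i \<noteq> j \<and> g i = g j"
  proof -
    have "g i \<in> pverts G" if "2 \<le> i" for i
    proof -
      have "g (i - 2 + 2) \<in> pverts G" using g unfolding link_def by blast
      then show ?thesis by (simp only: le_add_diff_inverse2[OF that])
    qed
    then have "g ` {2..} \<subseteq> pverts G" by auto
    then have "finite (g ` {2..})" using pair_graph_finite[OF graph] finite_subset by blast
    then have "\<not> inj_on g {2..}" using finite_imageD infinite_Ici[of 2] by blast
    then show ?thesis unfolding inj_on_def by blast
  qed
  then obtain i j where "2 \<le> i" "2 \<le> j" "i \<noteq> j" "g i = g j" by blast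
  then have "\<exists>i j. 2 \<le> i \<and> i < j \<and> g i = g j" 
    using linorder_neqE_nat[of i j] by metis
  then obtain i j where "2 \<le> i" "i < j" "g i = g j" by blast
  then have "0 < j - i \<and> 2 \<le> i \<and> g i = g (i + (j - i))" by simp
  then have "j - i \<in> D" unfolding D_def by blast
  define d where "d = (LEAST d. d \<in> D)"
  have dD: "d \<in> D" unfolding d_def using \<open>j - i \<in> D\<close> by (rule LeastI)
  have min: "d \<le> e" if "e \<in> D" for e unfolding d_def using that by (rule Least_le)
  have min': "i + d \<le> j" if "2 \<le> i" "i < j" "g i = g j" for i j
  proof -
    have "0 < j - i \<and> 2 \<le> i \<and> g i = g (i + (j - i))" using that by simp
    then have "j - i \<in> D" unfolding D_def by blast
    then show ?thesis using min[of "j - i"] that(2) by linarith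
  qed
  obtain m where m: "2 \<le> m" "g m = g (m + d)" and d0: "0 < d" using dD by (auto simp: D_def)
  have step: "g (i + 1) = g (i + 1 + d)" if i: "2 \<le> i" "g i = g (i + d)" for i
  proof -
    obtain a where a: "i = a + 2" using i(1) by (metis add.commute le_Suc_ex)
    have 1: "link G (g i) [g a, g (a + 1), g (a + 3), g (a + 4)]" using g[of a] a by simp
    have 2: "link G (g i) [g (a + d), g (a + d + 1), g (a + d + 3), g (a + d + 4)]"
      using g[of "a + d"] a i(2) by (simp add: add.commute add.left_commute)
    have d5: "5 \<le> d" using zigzag_local[OF g i(2)] d0 by simp
    have "\<not> g (a + d + 1) = g (a + 3)"
    proof
      assume "g (a + d + 1) = g (a + 3)"
      then have "a + 3 + d \<le> a + d + 1" using min'[of "a + 3" "a + d + 1"] d5 by simp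
      then show False by simp
    qed
    then have "g (a + d + 3) = g (a + 3)" using link4_unique[OF 1 2] by blast
    moreover have "i + 1 = a + 3" "i + 1 + d = a + d + 3" using a by simp_all
    ultimately show ?thesis by metis
  qed
  have per: "g (m + t) = g (m + t + d)" for t
  proof (induction t)
    case (Suc t)
    then show ?case using step[of "m + t"] m(1) by simp
  qed (use m in simp)
  define h where "h t = g (m + t)" for t
  have "link G (h (i + 2)) [h i, h (i + 1), h (i + 3), h (i + 4)]" for i
    using g[of "m + i"] by (simp add: h_def add.assoc)
  moreover have "h (i + d) = h i" for i using per[of i] by (simp add: h_def add.assoc)
  moreover have "i + d \<le> j" if "i < j" "h i = h j" for i j
    using min'[of "m + i" "m + j"] m(1) that by (simp add: h_def)
  ultimately show ?thesis using d0 by blast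
qed

text \<open>In the zigzag \<open>h\<close>, the value \<open>h 4\<close> is adjacent to \<open>h 5\<close> and \<open>h 6\<close>, but not to \<open>h 0\<close>, as \<open>h 0\<close> and
\<open>h 4\<close> are the two ends of the link of \<open>h 2\<close>; so the period is not \<open>5\<close> or \<open>6\<close>.\<close>

theorem is_cycle_square: "is_cycle_square G"
proof -
  obtain h :: "nat \<Rightarrow> 'a" and d where h: "\<And>i. link G (h (i + 2)) [h i, h (i + 1), h (i + 3), h (i + 4)]"
    and per: "\<And>i. h (i + d) = h i" and inj: "\<And>i j. i < j \<Longrightarrow> h i = h j \<Longrightarrow> i + d \<le> j" and d0: "0 < d"
    using periodic_zigzag by blast
  have d5: "5 \<le> d" using zigzag_local[OF h, of 0 d] per[of 0] d0 by simp
  have path: "(h 0, h 4) \<notin> parcs G" using h[of 0] by (auto simp: link_def)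
  have adj4: "(h 4, h 5) \<in> parcs G" "(h 4, h 6) \<in> parcs G"
    using link_nbr[OF h[of 2]] by simp_all
  have "d \<noteq> 5" "d \<noteq> 6"
    using path adj4 per[of 0] pair_graph_sym[OF graph, of "h 4" "h 0"] by auto
  then have d: "7 \<le> d" using d5 by simp
  have mod: "h (i mod d) = h i" for i
  proof -
    have "h (i + m * d) = h i" for m i
    proof (induction m)
      case (Suc m)
      then show ?case using per[of "i + m * d"] by (simp add: add.commute add.left_commute)
    qed simp
    from this[of "i mod d" "i div d"] show ?thesis by (simp add: add.commute)
  qed
  have nbrs: "open_neighborhood G (h i) = {h (i + d - 2), h (i + d - 1), h (i + 1), h (i + 2)}" for i
  proof -
    define j where "j = i + d - 2"
    have j: "i + d - 1 = j + 1" "i + d = j + 2" "i + 1 + d = j + 3" "i + 2 + d = j + 4"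
      using d by (simp_all add: j_def)
    have "h i = h (j + 2)" "h (i + 1) = h (j + 3)" "h (i + 2) = h (j + 4)"
      using per[of i] per[of "i + 1"] per[of "i + 2"] unfolding j by (simp_all only:)
    then show ?thesis unfolding j(1) j_def[symmetric] link_set[OF h[of j], folded \<open>h i = h (j + 2)\<close>]
      by (simp only: list.set)
  qed
  have inj': "inj_on h {..<d}"
  proof (rule inj_onI)
    fix i j assume ij: "i \<in> {..<d}" "j \<in> {..<d}" "h i = h j"
    show "i = j" using inj[of i j] inj[of j i] ij by (cases i j rule: linorder_cases) auto
  qed
  have im: "h ` {..<d} = pverts G"
  proof (rule connected)
    show "h ` {..<d} \<noteq> {}" using d by (auto simp: lessThan_empty_iff)
    have "h i \<in> pverts G" for i
    proof -
      have "h (i + 1) \<in> open_neighborhood G (h i)" unfolding nbrs by blast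
      then show ?thesis using pair_graph_in_verts[OF graph] unfolding open_neighborhood_iff by blast
    qed
    then show "h ` {..<d} \<subseteq> pverts G" by blast
    have all: "h i \<in> h ` {..<d}" for i using mod[of i] d by (metis imageI lessThan_iff mod_less_divisor d0)
    show "open_neighborhood G v \<subseteq> h ` {..<d}" if v: "v \<in> h ` {..<d}" for v
    proof -
      obtain i where "v = h i" using v by blast
      then show ?thesis using nbrs[of i] all by simp
    qed
  qed
  let ?Q = "graph_square (cycle_graph d)"
  have C: "pair_graph (cycle_graph d)" using d by (intro pair_graph_cycle_graph) simp
  have Q: "pair_graph ?Q" by (rule pair_graph_graph_square[OF C])
  have QV: "pverts ?Q = {..<d}" by (simp add: graph_square_verts cycle_graph_verts)
  have res: "res d (int n) = n mod d" for n
    using res_def[OF d] by (simp add: nat_mod_as_int)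
  have "(i, j) \<in> parcs ?Q \<longleftrightarrow> (h i, h j) \<in> parcs G" if ij: "i < d" "j < d" for i j
  proof -
    let ?S = "{(i + d - 2) mod d, (i + d - 1) mod d, (i + 1) mod d, (i + 2) mod d}"
    have r: "res d (int i - 2) = (i + d - 2) mod d" "res d (int i - 1) = (i + d - 1) mod d"
      "res d (int i + 1) = (i + 1) mod d" "res d (int i + 2) = (i + 2) mod d"
    proof -
      have "res d (int i - 2) = res d (int (i + d - 2))" "res d (int i - 1) = res d (int (i + d - 1))"
        using d by (simp_all add: res_eq[OF d] of_nat_diff)
      then show "res d (int i - 2) = (i + d - 2) mod d" "res d (int i - 1) = (i + d - 1) mod d"
        by (simp_all only: res)
      show "res d (int i + 1) = (i + 1) mod d" "res d (int i + 2) = (i + 2) mod d"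
        using res[of "i + 1"] res[of "i + 2"] by (simp_all add: add.commute)
    qed
    have "(i, j) \<in> parcs ?Q \<longleftrightarrow> j \<in> ?S"
      using square_arcs_res[OF d, of "int i" j] res_int[OF d ij(1)] unfolding r by simp
    also have "\<dots> \<longleftrightarrow> h j \<in> h ` ?S"
      using inj_on_image_mem_iff[OF inj', of j ?S] ij d by auto
    also have "h ` ?S = open_neighborhood G (h i)" unfolding nbrs by (simp add: mod)
    finally show ?thesis by (simp add: open_neighborhood_iff)
  qed
  then have "graph_iso_map ?Q G h"
    using inj' im by (simp add: graph_iso_map_def bij_betw_def QV)
  then have "digraph_iso (with_proj G) (with_proj ?Q)"
    using graph_iso_map_inv digraph_iso_with_proj_iff[OF pair_graph_wf[OF graph] pair_graph_wf[OF Q]] by blast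
  then show ?thesis unfolding is_cycle_square_def using d by blast
qed

end

section \<open>Undoing an edge splitting\<close>

definition contract :: "'a pair_pre_digraph \<Rightarrow> 'a \<Rightarrow> 'a \<Rightarrow> 'a \<Rightarrow> 'a pair_pre_digraph" where
  "contract G w x y = \<lparr>pverts = pverts G - {w},
     parcs = {(u, v) \<in> parcs G. u \<noteq> w \<and> v \<noteq> w} \<union> {(x, y), (y, x)}\<rparr>"

locale contractible_strip = strip +
  fixes w x y z :: 'a
  assumes w: "link G w [x, z, y]"
    and common: "(x, q) \<in> parcs G \<Longrightarrow> (y, q) \<in> parcs G \<Longrightarrow> q = z \<or> q = w"
begin

abbreviation H where "H \<equiv> contract G w x y"

lemma sym: "(u, v) \<in> parcs G \<longleftrightarrow> (v, u) \<in> parcs G"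
  by (rule pair_graph_sym[OF graph])

lemma distinct_wxyz: "w \<noteq> x" "w \<noteq> y" "w \<noteq> z" "x \<noteq> y" "x \<noteq> z" "y \<noteq> z"
  using link_distinct[OF w] by auto

lemma w_nbr: "(w, u) \<in> parcs G \<longleftrightarrow> u = x \<or> u = z \<or> u = y"
  using link_nbr[OF w] by simp

lemma w_nbr': "(u, w) \<in> parcs G \<longleftrightarrow> u = x \<or> u = z \<or> u = y"
  using w_nbr sym by blast

lemma edges: "(x, z) \<in> parcs G" "(z, y) \<in> parcs G" "(x, y) \<notin> parcs G" "(y, x) \<notin> parcs G"
  using w sym[of y x] distinct_wxyz by (auto simp: link_def)

lemma H_arcs: "(u, v) \<in> parcs H \<longleftrightarrow>
    (u, v) \<in> parcs G \<and> u \<noteq> w \<and> v \<noteq> w \<or> u = x \<and> v = y \<or> u = y \<and> v = x"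
  by (auto simp: contract_def)

lemma H_verts: "pverts H = pverts G - {w}"
  by (simp add: contract_def)

lemma in_verts: "x \<in> pverts G" "y \<in> pverts G" "z \<in> pverts G" "w \<in> pverts G"
  using edges pair_graph_in_verts[OF graph] w by (auto simp: link_def)

lemma graph_H: "pair_graph H"
proof (rule pair_graphI)
  show "finite (pverts H)" using pair_graph_finite[OF graph] by (simp add: H_verts)
  show "parcs H \<subseteq> pverts H \<times> pverts H"
    using pair_graph_in_verts[OF graph] in_verts distinct_wxyz by (auto simp: H_verts H_arcs)
  show "(u, v) \<in> parcs H \<Longrightarrow> (v, u) \<in> parcs H" for u v using sym by (auto simp: H_arcs)
  show "(v, v) \<notin> parcs H" for v using pair_graph_irrefl[OF graph] distinct_wxyz by (auto simp: H_arcs)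
qed

lemma swap: "contractible_strip G w y x z"
proof unfold_locales
  show "link G w [y, z, x]" using w link_rev[OF graph, of w "[x, z, y]"] by simp
qed (use common in blast)

lemma not_solo_xz: "\<not> solo G x z"
  using rim_edges(2)[OF w] .

lemma arm:
  obtains a where "inner_edge G x z w a"
proof -
  have "boundary_edge G x w z" using link_first[OF graph w] by (rule boundary_edge_comm)
  then obtain cs where 1: "link G x ([] @ w # z # cs)" using link_start by fastforce
  have "cs \<noteq> []" using link_length[OF 1] by auto
  then obtain a bs where "cs = a # bs" by (cases cs) auto
  then have "inner_edge G x z w a" using link_inner[OF graph, of x "[]" w z a bs] 1 by simp
  then show ?thesis using that by blast
qed

text \<open>The new edge \<open>xy\<close> is invisible here: a vertex adjacent to both \<open>x\<close> and \<open>y\<close> is \<open>z\<close> or \<open>w\<close>.\<close>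

lemma link_H_other:
  assumes v: "v \<in> pverts G" "v \<notin> {w, x, y, z}" and l: "link G v ps"
  shows "link H v ps"
proof -
  have "(v, w) \<notin> parcs G" using w_nbr' v by blast
  then have "open_neighborhood H v = open_neighborhood G v"
    using v by (auto simp: open_neighborhood_def H_arcs)
  moreover have "induced_path G ps \<longleftrightarrow> induced_path H ps"
  proof (rule induced_path_cong)
    fix s t assume st: "s \<in> set ps" "t \<in> set ps"
    then have "(v, s) \<in> parcs G" "(v, t) \<in> parcs G" using link_nbr[OF l] by auto
    then have "s \<noteq> w" "t \<noteq> w" "\<not> (s = x \<and> t = y)" "\<not> (s = y \<and> t = x)"
      using \<open>(v, w) \<notin> parcs G\<close> common[of v] v sym by blast+
    then show "(s, t) \<in> parcs G \<longleftrightarrow> (s, t) \<in> parcs H" by (auto simp: H_arcs)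
  qed
  ultimately show ?thesis using l v by (simp add: link_def H_verts)
qed

text \<open>In the link of \<open>z\<close> the vertex \<open>w\<close> is skipped, and the new edge joins its neighbours \<open>x\<close> and \<open>y\<close>.\<close>

lemma link_H_z: "\<exists>ps. link H z ps \<and> 2 \<le> length ps"
proof -
  have "inner_edge G w z x y" using link_inner[OF graph, of w "[]" x z y] w by simp
  then obtain as bs where l: "link G z (as @ x # w # y # bs)" using link_around inner_edge_comm by blast
  let ?A = "as @ [x]" and ?B = "y # bs"
  have ip: "induced_path G (?A @ w # ?B)" using l by (simp add: link_def)
  have A: "induced_path G ?A" and wB: "induced_path G (w # ?B)" and dj: "set ?A \<inter> set (w # ?B) = {}"
    and cross: "\<forall>s\<in>set ?A. \<forall>t\<in>set (w # ?B). (s, t) \<in> parcs G \<longleftrightarrow> s = last ?A \<and> t = hd (w # ?B)"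
    using ip unfolding induced_path_append[OF graph, of ?A] by blast+
  have wAB: "w \<notin> set ?A" "w \<notin> set ?B" using dj wB by auto
  have xyAB: "x \<notin> set ?B" "y \<notin> set ?A" using dj by auto
  have A': "induced_path H ?A"
  proof -
    have "induced_path G ?A \<longleftrightarrow> induced_path H ?A"
      using wAB(1) xyAB(2) by (intro induced_path_cong) (metis H_arcs)
    then show ?thesis using A by simp
  qed
  have B': "induced_path H ?B"
  proof -
    have "induced_path G ?B \<longleftrightarrow> induced_path H ?B"
      using wAB(2) xyAB(1) by (intro induced_path_cong) (metis H_arcs)
    then show ?thesis using wB by simp
  qed
  have "(s, t) \<in> parcs H \<longleftrightarrow> s = last ?A \<and> t = hd ?B" if s: "s \<in> set ?A" and t: "t \<in> set ?B" for s t
  proof -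
    have "(s, t) \<notin> parcs G" using cross s t wAB(2) by force
    moreover have "s \<noteq> y" using s xyAB(2) by blast
    ultimately show ?thesis by (auto simp: H_arcs)
  qed
  then have "induced_path H (?A @ ?B)"
    unfolding induced_path_append[OF graph_H, of ?A ?B] using A' B' dj by auto
  moreover have "set (?A @ ?B) = open_neighborhood H z"
  proof -
    have "open_neighborhood H z = open_neighborhood G z - {w}"
      using distinct_wxyz by (auto simp: open_neighborhood_def H_arcs)
    also have "\<dots> = set (?A @ w # ?B) - {w}" using link_set[OF l] by simp
    finally show ?thesis using wAB by auto
  qed
  ultimately have "link H z (?A @ ?B)" using in_verts distinct_wxyz by (simp add: link_def H_verts)
  then show ?thesis by (intro exI[of _ "?A @ ?B"]) simp
qed

text \<open>In the link of \<open>x\<close> the end \<open>w\<close> is replaced by \<open>y\<close>. No chord arises, because a neighbour of \<open>y\<close> in the link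
of \<open>x\<close> is a common neighbour of \<open>x\<close> and \<open>y\<close>.\<close>

lemma link_H_x: "\<exists>ps. link H x ps \<and> 2 \<le> length ps"
proof -
  have "boundary_edge G x w z" using link_first[OF graph w] by (rule boundary_edge_comm)
  then obtain cs where l: "link G x (w # z # cs)" using link_start by blast
  have mem: "(x, u) \<in> parcs G" if "u \<in> set (z # cs)" for u using link_nbr[OF l] that by simp
  have nmem: "w \<notin> set (z # cs)" "y \<notin> set (z # cs)" "x \<notin> set (z # cs)"
    using l mem edges pair_graph_irrefl[OF graph] by (auto simp: link_def)
  have "induced_path G (z # cs) \<longleftrightarrow> induced_path H (z # cs)"
    using nmem by (intro induced_path_cong) (metis H_arcs)
  then have "induced_path H (z # cs)" using l by (simp add: link_def)
  moreover have "(y, u) \<in> parcs H \<longleftrightarrow> u = z" if u: "u \<in> set (z # cs)" for u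
  proof -
    have "(y, u) \<in> parcs H \<longleftrightarrow> (y, u) \<in> parcs G" using u nmem distinct_wxyz by (metis H_arcs)
    also have "\<dots> \<longleftrightarrow> u = z" using common[OF mem[OF u]] edges(2) sym[of y z] u nmem(1) by metis
    finally show ?thesis .
  qed
  ultimately have "induced_path H (y # z # cs)" using nmem(2) by simp
  moreover have "set (y # z # cs) = open_neighborhood H x"
  proof -
    have "open_neighborhood H x = insert y (open_neighborhood G x - {w})"
      using distinct_wxyz by (auto simp: open_neighborhood_def H_arcs)
    also have "\<dots> = insert y (set (w # z # cs) - {w})" using link_set[OF l] by simp
    finally show ?thesis using nmem(1) by auto
  qed
  ultimately have "link H x (y # z # cs)" using in_verts distinct_wxyz by (simp add: link_def H_verts)
  then show ?thesis by (intro exI[of _ "y # z # cs"]) simp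
qed

lemma solo_H_xy: "open_neighborhood H x \<inter> open_neighborhood H y = {z}"
proof -
  have "q = z" if q: "(x, q) \<in> parcs H" "(y, q) \<in> parcs H" for q
  proof -
    have "q \<noteq> x" "q \<noteq> y" using q pair_graph_irrefl[OF graph_H] by blast+
    then have "(x, q) \<in> parcs G" "(y, q) \<in> parcs G" "q \<noteq> w" using q by (auto simp: H_arcs)
    then show ?thesis using common by blast
  qed
  moreover have "(x, z) \<in> parcs H" "(y, z) \<in> parcs H"
    using edges sym[of y z] distinct_wxyz by (simp_all add: H_arcs)
  ultimately show ?thesis unfolding set_eq_iff Int_iff open_neighborhood_iff singleton_iff by metis
qed

lemma xz_H: "\<exists>a. a \<noteq> y \<and> open_neighborhood H x \<inter> open_neighborhood H z = {y, a}"
proof -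
  obtain a where a: "inner_edge G x z w a" using arm by blast
  then have N: "open_neighborhood G x \<inter> open_neighborhood G z = {w, a}" and "a \<noteq> w" by (auto simp: inner_edge_def)
  have "(x, a) \<in> parcs G" using inner_edge_arcs[OF a] by blast
  then have "a \<noteq> y" using edges(3) by blast
  have "open_neighborhood H x = insert y (open_neighborhood G x - {w})"
    "open_neighborhood H z = open_neighborhood G z - {w}"
    using distinct_wxyz by (auto simp: open_neighborhood_def H_arcs)
  moreover have "y \<in> open_neighborhood G z" using edges by (simp add: open_neighborhood_def)
  ultimately have "open_neighborhood H x \<inter> open_neighborhood H z = {y, a}"
    using N \<open>a \<noteq> w\<close> distinct_wxyz by blast
  then show ?thesis using \<open>a \<noteq> y\<close> by blast
qed

lemma not_solo_H_xz: "\<not> solo H x z"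
  using xz_H by (auto simp: solo_def)

text \<open>A common neighbour is gained only through the new edge, and lost only if it is \<open>w\<close>; either way \<open>uv\<close>
is one of the edges \<open>xz\<close> and \<open>yz\<close>.\<close>

lemma solo_H_other:
  assumes uv: "(u, v) \<in> parcs G" "u \<noteq> w" "v \<noteq> w" "{u, v} \<noteq> {x, z}" "{u, v} \<noteq> {y, z}"
  shows "solo H u v \<longleftrightarrow> solo G u v"
proof -
  have ne: "u \<noteq> v" using uv(1) pair_graph_irrefl[OF graph] by blast
  have half: "(s, q) \<in> parcs G" if st: "{s, t} = {u, v}" and q: "(s, q) \<in> parcs H" "(t, q) \<in> parcs H" for s t q
  proof (rule ccontr)
    assume "(s, q) \<notin> parcs G"
    then have sq: "s = x \<and> q = y \<or> s = y \<and> q = x" using q(1) H_arcs by blast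
    have st': "(s, t) \<in> parcs G" "s \<noteq> t" "t \<noteq> w" using st uv(1-3) ne sym by (auto simp: doubleton_eq_iff)
    then have "(t, q) \<in> parcs G" using q(2) sq H_arcs by blast
    then have "t = z" using sq st' common[of t] sym by blast
    then show False using sq st uv(4,5) by auto
  qed
  have "q \<in> open_neighborhood H u \<inter> open_neighborhood H v \<longleftrightarrow>
      q \<in> open_neighborhood G u \<inter> open_neighborhood G v" for q
  proof
    assume "q \<in> open_neighborhood H u \<inter> open_neighborhood H v"
    then show "q \<in> open_neighborhood G u \<inter> open_neighborhood G v"
      using half[of u v q] half[of v u q] by (simp add: open_neighborhood_iff insert_commute)
  next
    assume q: "q \<in> open_neighborhood G u \<inter> open_neighborhood G v"
    have "q \<noteq> w"
    proof
      assume "q = w"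
      then have "u \<in> {x, z, y}" "v \<in> {x, z, y}" using q w_nbr' by (auto simp: open_neighborhood_iff)
      then show False using uv(1,4,5) ne edges(3,4) by auto
    qed
    then show "q \<in> open_neighborhood H u \<inter> open_neighborhood H v"
      using q uv(2,3) by (simp add: open_neighborhood_iff H_arcs)
  qed
  then have "open_neighborhood H u \<inter> open_neighborhood H v = open_neighborhood G u \<inter> open_neighborhood G v"
    by blast
  then show ?thesis by (simp add: solo_def)
qed

lemma contract_commute: "contract G w y x = H"
  by (simp add: contract_def insert_commute)

lemma link_H_y: "\<exists>ps. link H y ps \<and> 2 \<le> length ps"
  using contractible_strip.link_H_x[OF swap] unfolding contract_commute .

lemma yz_H: "\<exists>b. b \<noteq> x \<and> open_neighborhood H y \<inter> open_neighborhood H z = {x, b}"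
  using contractible_strip.xz_H[OF swap] unfolding contract_commute .

lemma not_solo_H_yz: "\<not> solo H y z"
  using contractible_strip.not_solo_H_xz[OF swap] unfolding contract_commute .

lemma not_solo_yz: "\<not> solo G y z"
  using contractible_strip.not_solo_xz[OF swap] .

lemma solo_H_iff:
  assumes uv: "(u, v) \<in> parcs G" "u \<noteq> w" "v \<noteq> w"
  shows "solo H u v \<longleftrightarrow> solo G u v"
proof (cases "{u, v} = {x, z} \<or> {u, v} = {y, z}")
  case True
  then show ?thesis
    using not_solo_H_xz not_solo_H_yz not_solo_xz not_solo_yz
    by (auto simp: doubleton_eq_iff solo_sym)
next
  case False
  then show ?thesis using solo_H_other[OF uv] by blast
qed

text \<open>The only triangle of \<open>H\<close> that is not a triangle of \<open>G\<close> is \<open>xyz\<close>, whose boundary edge is \<open>xy\<close>.\<close>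

lemma one_solo_H:
  assumes abc: "(a, b) \<in> parcs H" "(b, c) \<in> parcs H" "(a, c) \<in> parcs H"
  shows "solo H a b \<and> \<not> solo H b c \<and> \<not> solo H a c \<or> \<not> solo H a b \<and> solo H b c \<and> \<not> solo H a c \<or>
      \<not> solo H a b \<and> \<not> solo H b c \<and> solo H a c"
proof -
  note symH = pair_graph_sym[OF graph_H]
  have third: "c = z" if "(a, b) \<in> parcs H" "(b, c) \<in> parcs H" "(a, c) \<in> parcs H" "{a, b} = {x, y}" for a b c
  proof -
    have "(x, c) \<in> parcs H \<and> (y, c) \<in> parcs H" using that by (auto simp: doubleton_eq_iff)
    then have "c \<in> open_neighborhood H x \<inter> open_neighborhood H y" by (simp add: open_neighborhood_iff)
    then show ?thesis using solo_H_xy by simp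
  qed
  have sH: "solo H x y" using solo_H_xy by (auto simp: solo_def)
  have key: "solo H a b \<and> \<not> solo H b c \<and> \<not> solo H a c"
    if "(a, b) \<in> parcs H" "(b, c) \<in> parcs H" "(a, c) \<in> parcs H" "{a, b} = {x, y}" for a b c
    using third[OF that] that(4) sH not_solo_H_xz not_solo_H_yz by (auto simp: doubleton_eq_iff solo_sym)
  have G: "(u, v) \<in> parcs G \<and> u \<noteq> w \<and> v \<noteq> w" if "(u, v) \<in> parcs H" "{u, v} \<noteq> {x, y}" for u v
    using that by (auto simp: H_arcs)
  consider "{a, b} = {x, y}" | "{b, c} = {x, y}" | "{a, c} = {x, y}"
    | "{a, b} \<noteq> {x, y}" "{b, c} \<noteq> {x, y}" "{a, c} \<noteq> {x, y}" by blast
  then show ?thesis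
  proof cases
    case 1
    then show ?thesis using key[OF abc] by blast
  next
    case 2
    then show ?thesis using key[of b c a] abc symH[of a b] symH[of a c] solo_sym[of H a] by metis
  next
    case 3
    then show ?thesis using key[of a c b] abc symH[of b c] solo_sym[of H b c] by metis
  next
    case 4
    then have e: "(a, b) \<in> parcs G" "(b, c) \<in> parcs G" "(a, c) \<in> parcs G" and n: "a \<noteq> w" "b \<noteq> w" "c \<noteq> w"
      using G abc by blast+
    show ?thesis
      using one_solo[OF e] solo_H_iff[OF e(1) n(1,2)] solo_H_iff[OF e(2) n(2,3)] solo_H_iff[OF e(3) n(1,3)]
      by simp
  qed
qed

text \<open>A closed set of \<open>H\<close> becomes closed in \<open>G\<close> once \<open>w\<close> is added whenever \<open>z\<close>, and with it the whole triangle
\<open>xyz\<close>, belongs to the set.\<close>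

lemma connected_H:
  assumes S: "S \<noteq> {}" "S \<subseteq> pverts H" and closed: "\<And>v. v \<in> S \<Longrightarrow> open_neighborhood H v \<subseteq> S"
  shows "S = pverts H"
proof -
  have wS: "w \<notin> S" using S(2) by (auto simp: H_verts)
  have step: "u \<in> S" if "v \<in> S" "(v, u) \<in> parcs H" for u v
    using closed[OF that(1)] that(2) by (auto simp: open_neighborhood_iff)
  have zxy: "(z, x) \<in> parcs H" "(z, y) \<in> parcs H" "(x, z) \<in> parcs H" "(y, z) \<in> parcs H"
    using edges sym[of z x] sym[of y z] distinct_wxyz by (simp_all add: H_arcs)
  \<comment> \<open>\<open>z \<in> S\<close> iff \<open>S\<close> meets \<open>{x, y, z}\<close>, the neighbourhood of \<open>w\<close>.\<close>
  define S' where "S' = S \<union> (if z \<in> S then {w} else {})"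
  have "S' = pverts G"
  proof (rule connected)
    show "S' \<noteq> {}" using S(1) by (simp add: S'_def)
    show "S' \<subseteq> pverts G" using S(2) in_verts by (auto simp: S'_def H_verts)
    fix v assume v: "v \<in> S'"
    show "open_neighborhood G v \<subseteq> S'"
    proof
      fix u assume "u \<in> open_neighborhood G v"
      then have vu: "(v, u) \<in> parcs G" by (simp add: open_neighborhood_iff)
      consider "v = w" | "v \<noteq> w" "u = w" | "v \<noteq> w" "u \<noteq> w" by blast
      then show "u \<in> S'"
      proof cases
        case 1
        then have "z \<in> S" using v wS by (auto simp: S'_def split: if_splits)
        then have "x \<in> S" "y \<in> S" using step zxy by blast+
        then show ?thesis using vu 1 w_nbr \<open>z \<in> S\<close> by (auto simp: S'_def)
      next
        case 2
        then have "v \<in> {x, z, y}" using vu w_nbr' by blast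
        moreover have "v \<in> S" using v 2 by (auto simp: S'_def split: if_splits)
        ultimately have "z \<in> S" using step zxy by blast
        then show ?thesis using 2 by (simp add: S'_def)
      next
        case 3
        then have "v \<in> S" using v by (auto simp: S'_def split: if_splits)
        moreover have "(v, u) \<in> parcs H" using vu 3 by (simp add: H_arcs)
        ultimately show ?thesis using step by (simp add: S'_def)
      qed
    qed
  qed
  then show ?thesis using wS by (auto simp: S'_def H_verts split: if_splits)
qed

lemma strip_H: "strip H"
proof (intro strip.intro path_links.intro strip_axioms.intro)
  show "pair_graph H" by (rule graph_H)
  show "\<exists>ps. link H v ps \<and> 2 \<le> length ps" if v: "v \<in> pverts H" for v
  proof (cases "v \<in> {x, y, z}")
    case True
    then show ?thesis using link_H_x link_H_y link_H_z by blast
  next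
    case False
    then have "v \<in> pverts G" "v \<notin> {w, x, y, z}" using v by (auto simp: H_verts)
    then show ?thesis using links link_H_other by blast
  qed
  show "pverts H \<noteq> {}" using in_verts distinct_wxyz by (auto simp: H_verts)
qed (use one_solo_H connected_H in blast)+

lemma two_triangles:
  assumes "open_neighborhood H u \<inter> open_neighborhood H v = {p, q}" "p \<noteq> q" "(u, v) \<in> parcs H"
  shows "1 < card (triangles_on H u v)"
proof -
  have e: "(u, p) \<in> parcs H" "(v, p) \<in> parcs H" "(u, q) \<in> parcs H" "(v, q) \<in> parcs H"
  proof -
    have "p \<in> open_neighborhood H u \<inter> open_neighborhood H v" "q \<in> open_neighborhood H u \<inter> open_neighborhood H v"
      using assms(1) by simp_all
    then show "(u, p) \<in> parcs H" "(v, p) \<in> parcs H" "(u, q) \<in> parcs H" "(v, q) \<in> parcs H"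
      by (simp_all add: open_neighborhood_iff)
  qed
  have "{u, v, p} \<in> triangles H" "{u, v, q} \<in> triangles H"
    using e assms(3) unfolding triangles_iff[OF graph_H] by blast+
  then have sub: "{{u, v, p}, {u, v, q}} \<subseteq> triangles_on H u v" by (simp add: triangles_on_def)
  have "p \<noteq> u" "p \<noteq> v" using e pair_graph_irrefl[OF graph_H] by blast+
  then have "{u, v, p} \<noteq> {u, v, q}" using assms(2) by blast
  then have "card {{u, v, p}, {u, v, q}} = 2" by simp
  moreover have "finite (triangles_on H u v)"
  proof (rule finite_subset)
    show "triangles_on H u v \<subseteq> Pow (pverts H)" by (auto simp: triangles_on_def triangles_def)
  qed (use pair_graph_finite[OF graph_H] in simp)
  ultimately show ?thesis using card_mono[OF _ sub] by simp
qed

lemma edge_splitting_H: "edge_splitting H G"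
  unfolding edge_splitting_def
proof (intro exI conjI)
  have xyH: "(x, y) \<in> parcs H" and xzH: "(x, z) \<in> parcs H" and yzH: "(y, z) \<in> parcs H" and zyH: "(z, y) \<in> parcs H"
    using edges sym[of y z] distinct_wxyz by (simp_all add: H_arcs)
  show "(x, y) \<in> parcs H" by (rule xyH)
  show "triangles_on H x y = {{x, y, z}}"
  proof (intro equalityI subsetI)
    fix T assume "T \<in> triangles_on H x y"
    then have T: "T \<in> triangles H" "x \<in> T" "y \<in> T" by (simp_all add: triangles_on_def)
    obtain c where c: "T = {x, y, c}" "(x, c) \<in> parcs H" "(y, c) \<in> parcs H"
      using triangle_third[OF T] distinct_wxyz(4) by metis
    then have "c \<in> open_neighborhood H x \<inter> open_neighborhood H y" by (simp add: open_neighborhood_iff)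
    then show "T \<in> {{x, y, z}}" using solo_H_xy c(1) by simp
  next
    fix T assume "T \<in> {{x, y, z}}"
    then show "T \<in> triangles_on H x y"
    proof -
      have "{x, y, z} \<in> triangles H" using xyH xzH yzH unfolding triangles_iff[OF graph_H] by blast
      then show ?thesis using \<open>T \<in> {{x, y, z}}\<close> by (simp add: triangles_on_def)
    qed
  qed
  obtain a where "a \<noteq> y" "open_neighborhood H x \<inter> open_neighborhood H z = {y, a}" using xz_H by blast
  then show "1 < card (triangles_on H x z)" using two_triangles xzH by metis
  obtain b where "b \<noteq> x" "open_neighborhood H y \<inter> open_neighborhood H z = {x, b}" using yz_H by blast
  then show "1 < card (triangles_on H z y)" using two_triangles[of z y x b] zyH by (simp add: Int_commute)
  show "w \<notin> pverts H" by (simp add: H_verts)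
  have "pverts G = pverts (subdivide H (x, y) w)"
    using in_verts by (auto simp: subdivide.simps H_verts)
  moreover have "parcs G = parcs (subdivide H (x, y) w) \<union> {(w, z), (z, w)}"
  proof (intro equalityI subrelI)
    fix u v assume "(u, v) \<in> parcs G"
    then show "(u, v) \<in> parcs (subdivide H (x, y) w) \<union> {(w, z), (z, w)}"
      using w_nbr w_nbr' edges by (auto simp: subdivide.simps H_arcs)
  next
    fix u v assume "(u, v) \<in> parcs (subdivide H (x, y) w) \<union> {(w, z), (z, w)}"
    then show "(u, v) \<in> parcs G"
      using w_nbr w_nbr' edges by (auto simp: subdivide.simps H_arcs)
  qed
  ultimately show "G = \<lparr>pverts = pverts (subdivide H (x, y) w),
      parcs = parcs (subdivide H (x, y) w) \<union> {(w, z), (z, w)}\<rparr>" by simp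
qed

lemma card_H: "card (pverts H) < card (pverts G)"
  unfolding H_verts using pair_graph_finite[OF graph] in_verts(4) by (rule card_Diff1_less)

end

section \<open>Cyclic triangle graphs give strips\<close>

lemma induced_path_all:
  assumes "induced_path K ps" "ps \<noteq> []" "P (hd ps)" and step: "\<And>s s'. (s, s') \<in> parcs K \<Longrightarrow> P s \<Longrightarrow> P s'"
  shows "\<forall>s\<in>set ps. P s"
  using assms(1-3)
proof (induction ps)
  case (Cons s ps)
  show ?case
  proof (cases "ps = []")
    case False
    then have "(s, hd ps) \<in> parcs K" using Cons.prems(1) by simp
    then have "P (hd ps)" using step Cons.prems(3) by simp
    then show ?thesis using Cons False by simp
  qed (use Cons.prems in simp)
qed simp

context path_links
begin

lemma solo_iff_common:
  assumes e: "(a, b) \<in> parcs G" "(a, c) \<in> parcs G" "(b, c) \<in> parcs G"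
  shows "solo G a b \<and> open_neighborhood G a \<inter> open_neighborhood G b = {c} \<or>
    \<not> solo G a b \<and> (\<exists>p. p \<noteq> c \<and> open_neighborhood G a \<inter> open_neighborhood G b = {c, p})"
proof -
  have c: "c \<in> open_neighborhood G a \<inter> open_neighborhood G b" using e by (simp add: open_neighborhood_iff)
  show ?thesis
  proof (cases "solo G a b")
    case True
    then obtain u where u: "open_neighborhood G a \<inter> open_neighborhood G b = {u}" unfolding solo_def by blast
    then have "u = c" using c by simp
    then show ?thesis using True u by simp
  next
    case False
    then obtain p q where "inner_edge G a b p q"
      using boundary_or_inner_edge[OF e(1)] boundary_edge_solo[of G a b] by blast
    then have pq: "p \<noteq> q" "open_neighborhood G a \<inter> open_neighborhood G b = {p, q}"
      by (simp_all add: inner_edge_def)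
    then have "c = p \<or> c = q" using c by simp
    then have "\<exists>r. r \<noteq> c \<and> {p, q} = {c, r}" using pq(1) by (metis insert_commute)
    then show ?thesis using False unfolding pq(2) by simp
  qed
qed

text \<open>The triangle \<open>t = abc\<close> has exactly two neighbours \<open>h\<close> and \<open>l\<close> in the cycle. Each of them contains exactly one
edge of \<open>t\<close>; and since an edge lies in at most two triangles, these are two different edges, and they are precisely
the inner edges of \<open>t\<close>.\<close>

lemma one_solo_of_cycle:
  assumes cyc: "is_cycle (triangle_graph G)"
    and e: "(a, b) \<in> parcs G" "(b, c) \<in> parcs G" "(a, c) \<in> parcs G"
  shows "solo G a b \<and> \<not> solo G b c \<and> \<not> solo G a c \<or> \<not> solo G a b \<and> solo G b c \<and> \<not> solo G a c \<or>
      \<not> solo G a b \<and> \<not> solo G b c \<and> solo G a c"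
proof -
  let ?K = "triangle_graph G"
  have K: "pair_graph ?K" by (rule pair_graph_triangle_graph[OF graph])
  note sym = pair_graph_sym[OF graph]
  define t where "t = {a, b, c}"
  have t: "t \<in> triangles G" using e unfolding t_def triangles_iff[OF graph] by blast
  obtain ps where ps: "cyclic_order ?K t ps"
    using is_cycle_cyclic_order[OF K cyc] t by (auto simp: triangle_graph_verts)
  define h l where "h = hd ps" and "l = last ps"
  have ne: "ps \<noteq> []" and dist: "distinct ps" and len: "2 \<le> length ps"
    using ps induced_path_distinct by (auto simp: cyclic_order_def)
  have "h \<noteq> l" using ne dist len unfolding h_def l_def
    by (simp add: hd_conv_nth last_conv_nth nth_eq_iff_index_eq)
  have adj: "s = h \<or> s = l \<longleftrightarrow> s \<in> triangles G \<and> overlap t s" for s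
  proof -
    have "(t, s) \<in> parcs ?K \<longleftrightarrow> s \<in> triangles G \<and> overlap t s" using triangle_graph_arcs[OF graph] t by blast
    moreover have "(t, s) \<in> parcs ?K \<longleftrightarrow> s \<in> set ps \<and> (s = h \<or> s = l)"
    proof
      assume ts: "(t, s) \<in> parcs ?K"
      then have "s \<noteq> t" "s \<in> triangles G" using pair_graph_irrefl[OF K] calculation by blast+
      then have "s \<in> set ps" using ps by (auto simp: cyclic_order_def triangle_graph_verts)
      then show "s \<in> set ps \<and> (s = h \<or> s = l)" using ps ts by (simp add: cyclic_order_def h_def l_def)
    next
      assume "s \<in> set ps \<and> (s = h \<or> s = l)"
      then show "(t, s) \<in> parcs ?K" using ps by (simp add: cyclic_order_def h_def l_def)
    qed
    moreover have "h \<in> set ps" "l \<in> set ps" using ne by (simp_all add: h_def l_def)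
    ultimately show ?thesis by blast
  qed
  have one: "(a \<in> s \<and> b \<in> s) \<noteq> (b \<in> s \<and> c \<in> s) \<and> \<not> (a \<in> s \<and> b \<in> s \<and> c \<in> s) \<or>
      (a \<in> s \<and> c \<in> s) \<and> b \<notin> s" if s: "s = h \<or> s = l" for s
  proof -
    have sT: "s \<in> triangles G" "overlap t s" using adj[of s] s by blast+
    have "\<not> (a \<in> s \<and> b \<in> s \<and> c \<in> s)"
    proof
      assume "a \<in> s \<and> b \<in> s \<and> c \<in> s"
      then have "t \<subseteq> s" by (simp add: t_def)
      then have "t = s" using triangle_card[OF t] triangle_card[OF sT(1)] by (simp add: card_subset_eq)
      then show False using sT(2) by (simp add: overlap_def)
    qed
    moreover obtain u v where "u \<noteq> v" "u \<in> t" "v \<in> t" "u \<in> s" "v \<in> s"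
      using sT(2) by (auto simp: overlap_def)
    ultimately show ?thesis unfolding t_def by auto
  qed
  have edge: "(solo G u v \<longleftrightarrow> \<not> (u \<in> h \<and> v \<in> h) \<and> \<not> (u \<in> l \<and> v \<in> l)) \<and>
      \<not> ((u \<in> h \<and> v \<in> h) \<and> (u \<in> l \<and> v \<in> l))"
    if uvc: "(u, v) \<in> parcs G" "(u, r) \<in> parcs G" "(v, r) \<in> parcs G" "t = {u, v, r}" for u v r
  proof -
    have uv: "u \<noteq> v" using uvc(1) pair_graph_irrefl[OF graph] by blast
    have on: "\<exists>p. s = {u, v, p} \<and> p \<in> open_neighborhood G u \<inter> open_neighborhood G v \<and> p \<noteq> r"
      if s: "s = h \<or> s = l" "u \<in> s" "v \<in> s" for s
    proof -
      have sT: "s \<in> triangles G" "overlap t s" using adj[of s] s(1) by blast+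
      obtain p where "s = {u, v, p}" "(u, p) \<in> parcs G" "(v, p) \<in> parcs G"
        using triangle_third[OF sT(1) s(2,3) uv] by blast
      moreover from this have "p \<noteq> r" using sT(2) uvc(4) by (auto simp: overlap_def)
      ultimately show ?thesis by (auto simp: open_neighborhood_iff)
    qed
    from solo_iff_common[OF uvc(1-3)] show ?thesis
    proof (elim disjE conjE exE)
      assume "solo G u v" "open_neighborhood G u \<inter> open_neighborhood G v = {r}"
      then show ?thesis using on[of h] on[of l] by auto
    next
      fix p assume ns: "\<not> solo G u v" and p: "p \<noteq> r" "open_neighborhood G u \<inter> open_neighborhood G v = {r, p}"
      have unique: "s = {u, v, p}" if "s = h \<or> s = l" "u \<in> s" "v \<in> s" for s
        using on[OF that] p by auto
      have pE: "(u, p) \<in> parcs G" "(v, p) \<in> parcs G"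
      proof -
        have "p \<in> open_neighborhood G u \<inter> open_neighborhood G v" using p(2) by simp
        then show "(u, p) \<in> parcs G" "(v, p) \<in> parcs G" by (simp_all add: open_neighborhood_iff)
      qed
      then have "{u, v, p} \<in> triangles G" using uvc(1) unfolding triangles_iff[OF graph] by blast
      moreover have "p \<noteq> u" "p \<noteq> v" using pE pair_graph_irrefl[OF graph] by blast+
      then have "overlap t {u, v, p}" using uv p(1) uvc(4) by (intro overlapI[of _ _ u v]) auto
      ultimately have "{u, v, p} = h \<or> {u, v, p} = l" using adj[of "{u, v, p}"] by (simp only: simp_thms)
      then have "u \<in> h \<and> v \<in> h \<or> u \<in> l \<and> v \<in> l" by (metis insert_iff)
      moreover have "\<not> ((u \<in> h \<and> v \<in> h) \<and> (u \<in> l \<and> v \<in> l))"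
        using unique[of h] unique[of l] \<open>h \<noteq> l\<close> by metis
      ultimately show ?thesis using ns by blast
    qed
  qed
  have 1: "(b, a) \<in> parcs G" "(c, a) \<in> parcs G" "(c, b) \<in> parcs G" using e sym by blast+
  have 2: "t = {b, c, a}" "t = {a, c, b}" by (auto simp: t_def)
  have "(solo G a b \<longleftrightarrow> \<not> (a \<in> h \<and> b \<in> h) \<and> \<not> (a \<in> l \<and> b \<in> l)) \<and>
      \<not> ((a \<in> h \<and> b \<in> h) \<and> (a \<in> l \<and> b \<in> l))"
    by (rule edge[OF e(1,3,2) t_def])
  moreover have "(solo G b c \<longleftrightarrow> \<not> (b \<in> h \<and> c \<in> h) \<and> \<not> (b \<in> l \<and> c \<in> l)) \<and>
      \<not> ((b \<in> h \<and> c \<in> h) \<and> (b \<in> l \<and> c \<in> l))"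
    by (rule edge[OF e(2) 1(1,2) 2(1)])
  moreover have "(solo G a c \<longleftrightarrow> \<not> (a \<in> h \<and> c \<in> h) \<and> \<not> (a \<in> l \<and> c \<in> l)) \<and>
      \<not> ((a \<in> h \<and> c \<in> h) \<and> (a \<in> l \<and> c \<in> l))"
    by (rule edge[OF e(3,1) 1(3) 2(2)])
  ultimately show ?thesis using one[of h] one[of l] by argo
qed

text \<open>A triangle that shares an edge with a triangle inside \<open>S\<close> is itself inside \<open>S\<close>, so walking along the cycle
of triangles stays inside \<open>S\<close>; and each vertex is in some triangle.\<close>

lemma connected_of_cycle:
  assumes cyc: "is_cycle (triangle_graph G)"
    and S: "S \<noteq> {}" "S \<subseteq> pverts G" and closed: "\<And>v. v \<in> S \<Longrightarrow> open_neighborhood G v \<subseteq> S"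
  shows "S = pverts G"
proof -
  let ?K = "triangle_graph G"
  have K: "pair_graph ?K" by (rule pair_graph_triangle_graph[OF graph])
  have tri: "\<exists>T\<in>triangles G. v \<in> T" if v: "v \<in> pverts G" for v
  proof -
    obtain ps where ps: "link G v ps" "2 \<le> length ps" using links[OF v] by blast
    then obtain p q bs where "ps = p # q # bs" by (cases ps; cases "tl ps") auto
    then have "(v, p) \<in> parcs G" "(p, q) \<in> parcs G" "(v, q) \<in> parcs G"
      using boundary_edge_arcs[OF link_first[OF graph, of v p q bs]] ps(1) by auto
    then have "{v, p, q} \<in> triangles G" unfolding triangles_iff[OF graph] by blast
    then show ?thesis by blast
  qed
  have step: "s' \<subseteq> S" if s: "(s, s') \<in> parcs ?K" "s \<subseteq> S" for s s'
  proof -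
    have s': "s' \<in> triangles G" "overlap s s'" using s(1) triangle_graph_arcs[OF graph] by auto
    then obtain u v where uv: "u \<noteq> v" "u \<in> s" "v \<in> s" "u \<in> s'" "v \<in> s'" by (auto simp: overlap_def)
    obtain c where "s' = {u, v, c}" "(u, c) \<in> parcs G"
      using triangle_third[OF s'(1) uv(4,5,1)] by blast
    moreover have "u \<in> S" "v \<in> S" using uv s(2) by blast+
    ultimately show ?thesis using closed[of u] by (auto simp: open_neighborhood_def)
  qed
  obtain v where v: "v \<in> S" using S(1) by blast
  then obtain t where t: "t \<in> triangles G" "v \<in> t" using tri S(2) by blast
  have tS: "t \<subseteq> S"
  proof
    fix u assume "u \<in> t"
    then show "u \<in> S" using triangle_arc[OF t(1) t(2), of u] closed[OF v] v
      by (cases "u = v") (auto simp: open_neighborhood_def)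
  qed
  obtain ps where ps: "cyclic_order ?K t ps"
    using is_cycle_cyclic_order[OF K cyc] t by (auto simp: triangle_graph_verts)
  have ne: "ps \<noteq> []" using ps by (auto simp: cyclic_order_def)
  then have "(t, hd ps) \<in> parcs ?K" using ps by (simp add: cyclic_order_def)
  then have "hd ps \<subseteq> S" using step tS by blast
  then have "\<forall>s\<in>set ps. s \<subseteq> S"
    using induced_path_all[of ?K ps "\<lambda>s. s \<subseteq> S"] ps ne step by (auto simp: cyclic_order_def)
  moreover have "triangles G = insert t (set ps)" using ps by (simp add: cyclic_order_def triangle_graph_verts)
  ultimately have "T \<subseteq> S" if "T \<in> triangles G" for T using that tS by auto
  then have "pverts G \<subseteq> S" using tri by blast
  then show ?thesis using S(2) by blast
qed

lemma strip_of_cycle: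
  assumes cyc: "is_cycle (triangle_graph G)"
  shows "strip G"
proof (intro strip.intro strip_axioms.intro)
  show "path_links G" by (rule path_links_axioms)
  have "pair_graph (triangle_graph G)" by (rule pair_graph_triangle_graph[OF graph])
  then obtain n f where "3 \<le> n" "graph_iso_map (triangle_graph G) (cycle_graph n) f"
    using cyc is_cycle_iff by blast
  then have "f ` pverts (triangle_graph G) = {..<n}" "0 < n"
    by (auto simp: graph_iso_map_def bij_betw_def cycle_graph_verts)
  then have "pverts (triangle_graph G) \<noteq> {}" by force
  then obtain T where "T \<in> triangles G" by (auto simp: triangle_graph_verts)
  then show "pverts G \<noteq> {}" using triangle_card[of T G] by (auto simp: triangles_def)
qed (fact one_solo_of_cycle[OF cyc], rule connected_of_cycle[OF cyc])

end

section \<open>The characterisation\<close>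

text \<open>If some vertex of degree three can be removed, the induction hypothesis applies to the smaller strip; otherwise
the strip is irreducible with a vertex of degree three, or it has no such vertex.\<close>

theorem strip_reduction:
  assumes "strip G"
  shows "\<exists>H. pair_graph H \<and> (is_cycle_square H \<or> is_S_graph H) \<and> edge_splitting\<^sup>*\<^sup>* H G"
  using assms
proof (induction "card (pverts G)" arbitrary: G rule: less_induct)
  case less
  interpret strip G by (rule less.prems)
  consider (contractible) w x y z where "link G w [x, z, y]"
      "\<And>q. (x, q) \<in> parcs G \<Longrightarrow> (y, q) \<in> parcs G \<Longrightarrow> q = z \<or> q = w"
    | (rigid) w x y z where "link G w [x, z, y]"
      "\<And>w x y z. link G w [x, z, y] \<Longrightarrow> \<exists>q. (x, q) \<in> parcs G \<and> (y, q) \<in> parcs G \<and> q \<noteq> z \<and> q \<noteq> w"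
    | (zigzag) "\<And>v p q r. \<not> link G v [p, q, r]"
    by blast
  then show ?case
  proof cases
    case contractible
    interpret contractible_strip G w x y z using contractible by unfold_locales
    obtain K where "pair_graph K \<and> (is_cycle_square K \<or> is_S_graph K)" "edge_splitting\<^sup>*\<^sup>* K H"
      using less.hyps[OF card_H strip_H] by blast
    then show ?thesis using edge_splitting_H by (meson rtranclp.rtrancl_into_rtrancl)
  next
    case rigid
    interpret irreducible_strip G using rigid(2) by unfold_locales
    show ?thesis using is_S_graph_of_degree_three[OF rigid(1)] graph by blast
  next
    case zigzag
    interpret zigzag_strip G using zigzag by unfold_locales
    show ?thesis using is_cycle_square graph by blast
  qed
qed

lemma is_cycle_base:
  assumes H: "pair_graph H" and base: "is_cycle_square H \<or> is_S_graph H"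
  shows "is_cycle (triangle_graph H)"
  using base
proof
  assume "is_cycle_square H"
  then obtain k where k: "7 \<le> k" "digraph_iso (with_proj H) (with_proj (graph_square (cycle_graph k)))"
    by (auto simp: is_cycle_square_def)
  have "pair_graph (graph_square (cycle_graph k))"
    using k(1) by (intro pair_graph_graph_square pair_graph_cycle_graph) simp
  then show ?thesis by (rule is_cycle_triangle_graph_iso[OF H _ k(2) is_cycle_square_triangles[OF k(1)]])
next
  assume "is_S_graph H"
  then obtain S where S: "S \<in> {S_A, S_B, S_C, S_D}" "digraph_iso (with_proj H) (with_proj S)"
    by (auto simp: is_S_graph_def)
  have "is_cycle (triangle_graph S)"
    using S(1) is_cycle_S_A is_cycle_S_B is_cycle_S_C is_cycle_S_D by auto
  then show ?thesis by (rule is_cycle_triangle_graph_iso[OF H pair_graph_S[OF S(1)] S(2)])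
qed

lemma is_cycle_splittings:
  assumes "edge_splitting\<^sup>*\<^sup>* H G" "pair_graph H" "is_cycle (triangle_graph H)"
  shows "pair_graph G \<and> is_cycle (triangle_graph G)"
  using assms(1)
proof induction
  case (step G G')
  then show ?case using edge_splitting_is_cycle by blast
qed (use assms in simp)

theorem corollary5:
  fixes G :: "'a pair_pre_digraph"
  assumes "pair_graph G"
    and "\<And>v. v \<in> pverts G \<Longrightarrow>
           \<exists>m \<ge> 2. digraph_iso (with_proj G \<restriction> open_neighborhood G v) (with_proj (path_graph m))"
  shows "(\<exists>n \<ge> 3. digraph_iso (with_proj (triangle_graph G)) (with_proj (cycle_graph n))) \<longleftrightarrow>
      is_cycle_square G
    \<or> is_S_graph G
    \<or> (\<exists>H :: 'a pair_pre_digraph. pair_graph H \<and> (is_cycle_square H \<or> is_S_graph H)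
         \<and> edge_splitting\<^sup>*\<^sup>* H G)"
  unfolding is_cycle_def[symmetric]
proof
  assume cyc: "is_cycle (triangle_graph G)"
  have "path_links G"
  proof (rule path_links.intro)
    show "pair_graph G" by (rule assms(1))
    show "\<exists>ps. link G v ps \<and> 2 \<le> length ps" if v: "v \<in> pverts G" for v
      using link_of_path_neighborhood[OF assms(1) v] assms(2)[OF v] by blast
  qed
  then have "strip G" using cyc by (rule path_links.strip_of_cycle)
  then show "is_cycle_square G \<or> is_S_graph G \<or>
      (\<exists>H :: 'a pair_pre_digraph. pair_graph H \<and> (is_cycle_square H \<or> is_S_graph H) \<and> edge_splitting\<^sup>*\<^sup>* H G)"
    using strip_reduction[of G] by blast
next
  assume "is_cycle_square G \<or> is_S_graph G \<or>
      (\<exists>H :: 'a pair_pre_digraph. pair_graph H \<and> (is_cycle_square H \<or> is_S_graph H) \<and> edge_splitting\<^sup>*\<^sup>* H G)"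
  moreover have "edge_splitting\<^sup>*\<^sup>* G G" by (rule rtranclp.rtrancl_refl)
  ultimately obtain H :: "'a pair_pre_digraph"
    where H: "pair_graph H" "is_cycle_square H \<or> is_S_graph H" "edge_splitting\<^sup>*\<^sup>* H G"
    using assms(1) by metis
  then show "is_cycle (triangle_graph G)"
    using is_cycle_splittings[OF H(3,1)] is_cycle_base[OF H(1,2)] by blast
qed

end
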